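(* Typical divisor classes are represented by valid triples $(F,G,G_1)$, as defined in the context. The following procedures compute negation, addition and doubling, with the stated necessary and sufficient conditions for success. (1) Negation. Replace $(F,G,G_1)$ by $(F,G_1,G)$. This exchanges the roles of $D$ and its flip $A$ (so it represents $-[D-gP_\infty]$), and succeeds in all cases; both divisors remain typical. (2) Addition. Let $(F,G,G_1)$, $(F',G',G_1')$ be valid triples representing divisors $D$, $D'$. (a) Compute an echelon basis of $W^{4g}_D=FW^{2g}+GW^{2g-1}$ and select its first $g+2$ elements; this yields a basis of $W^{3g+1}_D$. Do the same for $W^{3g+1}_{D'}$. Apply the intersection procedure to $W^{3g+1}_D$ and $W^{3g+1}_{D'}$. This step succeeds if and only if $D$ and $D'$ are disjoint and $D+D'$ is semi-typical, in which case one correctly obtains $s\in W^{3g}_{D+D'}$ and $t\in W^{3g+1}_{D+D'}$ (of degrees $3g$ and $3g+1$). (b) Write $\operatorname{div}s=D+D'+D''$ and apply the flipping procedure with $N=2g+1$ to $D+D'$ with $(s,t)$; this produces $\{F'',G''\}$ describing $D''$, and succeeds if and only if $D+D'$ is typical. (c) Apply the flipping procedure with $N=2g+1$ to $D''$ with $(F'',G'')$; if successful, this certifies that $D''$ is typical and produces a divisor $D'''$ represented by $F''',G'''$ (where in fact $F'''=F''$), and $D'''$ is typical. Return $(F''',G''',G'')$, which represents the sum $[D'''-gP_\infty]=[D-gP_\infty]+[D'-gP_\infty]$. Given that $D,D'$ and their flips are typical, the whole procedure succeeds if and only if $D,D'$ are disjoint and $D''$ and $D'''$ are both typical. (3) Doubling.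 Let $(F,G,G_1)$ be a valid triple representing $D$. Compute $H_1=-GG_1/F$, then apply the doubling procedure with $N=3g+1$ to obtain $s,t\in W^{3g+1}_{2D}$ (of degrees $3g$ and $3g+1$), with $\operatorname{div}s=2D+D''$; then do two flips exactly as in steps (b) and (c) (with $2D$ in place of $D+D'$), obtaining representations of $D''$ and $D'''$, with $[D'''-gP_\infty]=2[D-gP_\infty]$, and return $(F''',G''',G'')$. Success occurs if and only if $2D$ (hence also $D'''$) and $D''$ are typical.
   Context: $K$ is a field and $C$ is a smooth projective (geometrically irreducible) curve of genus $g\ge1$ over $K$ with a $K$-rational point $P_\infty$; $R$ is the coordinate ring of the affine curve $C-\{P_\infty\}$; for nonzero $f\in R$, $\deg f$ is the order of the pole of $f$ at $P_\infty$ ($\deg 0=-\infty$). $W^N=\{f\in R:\deg f\le N\}$. A good divisor is an effective $K$-rational divisor whose support does not contain $P_\infty$. For $f\in R$ nonzero, $\operatorname{div} f$ denotes only the affine part of the divisor of $f$ (the component at $P_\infty$ is ignored), so $\operatorname{div} f$ is a good divisor of degree $\deg f$. For a good divisor $D$, $I_D=\{f\in R: f=0 \text{ or } \operatorname{div} f\ge D\}$ and $W^N_D=W^N\cap I_D$. A divisor $D$ is typical if it is good of degree $d\ge g$ and there exist $s\in W^{d+g}_D$, $t\in W^{d+g+1}_D$ with $sW^{2g}+tW^{2g-1}+W^{d+g-1}=W^{d+3g}$. A divisor $D$ is semi-typical if it is good of degree $d\ge g$ and $W^{d+g-1}_D=0$. Bases of subspaces of $R$ are echelon: ordered by strictly increasing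 degree of their elements. A pair $(F,G)$ describes (or represents) a semi-typical divisor $D$ of degree $g$ if $F\in W^{2g}_D$, $G\in W^{2g+1}_D$, $\deg F=2g$, $\deg G=2g+1$. The flip of such a $D$ is the divisor $A$ of degree $g$ with $\operatorname{div}F=D+A$. Valid triple: $(F,G,G_1)$ such that, for a typical divisor $D$ of degree $g$ described by $(F,G)$, the flip $A$ ($\operatorname{div}F=D+A$) is also typical and is described by $(F,G_1)$, i.e. $G_1\in W^{2g+1}_A$ has degree $2g+1$. It represents the class $[D-gP_\infty]\in\mathrm{Pic}^0(C)$. Intersection procedure for $D,D'$ of degree $g$, with $N=3g+1$: compute $W^N_D\cap W^N_{D'}$ together with $W^{3g-1}_D\cap W^{3g-1}_{D'}$. It fails if the latter is nonzero; otherwise it succeeds and returns the echelon basis of $W^N_D\cap W^N_{D'}$ as a basis of $W^N_{D+D'}$. Flipping procedure for a good divisor $D$ of degree $d\ge g$, with $s\in W^{d+g}_D$, $t\in W^{d+g+1}_D$ of degrees exactly $d+g$, $d+g+1$, and $N\ge 2g-1$: with $\operatorname{div}s=D+A$, compute $W'=\{\ell\in W^N:\ell t\in sW^{N+1}+W^{d+g-1}\}$ and $\hat W=W'\cap W^{2g-1}$. It fails if $\hat W\ne0$; otherwise it succeeds and returns an echelon basis of $W'$ as a basis of $W^N_A$. (With $N=2g+1$ this basis consists of two elements, of degrees $2g$ and $2g+1$.) Doubling procedure, for $D$ described by $(F,G)$, its flip $A$ described by $(F,G_1)$, $H_1\in W^{2g+2}$ with $GG_1+FH_1=0$, and $N\ge3g-1$: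 compute $W''=\{\ell=\alpha F+\beta G\in W^N_D : \alpha,\beta\in R,\ \alpha G_1-\beta H_1\in W^{N+1}_D\}$ and $W''\cap W^{3g-1}$. It fails if $W''\cap W^{3g-1}\neq0$; otherwise it succeeds and returns an echelon basis of $W''$ as a basis of $W^N_{2D}$. A composite procedure succeeds if all its steps succeed. *)

theory Defs
  imports
    "HOL-Computational_Algebra.Polynomial"
    "HOL-Algebra.Coset"
    "HOL-Algebra.Algebraic_Closure_Type"
    "HOL-Library.Set_Algebras"
    "HOL-Library.Function_Algebras"
begin

text \<open>
  A smooth projective curve over \<open>K\<close> is given by its function field: the type \<open>'k\<close> is the base
  field, the type \<open>'a\<close> is the function field, and \<open>emb\<close> embeds the former in the latter.
  As in the classical construction of the nonsingular projective model, a closed point of the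
  curve is a normalized discrete valuation of the function field that is trivial on \<open>K\<close>, i.e. the
  function "order of vanishing at the point".  Convention: such a valuation has value \<open>0\<close> at \<open>0\<close>,
  so that it is determined by its values at nonzero functions; order conditions on a function
  that may vanish therefore always treat the zero function separately.
  The component \<open>infty\<close> is the distinguished point at infinity.
\<close>

record ('k, 'a) curve =
  emb :: "'k \<Rightarrow> 'a"
  infty :: "'a \<Rightarrow> int"

definition scl :: "('k::field, 'a::field) curve \<Rightarrow> 'k \<Rightarrow> 'a \<Rightarrow> 'a" where
  "scl C c f = emb C c * f"

abbreviation kspan :: "('k::field, 'a::field) curve \<Rightarrow> 'a set \<Rightarrow> 'a set" where
  "kspan C \<equiv> Modules.module.span (scl C)"

abbreviation kindependent :: "('k::field, 'a::field) curve \<Rightarrow> 'a set \<Rightarrow> bool" where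
  "kindependent C B \<equiv> \<not> Modules.module.dependent (scl C) B"

abbreviation kdim :: "('k::field, 'a::field) curve \<Rightarrow> 'a set \<Rightarrow> nat" where
  "kdim C \<equiv> Vector_Spaces.vector_space.dim (scl C)"

definition field_embedding :: "('k::field \<Rightarrow> 'a::field) \<Rightarrow> bool" where
  "field_embedding \<iota> \<longleftrightarrow>
     \<iota> 1 = 1 \<and> (\<forall>x y. \<iota> (x + y) = \<iota> x + \<iota> y) \<and> (\<forall>x y. \<iota> (x * y) = \<iota> x * \<iota> y)"

text \<open>Finitely generated of transcendence degree one: finite over some \<open>K(x)\<close> with \<open>x\<close> transcendental.\<close>

definition rat_functions_in :: "('k::field, 'a::field) curve \<Rightarrow> 'a \<Rightarrow> 'a set" where
  "rat_functions_in C x =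
     {poly (map_poly (emb C) p) x / poly (map_poly (emb C) q) x | p q. q \<noteq> 0}"

definition function_field :: "('k::field, 'a::field) curve \<Rightarrow> bool" where
  "function_field C \<longleftrightarrow> field_embedding (emb C) \<and>
     (\<exists>x. (\<forall>p. p \<noteq> 0 \<longrightarrow> poly (map_poly (emb C) p) x \<noteq> 0) \<and>
          (\<exists>B. finite B \<and>
             (\<forall>y. \<exists>c. c ` B \<subseteq> rat_functions_in C x \<and> y = (\<Sum>b\<in>B. c b * b))))"

definition points :: "('k::field, 'a::field) curve \<Rightarrow> ('a \<Rightarrow> int) set" where
  "points C = {P. P 0 = 0 \<and> 1 \<in> P ` (UNIV - {0}) \<and>
     (\<forall>f h. f \<noteq> 0 \<longrightarrow> h \<noteq> 0 \<longrightarrow> P (f * h) = P f + P h) \<and>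
     (\<forall>f h. f \<noteq> 0 \<longrightarrow> h \<noteq> 0 \<longrightarrow> f + h \<noteq> 0 \<longrightarrow> min (P f) (P h) \<le> P (f + h)) \<and>
     (\<forall>c. c \<noteq> 0 \<longrightarrow> P (emb C c) = 0)}"

definition local_ring :: "('a::field \<Rightarrow> int) \<Rightarrow> 'a set" where
  "local_ring P = {f. f = 0 \<or> 0 \<le> P f}"

definition max_ideal :: "('a::field \<Rightarrow> int) \<Rightarrow> 'a set" where
  "max_ideal P = {f. f = 0 \<or> 0 < P f}"

definition rational_point :: "('k::field, 'a::field) curve \<Rightarrow> ('a \<Rightarrow> int) \<Rightarrow> bool" where
  "rational_point C P \<longleftrightarrow> P \<in> points C \<and> local_ring P = range (emb C) + max_ideal P"

text \<open>
  Geometric properties.  Both \<open>'a\<close> and an algebraic closure of \<open>K\<close> (the set \<open>kbar\<close>) live in the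
  algebraic closure of \<open>'a\<close>.  The curve is geometrically integral iff the function field and
  \<open>kbar\<close> are linearly disjoint over \<open>K\<close>.  In that case, for a \<open>K\<close>-subalgebra \<open>S\<close> of \<open>'a\<close>, the set
  \<open>kbar_span C S\<close> is the base change of \<open>S\<close> to \<open>kbar\<close>.  Smoothness at \<open>P\<close> means
  that the base change of the local ring at \<open>P\<close> is regular; as this base change is a
  one-dimensional noetherian domain with field of fractions \<open>kbar_span C UNIV\<close>, this means that
  it is integrally closed in that field.
\<close>

definition kbar :: "('k::field, 'a::field) curve \<Rightarrow> 'a alg_closure set" where
  "kbar C = {z. \<exists>p. p \<noteq> 0 \<and> poly (map_poly (\<lambda>c. to_ac (emb C c)) p) z = 0}"

definition kbar_span :: "('k::field, 'a::field) curve \<Rightarrow> 'a set \<Rightarrow> 'a alg_closure set" where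
  "kbar_span C S = {\<Sum>b\<in>B. c b * to_ac b | B c. finite B \<and> B \<subseteq> S \<and> c ` B \<subseteq> kbar C}"

definition geometrically_integral :: "('k::field, 'a::field) curve \<Rightarrow> bool" where
  "geometrically_integral C \<longleftrightarrow>
     (\<forall>B c. finite B \<longrightarrow> kindependent C B \<longrightarrow> c ` B \<subseteq> kbar C \<longrightarrow>
        (\<Sum>b\<in>B. c b * to_ac b) = 0 \<longrightarrow> (\<forall>b\<in>B. c b = 0))"

definition smooth_at :: "('k::field, 'a::field) curve \<Rightarrow> ('a \<Rightarrow> int) \<Rightarrow> bool" where
  "smooth_at C P \<longleftrightarrow>
     (\<forall>z \<in> kbar_span C UNIV.
        (\<exists>p. lead_coeff p = 1 \<and> (\<forall>i. coeff p i \<in> kbar_span C (local_ring P)) \<and> poly p z = 0)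
        \<longrightarrow> z \<in> kbar_span C (local_ring P))"

definition smooth_pointed_curve :: "('k::field, 'a::field) curve \<Rightarrow> bool" where
  "smooth_pointed_curve C \<longleftrightarrow> function_field C \<and> geometrically_integral C \<and>
     (\<forall>P\<in>points C. smooth_at C P) \<and> rational_point C (infty C)"

section \<open>Divisors, genus, and the degree zero Picard group\<close>

text \<open>
  A \<open>K\<close>-rational divisor is an integral combination of closed points, weighted in the degree by the
  degrees of their residue fields over \<open>K\<close>.  Sum, difference and order are pointwise.
\<close>

type_synonym 'a divisor = "('a \<Rightarrow> int) \<Rightarrow> int"

definition is_divisor :: "('k::field, 'a::field) curve \<Rightarrow> 'a divisor \<Rightarrow> bool" where
  "is_divisor C D \<longleftrightarrow> finite {P. D P \<noteq> 0} \<and> {P. D P \<noteq> 0} \<subseteq> points C"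

text \<open>Dimension of the residue field: the minimal number of generators modulo the maximal ideal.\<close>

definition point_deg :: "('k::field, 'a::field) curve \<Rightarrow> ('a \<Rightarrow> int) \<Rightarrow> nat" where
  "point_deg C P = (LEAST n. \<exists>B. finite B \<and> card B = n \<and> B \<subseteq> local_ring P \<and>
     local_ring P = kspan C B + max_ideal P)"

definition div_deg :: "('k::field, 'a::field) curve \<Rightarrow> 'a divisor \<Rightarrow> int" where
  "div_deg C D = (\<Sum>P | D P \<noteq> 0. D P * int (point_deg C P))"

definition principal_div :: "('k::field, 'a::field) curve \<Rightarrow> 'a \<Rightarrow> 'a divisor" where
  "principal_div C f = (\<lambda>P. if P \<in> points C then P f else 0)"

definition RR_space :: "('k::field, 'a::field) curve \<Rightarrow> 'a divisor \<Rightarrow> 'a set" where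
  "RR_space C D = {f. f = 0 \<or> 0 \<le> principal_div C f + D}"

text \<open>The genus is the maximum of \<open>deg D + 1 - \<ell>(D)\<close> over all divisors (attained, and at least \<open>0\<close>
  because of \<open>D = 0\<close>).\<close>

definition genus :: "('k::field, 'a::field) curve \<Rightarrow> nat" where
  "genus C = (GREATEST n. \<exists>D. is_divisor C D \<and>
     int n = div_deg C D + 1 - int (kdim C (RR_space C D)))"

definition div_group :: "('k::field, 'a::field) curve \<Rightarrow> 'a divisor monoid" where
  "div_group C = \<lparr>carrier = {D. is_divisor C D \<and> div_deg C D = 0}, monoid.mult = (+), monoid.one = 0\<rparr>"

definition principal_divs :: "('k::field, 'a::field) curve \<Rightarrow> 'a divisor set" where
  "principal_divs C = principal_div C ` (UNIV - {0})"

definition Pic0 :: "('k::field, 'a::field) curve \<Rightarrow> 'a divisor set monoid" where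
  "Pic0 C = div_group C Mod principal_divs C"

text \<open>The class of \<open>D - g P\<^sub>\<infinity>\<close>, for \<open>D\<close> of degree \<open>g\<close>.\<close>

definition pic_class :: "('k::field, 'a::field) curve \<Rightarrow> 'a divisor \<Rightarrow> 'a divisor set" where
  "pic_class C D = principal_divs C #>\<^bsub>div_group C\<^esub>
     (D - (\<lambda>P. if P = infty C then int (genus C) else 0))"

section \<open>The affine coordinate ring, good divisors, typical divisors\<close>

definition reg_ring :: "('k::field, 'a::field) curve \<Rightarrow> 'a set" where
  "reg_ring C = {f. f = 0 \<or> (\<forall>P \<in> points C - {infty C}. 0 \<le> P f)}"

text \<open>Only meaningful for nonzero functions.\<close>

definition pole_deg :: "('k::field, 'a::field) curve \<Rightarrow> 'a \<Rightarrow> int" where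
  "pole_deg C f = - infty C f"

definition has_deg :: "('k::field, 'a::field) curve \<Rightarrow> 'a \<Rightarrow> int \<Rightarrow> bool" where
  "has_deg C f n \<longleftrightarrow> f \<noteq> 0 \<and> pole_deg C f = n"

definition W :: "('k::field, 'a::field) curve \<Rightarrow> int \<Rightarrow> 'a set" where
  "W C N = {f \<in> reg_ring C. f = 0 \<or> pole_deg C f \<le> N}"

definition affine_div :: "('k::field, 'a::field) curve \<Rightarrow> 'a \<Rightarrow> 'a divisor" where
  "affine_div C f = (\<lambda>P. if P \<in> points C - {infty C} then P f else 0)"

definition good :: "('k::field, 'a::field) curve \<Rightarrow> 'a divisor \<Rightarrow> bool" where
  "good C D \<longleftrightarrow> is_divisor C D \<and> 0 \<le> D \<and> D (infty C) = 0"

definition disjoint_divs :: "'a divisor \<Rightarrow> 'a divisor \<Rightarrow> bool" where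
  "disjoint_divs D E \<longleftrightarrow> (\<forall>P. D P = 0 \<or> E P = 0)"

definition div_ideal :: "('k::field, 'a::field) curve \<Rightarrow> 'a divisor \<Rightarrow> 'a set" where
  "div_ideal C D = {f \<in> reg_ring C. f = 0 \<or> D \<le> affine_div C f}"

definition WD :: "('k::field, 'a::field) curve \<Rightarrow> int \<Rightarrow> 'a divisor \<Rightarrow> 'a set" where
  "WD C N D = W C N \<inter> div_ideal C D"

definition typical :: "('k::field, 'a::field) curve \<Rightarrow> 'a divisor \<Rightarrow> bool" where
  "typical C D \<longleftrightarrow> (let g = int (genus C); d = div_deg C D in
     good C D \<and> g \<le> d \<and>
     (\<exists>s \<in> WD C (d + g) D. \<exists>t \<in> WD C (d + g + 1) D.
        s *o W C (2 * g) + t *o W C (2 * g - 1) + W C (d + g - 1) = W C (d + 3 * g)))"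

definition semi_typical :: "('k::field, 'a::field) curve \<Rightarrow> 'a divisor \<Rightarrow> bool" where
  "semi_typical C D \<longleftrightarrow> (let g = int (genus C); d = div_deg C D in
     good C D \<and> g \<le> d \<and> WD C (d + g - 1) D = {0})"

definition describes ::
  "('k::field, 'a::field) curve \<Rightarrow> 'a \<Rightarrow> 'a \<Rightarrow> 'a divisor \<Rightarrow> bool" where
  "describes C F G D \<longleftrightarrow> (let g = int (genus C) in
     semi_typical C D \<and> div_deg C D = g \<and>
     F \<in> WD C (2 * g) D \<and> has_deg C F (2 * g) \<and>
     G \<in> WD C (2 * g + 1) D \<and> has_deg C G (2 * g + 1))"

text \<open>\<open>(F, G, G\<^sub>1)\<close> is a valid triple representing \<open>D\<close>; the divisor \<open>A\<close> is the flip of \<open>D\<close>.\<close>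

definition valid_triple ::
  "('k::field, 'a::field) curve \<Rightarrow> 'a \<Rightarrow> 'a \<Rightarrow> 'a \<Rightarrow> 'a divisor \<Rightarrow> bool" where
  "valid_triple C F G G1 D \<longleftrightarrow> typical C D \<and> describes C F G D \<and>
     (\<exists>A. affine_div C F = D + A \<and> typical C A \<and> describes C F G1 A)"

section \<open>The procedures\<close>

text \<open>
  An echelon basis is not unique, so a procedure is modelled as a relation between its inputs and
  its possible outcomes: \<open>None\<close> is failure, and \<open>Some out\<close> is success with output \<open>out\<close>.
\<close>

definition echelon_basis :: "('k::field, 'a::field) curve \<Rightarrow> 'a set \<Rightarrow> 'a list \<Rightarrow> bool" where
  "echelon_basis C V bs \<longleftrightarrow> 0 \<notin> set bs \<and> sorted_wrt (\<lambda>a b. pole_deg C a < pole_deg C b) bs \<and>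
     kindependent C (set bs) \<and> kspan C (set bs) = V"

definition basis_or_fail ::
  "('k::field, 'a::field) curve \<Rightarrow> 'a set \<Rightarrow> 'a set \<Rightarrow> 'a list option \<Rightarrow> bool" where
  "basis_or_fail C V V0 r \<longleftrightarrow>
     (if V0 \<noteq> {0} then r = None else (\<exists>bs. r = Some bs \<and> echelon_basis C V bs))"

text \<open>
  The inputs are bases of \<open>WD C (3 g + 1) D\<close> and \<open>WD C (3 g + 1) D'\<close>, which determine
  \<open>WD C (3 g - 1) D\<close> and \<open>WD C (3 g - 1) D'\<close> as the subspaces of elements of degree at most \<open>3 g - 1\<close>.
\<close>

definition intersection_run ::
  "('k::field, 'a::field) curve \<Rightarrow> 'a list \<Rightarrow> 'a list \<Rightarrow> 'a list option \<Rightarrow> bool" where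
  "intersection_run C b b' r \<longleftrightarrow> (let g = int (genus C) in
     basis_or_fail C (kspan C (set b) \<inter> kspan C (set b'))
       ((kspan C (set b) \<inter> W C (3 * g - 1)) \<inter> (kspan C (set b') \<inter> W C (3 * g - 1))) r)"

text \<open>Here \<open>d\<close> is the degree of the divisor to be flipped.\<close>

definition flip_run ::
  "('k::field, 'a::field) curve \<Rightarrow> int \<Rightarrow> int \<Rightarrow> 'a \<Rightarrow> 'a \<Rightarrow> 'a list option \<Rightarrow> bool" where
  "flip_run C N d s t r \<longleftrightarrow> (let g = int (genus C);
       W' = {l \<in> W C N. l * t \<in> s *o W C (N + 1) + W C (d + g - 1)}
     in basis_or_fail C W' (W' \<inter> W C (2 * g - 1)) r)"

definition doubling_run ::
  "('k::field, 'a::field) curve \<Rightarrow> int \<Rightarrow> 'a divisor \<Rightarrow> 'a \<Rightarrow> 'a \<Rightarrow> 'a \<Rightarrow> 'a \<Rightarrow> 'a list option \<Rightarrow> bool"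
  where
  "doubling_run C N D F G G1 H1 r \<longleftrightarrow> (let g = int (genus C);
       W'' = {\<alpha> * F + \<beta> * G | \<alpha> \<beta>. \<alpha> \<in> reg_ring C \<and> \<beta> \<in> reg_ring C \<and>
                \<alpha> * F + \<beta> * G \<in> WD C N D \<and> \<alpha> * G1 - \<beta> * H1 \<in> WD C (N + 1) D}
     in basis_or_fail C W'' (W'' \<inter> W C (3 * g - 1)) r)"

definition selected_basis ::
  "('k::field, 'a::field) curve \<Rightarrow> 'a \<Rightarrow> 'a \<Rightarrow> 'a list \<Rightarrow> bool" where
  "selected_basis C F G b \<longleftrightarrow> (\<exists>b0.
     echelon_basis C (F *o W C (2 * int (genus C)) + G *o W C (2 * int (genus C) - 1)) b0 \<and>
     b = take (genus C + 2) b0)"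

definition add_start_run ::
  "('k::field, 'a::field) curve \<Rightarrow> 'a \<Rightarrow> 'a \<Rightarrow> 'a \<Rightarrow> 'a \<Rightarrow> 'a list option \<Rightarrow> bool" where
  "add_start_run C F G F' G' r \<longleftrightarrow>
     (\<exists>b b'. selected_basis C F G b \<and> selected_basis C F' G' b' \<and> intersection_run C b b' r)"

definition double_start_run ::
  "('k::field, 'a::field) curve \<Rightarrow> 'a divisor \<Rightarrow> 'a \<Rightarrow> 'a \<Rightarrow> 'a \<Rightarrow> 'a list option \<Rightarrow> bool" where
  "double_start_run C D F G G1 r \<longleftrightarrow>
     doubling_run C (3 * int (genus C) + 1) D F G G1 (- (G * G1) / F) r"

text \<open>Two successive flips, first of a divisor of degree \<open>2 g\<close>, then of one of degree \<open>g\<close>.\<close>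

definition two_flips_run ::
  "('k::field, 'a::field) curve \<Rightarrow> 'a \<Rightarrow> 'a \<Rightarrow> ('a \<times> 'a \<times> 'a) option \<Rightarrow> bool" where
  "two_flips_run C s t r \<longleftrightarrow> (let g = int (genus C) in
     \<exists>r2. flip_run C (2 * g + 1) (2 * g) s t r2 \<and>
       (case r2 of None \<Rightarrow> r = None
        | Some b2 \<Rightarrow> \<exists>r3. flip_run C (2 * g + 1) g (b2 ! 0) (b2 ! 1) r3 \<and>
            r = map_option (\<lambda>b3. (b3 ! 0, b3 ! 1, b2 ! 1)) r3))"

definition add_run ::
  "('k::field, 'a::field) curve \<Rightarrow> 'a \<Rightarrow> 'a \<Rightarrow> 'a \<Rightarrow> 'a \<Rightarrow> ('a \<times> 'a \<times> 'a) option \<Rightarrow> bool" where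
  "add_run C F G F' G' r \<longleftrightarrow> (\<exists>r1. add_start_run C F G F' G' r1 \<and>
     (case r1 of None \<Rightarrow> r = None | Some b \<Rightarrow> two_flips_run C (b ! 0) (b ! 1) r))"

definition double_run ::
  "('k::field, 'a::field) curve \<Rightarrow> 'a divisor \<Rightarrow> 'a \<Rightarrow> 'a \<Rightarrow> 'a \<Rightarrow> ('a \<times> 'a \<times> 'a) option \<Rightarrow> bool" where
  "double_run C D F G G1 r \<longleftrightarrow> (\<exists>r1. double_start_run C D F G G1 r1 \<and>
     (case r1 of None \<Rightarrow> r = None | Some b \<Rightarrow> two_flips_run C (b ! 0) (b ! 1) r))"

text \<open>
  \<open>flip_via C n E f A\<close>: the function \<open>f\<close> of degree exactly \<open>n\<close> vanishes on \<open>E\<close>, and \<open>A\<close> is the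
  residual divisor.  It makes sense, and is used below, also when no procedure has succeeded.
\<close>

definition flip_via ::
  "('k::field, 'a::field) curve \<Rightarrow> int \<Rightarrow> 'a divisor \<Rightarrow> 'a \<Rightarrow> 'a divisor \<Rightarrow> bool" where
  "flip_via C n E f A \<longleftrightarrow> f \<in> WD C n E \<and> has_deg C f n \<and> affine_div C f = E + A"

end

theory Submission
  imports Defs
begin

text \<open>
  Everything rests on one consequence of the theorem of Riemann and Roch: if \<open>D\<close> is a good divisor
  of degree \<open>d\<close> and \<open>N - d \<ge> 2g - 1\<close>, then \<open>W\<^sup>N\<^sub>D\<close> has dimension \<open>N - d + 1 - g\<close>, and this number is
  a lower bound for the dimension in general.  The first half of the theory derives this
  (\<open>ell_large_degree\<close>, \<open>Riemann\<close>) from the definition of the function field.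
  Comparing growth rates bounds the number of functions independent over \<open>K(y)\<close>
  (\<open>kx_indep_card_bounded\<close>); approximation at finitely many places then bounds the zeros of \<open>y\<close>
  (\<open>zeros_bound\<close>).  A maximal subring that contains \<open>1 / y\<close> but not \<open>y\<close> is a discrete valuation
  ring, so that nonconstant functions have poles (\<open>exists_pole\<close>) and \<open>L(0)\<close> is the base field.
  From this follow the vanishing of the degree of principal divisors (\<open>deg_principal\<close>) and
  the finiteness of the genus (\<open>Riemann_bound\<close>).  Equality in Riemann's inequality is reached in
  degree \<open>2g - 1\<close> by a count along the filtration by the pole order at \<open>P\<^sub>\<infinity>\<close>: a gap in degree
  \<open>m \<ge> 2g\<close> would force one further gap for every element up to \<open>m\<close> of the Weierstrass semigroup of
  \<open>P\<^sub>\<infinity>\<close>, and these are too many (\<open>jump_in_large_degree\<close>).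

  Now let \<open>D\<close> be semi-typical of degree \<open>d\<close>.  The functions \<open>s\<close> and \<open>t\<close> of degree \<open>d + g\<close> and
  \<open>d + g + 1\<close> in \<open>I\<^sub>D\<close> are then unique up to the obvious changes.  By counting dimensions, \<open>D\<close> is
  typical iff \<open>s W\<^sup>2\<^sup>g\<close> and \<open>t W\<^sup>2\<^sup>g\<^sup>-\<^sup>1\<close> intersect in \<open>0\<close>.  With \<open>div s = D + A\<close> and
  \<open>div t = D + T\<close>, a relation \<open>l t \<in> s R\<close> means \<open>div l \<ge> A - min(T, A)\<close>, so the intersection is \<open>t\<close> times
  \<open>W\<^sup>2\<^sup>g\<^sup>-\<^sup>1\<close> of the divisor \<open>A - min(T, A)\<close>.  As \<open>A\<close> has degree \<open>g\<close>, this space vanishes only if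
  \<open>min(T, A) = 0\<close> and \<open>A\<close> is semi-typical (\<open>typical_iff_flip_remainder\<close>, \<open>flip_of_typical\<close>).  The
  flipping procedure computes exactly these spaces, so it succeeds iff \<open>D\<close> is typical, and then
  returns a description of \<open>A\<close> (\<open>flip_run_iff\<close>).

  The remaining points are short.  Two divisors of degree \<open>g\<close> have \<open>W\<^sup>3\<^sup>g\<^sup>-\<^sup>1\<^sub>D \<inter> W\<^sup>3\<^sup>g\<^sup>-\<^sup>1\<^sub>D\<^sub>' = 0\<close> only if their
  maximum has degree at least \<open>2g\<close>, that is, if they are disjoint (\<open>intersection_success\<close>).
  If \<open>div G\<^sub>1 = A + B\<close>, then \<open>B\<close> is disjoint from \<open>D\<close> because \<open>A\<close> is typical with flip \<open>D\<close>;
  hence \<open>l G\<^sub>1 / F \<in> I\<^sub>D\<close> detects \<open>div l \<ge> 2D\<close> (\<open>double_start_iff\<close>).  Finally, multiplication by a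
  function shows that typicality depends only on the class of a divisor
  (\<open>typical_class_invariant\<close>), and the divisor after two flips is equivalent to the original one up to
  a multiple of \<open>P\<^sub>\<infinity>\<close>; so the one is typical iff the other is.
\<close>

section \<open>Dimensions of subspaces, absolute and relative\<close>

text \<open>
  A function field has infinite dimension over \<open>K\<close>, so dimensions of its subspaces are
  related to each other through bases relative to a subspace.
\<close>

locale k_space = vector_space scale
  for scale :: "'k::field \<Rightarrow> 'b::ab_group_add \<Rightarrow> 'b"
begin

definition fin_dim :: "'b set \<Rightarrow> bool" where
  "fin_dim V \<longleftrightarrow> (\<exists>B. finite B \<and> V \<subseteq> span B)"

text \<open>
  The images of the elements of \<open>B\<close> in the quotient by \<open>V\<close> are distinct and
  linearly independent.
\<close>

definition indep_mod :: "'b set \<Rightarrow> 'b set \<Rightarrow> bool" where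
  "indep_mod V B \<longleftrightarrow> finite B \<and> (\<forall>c. (\<Sum>b\<in>B. scale (c b) b) \<in> V \<longrightarrow> (\<forall>b\<in>B. c b = 0))"

lemma fin_dim_mono: "fin_dim V' \<Longrightarrow> V \<subseteq> V' \<Longrightarrow> fin_dim V"
  unfolding fin_dim_def by blast

lemma independent_card_le:
  assumes "independent B" "B \<subseteq> V" "fin_dim V"
  shows "finite B \<and> card B \<le> dim V"
proof -
  obtain B0 where B0: "B0 \<subseteq> V" "independent B0" "V \<subseteq> span B0" "card B0 = dim V"
    using basis_exists by blast
  obtain Y where Y: "finite Y" "V \<subseteq> span Y" using assms(3) fin_dim_def by blast
  have "finite B0" using independent_span_bound[OF Y(1) B0(2)] B0(1) Y(2) by blast
  from independent_span_bound[OF this assms(1)] show ?thesis using assms(2) B0 by auto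
qed

lemma fin_dim_basis:
  assumes "fin_dim V"
  shows "\<exists>B. B \<subseteq> V \<and> independent B \<and> V \<subseteq> span B \<and> card B = dim V \<and> finite B"
proof -
  obtain B where B: "B \<subseteq> V" "independent B" "V \<subseteq> span B" "card B = dim V"
    using basis_exists by blast
  then show ?thesis using independent_card_le[OF B(2,1) assms] by blast
qed

lemma dim_le_dim:
  assumes "V \<subseteq> V'" "fin_dim V'" shows "dim V \<le> dim V'"
proof -
  obtain B where "B \<subseteq> V" "independent B" "card B = dim V"
    using fin_dim_basis[OF fin_dim_mono[OF assms(2,1)]] by blast
  then show ?thesis using independent_card_le[of B V'] assms by auto
qed

lemma indep_mod_notin:
  assumes B: "indep_mod V B" and b: "b \<in> B"
  shows "b \<notin> V"
proof
  assume bV: "b \<in> V"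
  define c where "c x = (if x = b then 1 else 0 :: 'k)" for x
  have "(\<Sum>x\<in>B. scale (c x) x) = (\<Sum>x\<in>B. if x = b then b else 0)"
    by (rule sum.cong) (auto simp: c_def)
  then have "(\<Sum>x\<in>B. scale (c x) x) \<in> V"
    using bV b B by (simp add: indep_mod_def)
  then have "c b = 0" using B b unfolding indep_mod_def by blast
  then show False by (simp add: c_def)
qed

lemma independent_of_indep_mod:
  assumes V: "subspace V" and B0: "independent B0" "finite B0" "B0 \<subseteq> V"
    and B: "indep_mod V B"
  shows "independent (B0 \<union> B)" "B0 \<inter> B = {}"
proof -
  have fB: "finite B" using B indep_mod_def by blast
  have notin: "b \<notin> V" if "b \<in> B" for b using indep_mod_notin[OF B that] .
  show disj: "B0 \<inter> B = {}" using notin B0(3) by auto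
  show "independent (B0 \<union> B)"
  proof (rule independent_if_scalars_zero)
    show "finite (B0 \<union> B)" using B0 fB by auto
    fix f x assume s: "(\<Sum>x\<in>B0 \<union> B. scale (f x) x) = 0" and x: "x \<in> B0 \<union> B"
    have sp: "(\<Sum>x\<in>B0. scale (f x) x) + (\<Sum>x\<in>B. scale (f x) x) = 0"
      using s by (simp add: sum.union_disjoint[OF B0(2) fB disj])
    have "(\<Sum>x\<in>B0. scale (f x) x) \<in> V"
      using V B0(3) by (auto intro!: subspace_sum subspace_scale)
    then have "(\<Sum>x\<in>B. scale (f x) x) \<in> V"
      using subspace_neg[OF V] add.inverse_unique[OF sp] by metis
    then have z: "\<forall>b\<in>B. f b = 0" using B indep_mod_def by blast
    then have "(\<Sum>x\<in>B. scale (f x) x) = 0" by simp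
    then have "(\<Sum>x\<in>B0. scale (f x) x) = 0" using sp by simp
    then have "\<forall>b\<in>B0. f b = 0" using independentD[OF B0(1,2)] by auto
    then show "f x = 0" using z x by auto
  qed
qed

lemma dim_add_card_le:
  assumes V: "subspace V" "V \<subseteq> V'" "fin_dim V'" and B: "indep_mod V B" "B \<subseteq> V'"
  shows "dim V + card B \<le> dim V'"
proof -
  obtain B0 where B0: "B0 \<subseteq> V" "independent B0" "card B0 = dim V" "finite B0"
    using fin_dim_basis[OF fin_dim_mono[OF V(3,2)]] by blast
  note i = independent_of_indep_mod[OF V(1) B0(2,4,1) B(1)]
  have "card (B0 \<union> B) = dim V + card B"
    using i(2) B0 B(1) by (simp add: card_Un_disjoint indep_mod_def)
  then show ?thesis using independent_card_le[OF i(1), of V'] B0 B V by auto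
qed

lemma dim_le_add_card:
  assumes "fin_dim V" "finite B" "V' \<subseteq> V + span B"
  shows "fin_dim V'" "dim V' \<le> dim V + card B"
proof -
  obtain B0 where B0: "B0 \<subseteq> V" "V \<subseteq> span B0" "card B0 = dim V" "finite B0"
    using fin_dim_basis[OF assms(1)] by blast
  have s: "V' \<subseteq> span (B0 \<union> B)"
    using assms(3) B0(2) unfolding span_Un set_plus_def by blast
  show "fin_dim V'" unfolding fin_dim_def using s B0 assms by blast
  have "dim V' \<le> card (B0 \<union> B)" using dim_le_card[OF s] B0 assms by auto
  also have "\<dots> \<le> dim V + card B" using card_Un_le[of B0 B] B0 by simp
  finally show "dim V' \<le> dim V + card B" .
qed

lemma rel_basis_exists:
  assumes V: "subspace V" "V \<subseteq> V'" "fin_dim V'"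
  shows "\<exists>B. B \<subseteq> V' \<and> indep_mod V B \<and> V' \<subseteq> V + span B"
proof -
  obtain B0 where B0: "B0 \<subseteq> V" "independent B0" "V \<subseteq> span B0" "finite B0"
    using fin_dim_basis[OF fin_dim_mono[OF V(3,2)]] by blast
  obtain B1 where B1: "B0 \<subseteq> B1" "B1 \<subseteq> V'" "independent B1" "V' \<subseteq> span B1"
    using maximal_independent_subset_extend[of B0 V'] B0 V by blast
  have fB1: "finite B1" using independent_card_le[OF B1(3,2) V(3)] by blast
  have sB0: "span B0 = V" using B0 V by (simp add: span_subspace)
  show ?thesis
  proof (intro exI[of _ "B1 - B0"] conjI)
    show "B1 - B0 \<subseteq> V'" using B1 by auto
    have "B1 = B0 \<union> (B1 - B0)" using B1 by auto
    then show "V' \<subseteq> V + span (B1 - B0)"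
      using B1(4) span_Un[of B0 "B1 - B0"] sB0 unfolding set_plus_def by auto blast
    show "indep_mod V (B1 - B0)" unfolding indep_mod_def
    proof (intro conjI allI impI)
      show "finite (B1 - B0)" using fB1 by simp
      fix c assume "(\<Sum>b\<in>B1 - B0. scale (c b) b) \<in> V"
      then obtain u where u: "(\<Sum>b\<in>B1 - B0. scale (c b) b) = (\<Sum>b\<in>B0. scale (u b) b)"
        using sB0 span_finite[OF B0(4)] by auto
      define f where "f b = (if b \<in> B0 then - u b else c b)" for b
      have "(\<Sum>b\<in>B1. scale (f b) b) = (\<Sum>b\<in>B1 - B0. scale (f b) b) + (\<Sum>b\<in>B0. scale (f b) b)"
        using B1(1) fB1 by (rule sum.subset_diff)
      also have "\<dots> = 0" using u by (simp add: f_def sum_negf)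
      finally have "\<forall>b\<in>B1. f b = 0" using independentD[OF B1(3) fB1] by auto
      then show "\<forall>b\<in>B1 - B0. c b = 0" by (auto simp: f_def)
    qed
  qed
qed

lemma subspace_plus:
  assumes "subspace A" "subspace B" shows "subspace (A + B)"
proof -
  have "A + B = {x + y |x y. x \<in> A \<and> y \<in> B}" unfolding set_plus_def by blast
  then show ?thesis using subspace_sums[OF assms] by simp
qed

lemma dim_rel_basis:
  assumes V: "subspace V" "V \<subseteq> V'" "fin_dim V"
    and B: "B \<subseteq> V'" "indep_mod V B" "V' \<subseteq> V + span B"
  shows "fin_dim V'" "dim V' = dim V + card B"
proof -
  have fB: "finite B" using B(2) indep_mod_def by blast
  show f: "fin_dim V'" using dim_le_add_card[OF V(3) fB B(3)] by blast
  show "dim V' = dim V + card B"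
    using dim_le_add_card(2)[OF V(3) fB B(3)] dim_add_card_le[OF V(1,2) f B(2,1)] by simp
qed

lemma subspace_eq_of_dim_le:
  assumes "subspace V" "V \<subseteq> V'" "fin_dim V'" "dim V' \<le> dim V"
  shows "V = V'"
proof -
  obtain B where B: "B \<subseteq> V'" "indep_mod V B" "V' \<subseteq> V + span B"
    using rel_basis_exists[OF assms(1-3)] by blast
  have "card B = 0" using dim_add_card_le[OF assms(1-3) B(2,1)] assms(4) by simp
  then have "B = {}" using B(2) by (simp add: indep_mod_def)
  then show ?thesis using B(3) assms(2) by (auto simp: set_plus_def)
qed

text \<open>
  A basis of \<open>B\<close> relative to \<open>A \<inter> B\<close> is also a basis of
  \<open>A + B\<close> relative to \<open>A\<close>.
\<close>

lemma dim_sum_Int: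
  assumes A: "subspace A" "fin_dim A" and B: "subspace B" "fin_dim B"
  shows "fin_dim (A + B)" "dim (A + B) + dim (A \<inter> B) = dim A + dim B"
proof -
  have sI: "subspace (A \<inter> B)" using A B subspace_inter by blast
  obtain Y where Y: "Y \<subseteq> B" "indep_mod (A \<inter> B) Y" "B \<subseteq> A \<inter> B + span Y"
    using rel_basis_exists[of "A \<inter> B" B] sI B by blast
  have d1: "dim B = dim (A \<inter> B) + card Y"
    using dim_rel_basis(2)[OF sI _ _ Y] fin_dim_mono[OF B(2)] by blast
  have A0: "A \<subseteq> A + B" using subspace_0[OF B(1)] by (force simp: set_plus_def)
  have B0: "B \<subseteq> A + B" using subspace_0[OF A(1)] by (force simp: set_plus_def)
  have Y1: "Y \<subseteq> A + B" using Y B0 by auto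
  have Y2: "indep_mod A Y" unfolding indep_mod_def
  proof (intro conjI allI impI)
    show "finite Y" using Y(2) indep_mod_def by blast
    fix c assume "(\<Sum>b\<in>Y. scale (c b) b) \<in> A"
    moreover have "(\<Sum>b\<in>Y. scale (c b) b) \<in> B"
      using B(1) Y(1) by (auto intro!: subspace_sum subspace_scale)
    ultimately show "\<forall>b\<in>Y. c b = 0" using Y(2) unfolding indep_mod_def by blast
  qed
  have Y3: "A + B \<subseteq> A + span Y"
  proof
    fix z assume "z \<in> A + B"
    then obtain a b where z: "z = a + b" "a \<in> A" "b \<in> B" by (auto simp: set_plus_def)
    then obtain a' x where b: "b = a' + x" "a' \<in> A" "x \<in> span Y"
      using Y(3) by (force simp: set_plus_def)
    have "z = (a + a') + x" using z b by simp
    then show "z \<in> A + span Y" using subspace_add[OF A(1) z(2) b(2)] b(3)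
      by (auto simp: set_plus_def)
  qed
  show "fin_dim (A + B)" using dim_rel_basis(1)[OF A(1) A0 A(2) Y1 Y2 Y3] .
  show "dim (A + B) + dim (A \<inter> B) = dim A + dim B"
    using dim_rel_basis(2)[OF A(1) A0 A(2) Y1 Y2 Y3] d1 by simp
qed

lemma indep_mod_Un:
  assumes V: "subspace V" "subspace V'" "V \<subseteq> V'"
    and B: "indep_mod V B" "B \<subseteq> V'" "indep_mod V' B'"
  shows "indep_mod V (B \<union> B')" "B \<inter> B' = {}"
proof -
  have fB: "finite B" "finite B'" using B indep_mod_def by blast+
  have notin: "b \<notin> V'" if "b \<in> B'" for b using indep_mod_notin[OF B(3) that] .
  show disj: "B \<inter> B' = {}" using notin B(2) by auto
  show "indep_mod V (B \<union> B')" unfolding indep_mod_def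
  proof (intro conjI allI impI)
    show "finite (B \<union> B')" using fB by auto
    fix f assume s: "(\<Sum>x\<in>B \<union> B'. scale (f x) x) \<in> V"
    have sp: "(\<Sum>x\<in>B \<union> B'. scale (f x) x) = (\<Sum>x\<in>B. scale (f x) x) + (\<Sum>x\<in>B'. scale (f x) x)"
      by (simp add: sum.union_disjoint[OF fB disj])
    have "(\<Sum>x\<in>B. scale (f x) x) \<in> V'"
      using V(2) B(2) by (auto intro!: subspace_sum subspace_scale)
    moreover have "(\<Sum>x\<in>B \<union> B'. scale (f x) x) \<in> V'" using s V by auto
    ultimately have "(\<Sum>x\<in>B \<union> B'. scale (f x) x) - (\<Sum>x\<in>B. scale (f x) x) \<in> V'"
      using subspace_diff[OF V(2)] by blast
    then have "(\<Sum>x\<in>B'. scale (f x) x) \<in> V'" unfolding sp by simp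
    then have z: "\<forall>b\<in>B'. f b = 0" using B(3) indep_mod_def by blast
    then have "(\<Sum>x\<in>B'. scale (f x) x) = 0" by simp
    then have "(\<Sum>x\<in>B. scale (f x) x) \<in> V" using sp s by simp
    then have "\<forall>b\<in>B. f b = 0" using B(1) indep_mod_def by blast
    then show "\<forall>b\<in>B \<union> B'. f b = 0" using z by auto
  qed
qed

lemma indep_mod_family:
  assumes fin: "finite I" and V: "subspace V"
    and ind: "\<And>c i. (\<Sum>i\<in>I. scale (c i) (f i)) \<in> V \<Longrightarrow> i \<in> I \<Longrightarrow> c i = 0"
  shows "indep_mod V (f ` I)" "card (f ` I) = card I" "inj_on f I"
proof -
  show inj: "inj_on f I"
  proof (rule inj_onI, rule ccontr)
    fix i j assume ij: "i \<in> I" "j \<in> I" "f i = f j" "i \<noteq> j"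
    define c where "c k = (if k = i then 1 else if k = j then - 1 else 0 :: 'k)" for k
    have "(\<Sum>k\<in>I. scale (c k) (f k)) = (\<Sum>k\<in>{i,j}. scale (c k) (f k))"
      using ij fin by (intro sum.mono_neutral_right) (auto simp: c_def)
    also have "\<dots> = 0" using ij by (simp add: c_def)
    finally have "c i = 0" using ind[of c i] ij subspace_0[OF V] by simp
    then show False by (simp add: c_def)
  qed
  then show "card (f ` I) = card I" by (rule card_image)
  show "indep_mod V (f ` I)" unfolding indep_mod_def
  proof (intro conjI allI impI ballI)
    show "finite (f ` I)" using fin by simp
    fix c b assume s: "(\<Sum>b\<in>f ` I. scale (c b) b) \<in> V" and b: "b \<in> f ` I"
    have "(\<Sum>i\<in>I. scale (c (f i)) (f i)) \<in> V"
      using s by (simp add: sum.reindex[OF inj])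
    then show "c b = 0" using ind[of "\<lambda>i. c (f i)"] b by auto
  qed
qed

lemma independent_iff_indep_mod:
  assumes "indep_mod {0} B" shows "independent B"
  using assms by (intro independent_if_scalars_zero) (auto simp: indep_mod_def)

text \<open>
  The exchange lemma in the quotient by \<open>V\<close>: the components in \<open>span B\<close> of the
  elements of \<open>Y\<close> are independent.
\<close>

lemma indep_mod_card_le:
  assumes V: "subspace V" and Y: "indep_mod V Y" "Y \<subseteq> V + span B" and B: "finite B"
  shows "card Y \<le> card B"
proof -
  have "\<forall>y\<in>Y. \<exists>s. s \<in> span B \<and> y - s \<in> V"
  proof
    fix y assume "y \<in> Y"
    then obtain v s where "y = v + s" "v \<in> V" "s \<in> span B" using Y(2) by (force simp: set_plus_def)
    then show "\<exists>s. s \<in> span B \<and> y - s \<in> V" by (intro exI[of _ s]) simp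
  qed
  then obtain s where s: "\<And>y. y \<in> Y \<Longrightarrow> s y \<in> span B" "\<And>y. y \<in> Y \<Longrightarrow> y - s y \<in> V"
    by metis
  have fY: "finite Y" using Y indep_mod_def by blast
  have *: "c y = 0" if c: "(\<Sum>y\<in>Y. scale (c y) (s y)) \<in> {0}" and y: "y \<in> Y" for c y
  proof -
    have "(\<Sum>y\<in>Y. scale (c y) y) = (\<Sum>y\<in>Y. scale (c y) (y - s y)) + (\<Sum>y\<in>Y. scale (c y) (s y))"
      by (simp add: sum.distrib[symmetric] scale_right_distrib[symmetric])
    also have "\<dots> \<in> V" using c s(2) V by (auto intro!: subspace_sum subspace_scale)
    finally show ?thesis using Y(1) y unfolding indep_mod_def by blast
  qed
  have m: "indep_mod {0} (s ` Y)" "card (s ` Y) = card Y"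
    by (rule indep_mod_family[OF fY subspace_single_0], erule (1) *)+
  have "s ` Y \<subseteq> span B" using s(1) by blast
  then show ?thesis using independent_span_bound[OF B independent_iff_indep_mod[OF m(1)]] m(2) by simp
qed

lemma indep_mod_insert:
  assumes V: "subspace V" and Y: "indep_mod V Y" and f: "f \<notin> V + span Y"
  shows "indep_mod V (insert f Y)" "f \<notin> Y"
proof -
  have fY: "finite Y" using Y indep_mod_def by blast
  have ysp: "y \<in> V + span Y" if "y \<in> span Y" for y
    using that subspace_0[OF V] unfolding set_plus_def by force
  show fnY: "f \<notin> Y" using f ysp span_base by blast
  show "indep_mod V (insert f Y)" unfolding indep_mod_def
  proof (intro conjI allI impI)
    show "finite (insert f Y)" using fY by simp
    fix c assume "(\<Sum>b\<in>insert f Y. scale (c b) b) \<in> V"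
    then have s: "scale (c f) f + (\<Sum>b\<in>Y. scale (c b) b) \<in> V" using fY fnY by simp
    have "c f = 0"
    proof (rule ccontr)
      assume c: "c f \<noteq> 0"
      define v where "v = scale (c f) f + (\<Sum>b\<in>Y. scale (c b) b)"
      have "f = scale (inverse (c f)) (v - (\<Sum>b\<in>Y. scale (c b) b))"
        using c by (simp add: v_def)
      also have "\<dots> = scale (inverse (c f)) v + - scale (inverse (c f)) (\<Sum>b\<in>Y. scale (c b) b)"
        by (simp add: scale_right_diff_distrib)
      also have "\<dots> \<in> V + span Y"
        using s V by (intro set_plus_intro subspace_scale span_neg span_scale span_sum)
          (auto simp: v_def intro: span_base)
      finally show False using f by simp
    qed
    moreover then have "\<forall>b\<in>Y. c b = 0" using s Y unfolding indep_mod_def by simp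
    ultimately show "\<forall>b\<in>insert f Y. c b = 0" by simp
  qed
qed

text \<open>
  A largest independent set modulo \<open>V\<close> is a basis relative to \<open>V\<close>.
\<close>

lemma rel_basis_of_bound:
  assumes V: "subspace V" and bd: "\<And>Y. Y \<subseteq> V' \<Longrightarrow> indep_mod V Y \<Longrightarrow> card Y \<le> n"
  shows "\<exists>Y. Y \<subseteq> V' \<and> indep_mod V Y \<and> V' \<subseteq> V + span Y \<and> card Y \<le> n"
proof -
  let ?P = "\<lambda>k. \<exists>Y. Y \<subseteq> V' \<and> indep_mod V Y \<and> card Y = k"
  have "?P 0" by (intro exI[of _ "{}"]) (simp add: indep_mod_def)
  then have "?P (GREATEST k. ?P k)"
    by (rule GreatestI_nat) (use bd in blast)
  then obtain Y where Y: "Y \<subseteq> V'" "indep_mod V Y" "card Y = (GREATEST k. ?P k)" by blast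
  have "V' \<subseteq> V + span Y"
  proof (rule ccontr)
    assume "\<not> V' \<subseteq> V + span Y"
    then obtain f where f: "f \<in> V'" "f \<notin> V + span Y" by blast
    note i = indep_mod_insert[OF V Y(2) f(2)]
    have "?P (card Y + 1)"
      using i Y f(1) by (intro exI[of _ "insert f Y"]) (simp add: indep_mod_def)
    then have "card Y + 1 \<le> (GREATEST k. ?P k)"
      by (rule Greatest_le_nat) (use bd in blast)
    then show False using Y by simp
  qed
  then show ?thesis using Y bd by blast
qed

lemma indep_mod_of_minimal:
  assumes V: "subspace V" and B: "finite B" "V' \<subseteq> V + span B"
    and min: "\<And>B'. B' \<subseteq> B \<Longrightarrow> V' \<subseteq> V + span B' \<Longrightarrow> card B \<le> card B'"
  shows "indep_mod V B"
  unfolding indep_mod_def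
proof (intro conjI allI impI ballI)
  show "finite B" by fact
  fix c b assume s: "(\<Sum>b\<in>B. scale (c b) b) \<in> V" and b: "b \<in> B"
  show "c b = 0"
  proof (rule ccontr)
    assume c: "c b \<noteq> 0"
    define v where "v = (\<Sum>b\<in>B. scale (c b) b)"
    have v: "v = scale (c b) b + (\<Sum>x\<in>B - {b}. scale (c x) x)"
      unfolding v_def using b B(1) by (simp add: sum.remove)
    have bb: "b = scale (inverse (c b)) v - scale (inverse (c b)) (\<Sum>x\<in>B - {b}. scale (c x) x)"
      unfolding v using c by (simp add: scale_right_distrib)
    have sp: "scale (inverse (c b)) (\<Sum>x\<in>B - {b}. scale (c x) x) \<in> span (B - {b})"
      by (intro span_scale span_sum) (auto intro: span_base)
    have "V' \<subseteq> V + span (B - {b})"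
    proof
      fix w assume "w \<in> V'"
      then obtain v' s' where w: "w = v' + s'" "v' \<in> V" "s' \<in> span B"
        using B(2) by (force simp: set_plus_def)
      have "s' \<in> span (insert b (B - {b}))" using w(3) b by (simp add: insert_absorb)
      then obtain k where k: "s' - scale k b \<in> span (B - {b})" using span_breakdown_eq by blast
      have "w = (v' + scale k (scale (inverse (c b)) v)) +
          ((s' - scale k b) - scale k (scale (inverse (c b)) (\<Sum>x\<in>B - {b}. scale (c x) x)))"
        using arg_cong[OF bb, of "scale k"] w(1) by (simp add: scale_right_diff_distrib)
      also have "\<dots> \<in> V + span (B - {b})"
      proof (rule set_plus_intro)
        show "v' + scale k (scale (inverse (c b)) v) \<in> V"
          using w(2) s V by (intro subspace_add subspace_scale) (auto simp: v_def)
        show "(s' - scale k b) - scale k (scale (inverse (c b)) (\<Sum>x\<in>B - {b}. scale (c x) x)) \<in> span (B - {b})"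
          by (rule span_diff[OF k span_scale[OF sp]])
      qed
      finally show "w \<in> V + span (B - {b})" .
    qed
    from min[OF _ this] have "card B \<le> card (B - {b})" by auto
    moreover have "card (B - {b}) < card B" using b B(1) by (rule card_Diff1_less[rotated])
    ultimately show False by simp
  qed
qed

end

section \<open>The base field and polynomials in a function\<close>

locale pointed_curve =
  fixes C :: "('k::field, 'a::field) curve"
  assumes function_field: "function_field C"
    and rational_infty: "rational_point C (infty C)"
begin

lemma emb_1 [simp]: "emb C 1 = 1"
  and emb_add: "emb C (x + y) = emb C x + emb C y"
  and emb_mult: "emb C (x * y) = emb C x * emb C y"
  using function_field unfolding function_field_def field_embedding_def by blast+

lemma emb_0 [simp]: "emb C 0 = 0"
  using emb_add[of 0 0] by (metis add_cancel_right_right)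

lemma emb_minus: "emb C (- x) = - emb C x"
  using emb_add[of x "- x"] by (simp add: eq_neg_iff_add_eq_0 add.commute)

lemma emb_eq_0_iff [simp]: "emb C x = 0 \<longleftrightarrow> x = 0"
  by (metis emb_0 emb_1 emb_mult mult_zero_left right_inverse zero_neq_one)

lemma emb_inverse: "emb C (inverse x) = inverse (emb C x)"
  by (metis emb_0 emb_1 emb_mult inverse_unique inverse_zero right_inverse)

sublocale vs: k_space "scl C"
  by unfold_locales (simp_all add: scl_def algebra_simps emb_add emb_mult)

definition pev :: "'k poly \<Rightarrow> 'a \<Rightarrow> 'a" where
  "pev p x = poly (map_poly (emb C) p) x"

lemma pev_0 [simp]: "pev 0 x = 0" by (simp add: pev_def)

lemma pev_pCons [simp]: "pev (pCons a p) x = emb C a + x * pev p x"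
  by (simp add: pev_def map_poly_pCons)

lemma pev_1 [simp]: "pev 1 x = 1"
  by (simp add: one_pCons)

lemma pev_add: "pev (p + q) x = pev p x + pev q x"
proof (induction p arbitrary: q)
  case (pCons a p)
  obtain b r where "q = pCons b r" by (cases q) blast
  then show ?case by (simp add: pCons.IH emb_add algebra_simps)
qed simp

lemma pev_smult: "pev (smult a q) x = emb C a * pev q x"
  by (induction q) (simp_all add: emb_mult algebra_simps)

lemma pev_mult: "pev (p * q) x = pev p x * pev q x"
  by (induction p) (simp_all add: pev_add pev_smult algebra_simps)

lemma pev_sum: "pev (\<Sum>i\<in>I. p i) x = (\<Sum>i\<in>I. pev (p i) x)"
  by (induction I rule: infinite_finite_induct) (simp_all add: pev_add)

lemma pev_pcompose: "pev (pcompose p q) x = pev p (pev q x)"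
  by (induction p) (simp_all add: pcompose_pCons pev_add pev_mult algebra_simps)

lemma pev_altdef: "pev p x = (\<Sum>i\<le>degree p. scl C (coeff p i) (x ^ i))"
proof -
  have "degree (map_poly (emb C) p) = degree p" by (rule degree_map_poly) simp
  then show ?thesis
    unfolding pev_def poly_altdef by (simp add: coeff_map_poly scl_def)
qed

definition transcendental :: "'a \<Rightarrow> bool" where
  "transcendental x \<longleftrightarrow> (\<forall>p. p \<noteq> 0 \<longrightarrow> pev p x \<noteq> 0)"

section \<open>Independence over the field of rational functions in one function\<close>

text \<open>
  Linear independence over \<open>K(y)\<close> for transcendental \<open>y\<close>; after clearing
  denominators, polynomial coefficients suffice.
\<close>

definition kx_indep :: "'a \<Rightarrow> 'a set \<Rightarrow> bool" where
  "kx_indep y U \<longleftrightarrow> finite U \<and> (\<forall>p. (\<Sum>u\<in>U. pev (p u) y * u) = 0 \<longrightarrow> (\<forall>u\<in>U. p u = 0))"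

lemma pev_monom: "pev (monom a n) x = emb C a * x ^ n"
  by (induction n) (simp_all add: monom_0 monom_Suc)

text \<open>
  Multiplication by powers of \<open>y\<close> turns independence over \<open>K(y)\<close> into
  independence over \<open>K\<close> of a family that grows linearly in \<open>N\<close>.  The factor
  \<open>Q\<close> serves to clear denominators.
\<close>

lemma kx_indep_powers:
  fixes N :: nat
  assumes U: "kx_indep y U" and Q: "Q \<noteq> 0"
  defines "E \<equiv> (\<lambda>(i, u). Q * y ^ i * u) ` ({..N} \<times> U)"
  shows "vs.independent E" "card E = (N + 1) * card U" "finite E"
proof -
  have fU: "finite U" using U kx_indep_def by blast
  have *: "c iu = 0" if s: "(\<Sum>iu\<in>{..N} \<times> U. scl C (c iu) ((\<lambda>(i, u). Q * y ^ i * u) iu)) \<in> {0}"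
    and iu: "iu \<in> {..N} \<times> U" for c iu
  proof -
    define p where "p u = (\<Sum>i\<le>N. monom (c (i, u)) i)" for u
    have "(\<Sum>iu\<in>{..N} \<times> U. scl C (c iu) ((\<lambda>(i, u). Q * y ^ i * u) iu)) =
        (\<Sum>iu\<in>{..N} \<times> U. (\<lambda>(i, u). scl C (c (i, u)) (Q * y ^ i * u)) iu)"
      by (rule sum.cong) auto
    also have "\<dots> = (\<Sum>i\<le>N. \<Sum>u\<in>U. scl C (c (i, u)) (Q * y ^ i * u))"
      by (simp add: sum.cartesian_product)
    also have "\<dots> = (\<Sum>u\<in>U. \<Sum>i\<le>N. scl C (c (i, u)) (Q * y ^ i * u))"
      by (rule sum.swap)
    also have "\<dots> = (\<Sum>u\<in>U. Q * (pev (p u) y * u))"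
      by (simp add: p_def pev_sum pev_monom scl_def sum_distrib_left sum_distrib_right mult_ac)
    also have "\<dots> = Q * (\<Sum>u\<in>U. pev (p u) y * u)" by (simp add: sum_distrib_left)
    finally have "(\<Sum>u\<in>U. pev (p u) y * u) = 0" using s Q by simp
    then have p0: "p u = 0" if "u \<in> U" for u using U that unfolding kx_indep_def by blast
    obtain i u where [simp]: "iu = (i, u)" and i: "i \<le> N" and u: "u \<in> U" using iu by auto
    have "coeff (p u) i = c (i, u)" using i by (simp add: p_def coeff_sum)
    then show ?thesis using p0[OF u] by simp
  qed
  have fin: "finite ({..N} \<times> U)" using fU by simp
  have m: "vs.indep_mod {0} ((\<lambda>(i, u). Q * y ^ i * u) ` ({..N} \<times> U))"
    "card ((\<lambda>(i, u). Q * y ^ i * u) ` ({..N} \<times> U)) = card ({..N} \<times> U)"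
    by (rule vs.indep_mod_family[OF fin vs.subspace_single_0], erule (1) *)+
  show "vs.independent E" unfolding E_def
    by (rule vs.independent_iff_indep_mod[OF m(1)])
  show "card E = (N + 1) * card U" unfolding E_def using m(2) by (simp add: card_cartesian_product)
  show "finite E" unfolding E_def using fin by simp
qed

lemma common_denominator:
  assumes x: "transcendental x" and S: "finite S" "S \<subseteq> rat_functions_in C x"
  shows "\<exists>q. q \<noteq> 0 \<and> (\<forall>s\<in>S. \<exists>p. pev q x * s = pev p x)"
  using S
proof (induction S rule: finite_induct)
  case empty
  show ?case by (intro exI[of _ 1]) simp
next
  case (insert s S)
  then obtain q where q: "q \<noteq> 0" "\<And>s. s \<in> S \<Longrightarrow> \<exists>p. pev q x * s = pev p x" by auto
  obtain p r where s: "s = pev p x / pev r x" "r \<noteq> 0"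
    using insert.prems by (auto simp: rat_functions_in_def pev_def)
  have r0: "pev r x \<noteq> 0" using x s(2) by (auto simp: transcendental_def)
  show ?case
  proof (rule exI[of _ "r * q"], intro conjI ballI)
    show "r * q \<noteq> 0" using q s by simp
    fix t assume "t \<in> insert s S"
    then consider "t = s" | "t \<in> S" by blast
    then show "\<exists>p. pev (r * q) x * t = pev p x"
    proof cases
      case 1
      then show ?thesis using s r0 by (intro exI[of _ "q * p"]) (simp add: pev_mult)
    next
      case 2
      then obtain p' where "pev q x * t = pev p' x" using q(2) by blast
      then show ?thesis by (intro exI[of _ "r * p'"]) (simp add: pev_mult mult.assoc)
    qed
  qed
qed

text \<open>
  Let \<open>B\<close> generate the function field over \<open>K(x)\<close>.  Multiplication by
  \<open>y\<close> increases the degrees in \<open>x\<close> of coordinates with respect to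
  \<open>B\<close> by at most a constant \<open>d\<close>, up to a common denominator.  So the
  \<open>(N + 1) * card U\<close> independent functions \<open>y\<^sup>i u\<close>,
  \<open>i \<le> N\<close>, lie in a space whose dimension grows like \<open>d * N * card B\<close>,
  whence \<open>card U \<le> d * card B\<close>.
\<close>

lemma kx_indep_card_bounded: "\<exists>n. \<forall>U. kx_indep y U \<longrightarrow> card U \<le> n"
proof -
  obtain x B where x: "transcendental x" and fB: "finite B"
    and gen: "\<And>z. \<exists>c. c ` B \<subseteq> rat_functions_in C x \<and> z = (\<Sum>b\<in>B. c b * b)"
    using function_field unfolding function_field_def transcendental_def pev_def by blast
  define T where "T n = {\<Sum>b\<in>B. pev (r b) x * b | r. \<forall>b\<in>B. degree (r b) \<le> n}" for n
  have TI: "z \<in> T n" if "z = (\<Sum>b\<in>B. pev (r b) x * b)" "\<And>b. b \<in> B \<Longrightarrow> degree (r b) \<le> n" for z r n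
    unfolding T_def using that by blast
  \<comment> \<open>Clearing denominators: a multiple by a polynomial in \<open>x\<close> moves a finite set into some \<open>T m\<close>.\<close>
  have clear: "\<exists>q r. q \<noteq> 0 \<and> (\<forall>u\<in>U. pev q x * u = (\<Sum>b\<in>B. pev (r u b) x * b))"
    if fU: "finite (U :: 'a set)" for U
  proof -
    obtain c where c: "\<And>z. c z ` B \<subseteq> rat_functions_in C x" "\<And>z. z = (\<Sum>b\<in>B. c z b * b)"
      using gen by metis
    have "finite (\<Union>u\<in>U. c u ` B)" "(\<Union>u\<in>U. c u ` B) \<subseteq> rat_functions_in C x"
      using fU fB c(1) by auto
    from common_denominator[OF x this] obtain q where q: "q \<noteq> 0"
      "\<And>s. s \<in> (\<Union>u\<in>U. c u ` B) \<Longrightarrow> \<exists>p. pev q x * s = pev p x" by blast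
    define r where "r u b = (SOME p. pev q x * c u b = pev p x)" for u b
    have r: "pev q x * c u b = pev (r u b) x" if "u \<in> U" "b \<in> B" for u b
      unfolding r_def by (rule someI_ex, rule q(2)) (use that in auto)
    have "pev q x * u = (\<Sum>b\<in>B. pev (r u b) x * b)" if "u \<in> U" for u
    proof -
      have "pev q x * u = pev q x * (\<Sum>b\<in>B. c u b * b)" using c(2)[of u] by simp
      also have "\<dots> = (\<Sum>b\<in>B. pev (r u b) x * b)"
        unfolding sum_distrib_left using r[OF that] by (intro sum.cong) (auto simp: mult.assoc[symmetric])
      finally show ?thesis .
    qed
    then show ?thesis using q(1) by blast
  qed
  obtain q r where q: "q \<noteq> 0" "\<And>u. u \<in> (\<lambda>b. y * b) ` B \<Longrightarrow> pev q x * u = (\<Sum>b\<in>B. pev (r u b) x * b)"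
    using clear[of "(\<lambda>b. y * b) ` B"] fB by blast
  define p where "p b b' = r (y * b) b'" for b b'
  have p: "pev q x * (y * b) = (\<Sum>b'\<in>B. pev (p b b') x * b')" if "b \<in> B" for b
    unfolding p_def by (rule q(2)) (use that in blast)
  define d where "d = Max (insert (degree q) ((\<lambda>(b, b'). degree (p b b')) ` (B \<times> B)))"
  have dq: "degree q \<le> d" using fB by (simp add: d_def)
  have dp: "degree (p b b') \<le> d" if "b \<in> B" "b' \<in> B" for b b'
    unfolding d_def using fB that by (intro Max_ge) force+
  have Ty: "pev q x * (y * z) \<in> T (n + d)" if z: "z \<in> T n" for z n
  proof -
    obtain r where r: "z = (\<Sum>b\<in>B. pev (r b) x * b)" "\<forall>b\<in>B. degree (r b) \<le> n"
      using z by (auto simp: T_def)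
    have "pev q x * (y * z) = (\<Sum>b\<in>B. pev (r b) x * (pev q x * (y * b)))"
      by (simp add: r(1) sum_distrib_left mult_ac)
    also have "\<dots> = (\<Sum>b\<in>B. \<Sum>b'\<in>B. pev (r b) x * (pev (p b b') x * b'))"
      by (rule sum.cong) (auto simp: p sum_distrib_left)
    also have "\<dots> = (\<Sum>b'\<in>B. \<Sum>b\<in>B. pev (r b) x * (pev (p b b') x * b'))"
      by (rule sum.swap)
    also have "\<dots> = (\<Sum>b'\<in>B. pev (\<Sum>b\<in>B. r b * p b b') x * b')"
      by (simp add: pev_sum pev_mult sum_distrib_left sum_distrib_right mult_ac)
    finally have "pev q x * (y * z) = (\<Sum>b'\<in>B. pev (\<Sum>b\<in>B. r b * p b b') x * b')" .
    moreover have "degree (\<Sum>b\<in>B. r b * p b b') \<le> n + d" if "b' \<in> B" for b'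
    proof (rule degree_sum_le[OF fB])
      fix b assume b: "b \<in> B"
      show "degree (r b * p b b') \<le> n + d"
        using order_trans[OF degree_mult_le add_mono[OF r(2)[rule_format, OF b] dp[OF b that]]] .
    qed
    ultimately show ?thesis by (rule TI)
  qed
  have Tq: "pev q x * z \<in> T (n + d)" if z: "z \<in> T n" for z n
  proof -
    obtain r where r: "z = (\<Sum>b\<in>B. pev (r b) x * b)" "\<forall>b\<in>B. degree (r b) \<le> n"
      using z by (auto simp: T_def)
    have "pev q x * z = (\<Sum>b\<in>B. pev (q * r b) x * b)"
      by (simp add: r(1) sum_distrib_left pev_mult mult_ac)
    moreover have "degree (q * r b) \<le> n + d" if "b \<in> B" for b
      using order_trans[OF degree_mult_le add_mono[OF dq r(2)[rule_format, OF that]]] by simp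
    ultimately show ?thesis by (rule TI)
  qed
  have TN: "pev q x ^ N * y ^ i * z \<in> T (m + d * N)" if z: "z \<in> T m" and "i \<le> N" for z m i N
    using that(2)
  proof (induction N arbitrary: i)
    case 0
    then show ?case using z by simp
  next
    case (Suc N)
    show ?case
    proof (cases i)
      case 0
      have "pev q x * (pev q x ^ N * y ^ 0 * z) \<in> T (m + d * N + d)" by (rule Tq, rule Suc.IH) simp
      then show ?thesis using 0 by (simp add: mult_ac add_ac)
    next
      case (Suc j)
      have "pev q x * (y * (pev q x ^ N * y ^ j * z)) \<in> T (m + d * N + d)"
        by (rule Ty, rule Suc.IH) (use Suc Suc.prems in simp)
      then show ?thesis using Suc by (simp add: mult_ac add_ac)
    qed
  qed
  have Tspan: "T n \<subseteq> vs.span ((\<lambda>(i, b). x ^ i * b) ` ({..n} \<times> B))" for n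
  proof
    fix z assume "z \<in> T n"
    then obtain r where r: "z = (\<Sum>b\<in>B. pev (r b) x * b)" "\<forall>b\<in>B. degree (r b) \<le> n"
      by (auto simp: T_def)
    have "pev (r b) x * b \<in> vs.span ((\<lambda>(i, b). x ^ i * b) ` ({..n} \<times> B))" if b: "b \<in> B" for b
    proof -
      have "pev (r b) x * b = (\<Sum>i\<le>degree (r b). scl C (coeff (r b) i) (x ^ i * b))"
        by (simp add: pev_altdef sum_distrib_right scl_def mult.assoc)
      also have "\<dots> \<in> vs.span ((\<lambda>(i, b). x ^ i * b) ` ({..n} \<times> B))"
        using b r(2) by (intro vs.span_sum vs.span_scale vs.span_base) force
      finally show ?thesis .
    qed
    then show "z \<in> vs.span ((\<lambda>(i, b). x ^ i * b) ` ({..n} \<times> B))"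
      unfolding r(1) by (rule vs.span_sum)
  qed
  have "card U \<le> d * card B" if U: "kx_indep y U" for U
  proof (rule ccontr)
    assume neg: "\<not> card U \<le> d * card B"
    have fU: "finite U" using U kx_indep_def by blast
    obtain q' r' where q': "q' \<noteq> 0" "\<And>u. u \<in> U \<Longrightarrow> pev q' x * u = (\<Sum>b\<in>B. pev (r' u b) x * b)"
      using clear[OF fU] by blast
    define m where "m = Max (insert 0 ((\<lambda>(u, b). degree (r' u b)) ` (U \<times> B)))"
    have "degree (r' u b) \<le> m" if "u \<in> U" "b \<in> B" for u b
      unfolding m_def using fB fU that by (intro Max_ge) force+
    then have uT: "pev q' x * u \<in> T m" if "u \<in> U" for u
      using q'(2)[OF that] that unfolding T_def by blast
    define N where "N = (m + 1) * card B"
    define Q where "Q = pev q x ^ N * pev q' x"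
    have Q: "Q \<noteq> 0" using x q(1) q'(1) by (auto simp: Q_def transcendental_def)
    define E where "E = (\<lambda>(i, u). Q * y ^ i * u) ` ({..N} \<times> U)"
    define G where "G = (\<lambda>(i, b). x ^ i * b) ` ({..m + d * N} \<times> B)"
    have "E \<subseteq> T (m + d * N)"
    proof
      fix z assume "z \<in> E"
      then obtain i u where iu: "z = Q * y ^ i * u" "i \<le> N" "u \<in> U" by (auto simp: E_def)
      then show "z \<in> T (m + d * N)"
        using TN[OF uT[OF iu(3)] iu(2)] by (simp add: Q_def mult_ac)
    qed
    then have "E \<subseteq> vs.span G" unfolding G_def using Tspan by blast
    moreover have "finite G" using fB by (simp add: G_def)
    ultimately have "card E \<le> card G"
      using vs.independent_span_bound kx_indep_powers(1)[OF U Q] unfolding E_def by blast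
    also have "card G \<le> (m + d * N + 1) * card B"
      unfolding G_def using card_image_le[of "{..m + d * N} \<times> B"] fB
      by (simp add: card_cartesian_product)
    finally have "(N + 1) * card U \<le> (m + d * N + 1) * card B"
      using kx_indep_powers(2)[OF U Q, of N] unfolding E_def by simp
    moreover have "(N + 1) * (d * card B + 1) \<le> (N + 1) * card U"
      using neg by (intro mult_le_mono2) simp
    ultimately have "(N + 1) * (d * card B + 1) \<le> (m + d * N + 1) * card B" by linarith
    then have "N + 1 + d * card B \<le> (m + 1) * card B" by (simp add: algebra_simps)
    then show False by (simp add: N_def)
  qed
  then show ?thesis by blast
qed

text \<open>
  The degree of the function field over \<open>K(y)\<close>, for transcendental \<open>y\<close>.
\<close>

definition kx_rank :: "'a \<Rightarrow> nat" where
  "kx_rank y = (GREATEST n. \<exists>U. kx_indep y U \<and> card U = n)"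

lemma kx_rank_attained: "\<exists>U. kx_indep y U \<and> card U = kx_rank y"
  and kx_rank_ge: "kx_indep y U \<Longrightarrow> card U \<le> kx_rank y"
proof -
  obtain n where n: "\<And>U. kx_indep y U \<Longrightarrow> card U \<le> n" using kx_indep_card_bounded by blast
  have 0: "\<exists>U. kx_indep y U \<and> card U = 0" by (intro exI[of _ "{}"]) (simp add: kx_indep_def)
  show "\<exists>U. kx_indep y U \<and> card U = kx_rank y" unfolding kx_rank_def
    by (rule GreatestI_nat[where P = "\<lambda>n. \<exists>U. kx_indep y U \<and> card U = n", OF 0]) (use n in blast)
  show "kx_indep y U \<Longrightarrow> card U \<le> kx_rank y" unfolding kx_rank_def
    by (rule Greatest_le_nat[where b = n]) (use n in blast)+
qed

section \<open>Valuations\<close>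

lemma pt_mult: "P \<in> points C \<Longrightarrow> f \<noteq> 0 \<Longrightarrow> h \<noteq> 0 \<Longrightarrow> P (f * h) = P f + P h"
  and pt_min: "P \<in> points C \<Longrightarrow> f \<noteq> 0 \<Longrightarrow> h \<noteq> 0 \<Longrightarrow> f + h \<noteq> 0 \<Longrightarrow> min (P f) (P h) \<le> P (f + h)"
  and pt_0: "P \<in> points C \<Longrightarrow> P 0 = 0"
  and pt_ex1: "P \<in> points C \<Longrightarrow> \<exists>f. f \<noteq> 0 \<and> P f = 1"
  unfolding points_def by (blast, blast, blast, force)

lemma pt_emb: assumes "P \<in> points C" shows "P (emb C c) = 0"
proof (cases "c = 0")
  case False
  then show ?thesis using assms unfolding points_def by blast
qed (simp add: assms pt_0)

lemma pt_1: "P \<in> points C \<Longrightarrow> P 1 = 0"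
  using pt_emb[of P 1] by simp

lemma pt_uminus: "P \<in> points C \<Longrightarrow> P (- f) = P f"
  using pt_mult[of P "emb C (- 1)" f] pt_emb[of P "- 1"] by (cases "f = 0") (simp_all add: emb_minus)

lemmas pt_simps = pt_0 pt_1 pt_emb pt_uminus

lemma pt_power: "P \<in> points C \<Longrightarrow> f \<noteq> 0 \<Longrightarrow> P (f ^ n) = int n * P f"
  by (induction n) (auto simp: pt_mult pt_1 algebra_simps)

lemma pt_inverse: "P \<in> points C \<Longrightarrow> P (inverse f) = - P f"
  using pt_mult[of P f "inverse f"] by (cases "f = 0") (auto simp: pt_simps)

lemma pt_divide: "P \<in> points C \<Longrightarrow> f \<noteq> 0 \<Longrightarrow> h \<noteq> 0 \<Longrightarrow> P (f / h) = P f - P h"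
  by (simp add: divide_inverse pt_mult pt_inverse)

lemma pt_powi: "P \<in> points C \<Longrightarrow> f \<noteq> 0 \<Longrightarrow> P (f powi n) = n * P f"
  by (auto simp: power_int_def pt_power pt_inverse)

lemma pt_add_less:
  assumes "P \<in> points C" "f \<noteq> 0" "h \<noteq> 0" "P f < P h"
  shows "f + h \<noteq> 0" "P (f + h) = P f"
proof -
  show nz: "f + h \<noteq> 0"
    using assms pt_uminus[OF assms(1), of h] by (metis add_eq_0_iff2 less_irrefl)
  have "P f \<le> P (f + h)" using pt_min[OF assms(1-3) nz] assms(4) by simp
  moreover have "\<not> P f < P (f + h)"
  proof
    assume "P f < P (f + h)"
    then show False
      using pt_min[OF assms(1) nz, of "- h"] assms by (simp add: pt_uminus)
  qed
  ultimately show "P (f + h) = P f" by simp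
qed

text \<open>
  Order conditions on functions that may vanish: the value \<open>P 0 = 0\<close> is only a convention.
\<close>

definition vge :: "('a \<Rightarrow> int) \<Rightarrow> int \<Rightarrow> 'a \<Rightarrow> bool" where
  "vge P n f \<longleftrightarrow> f = 0 \<or> n \<le> P f"

lemma vge_0 [simp]: "vge P n 0" by (simp add: vge_def)

lemma vge_add: "P \<in> points C \<Longrightarrow> vge P n f \<Longrightarrow> vge P n h \<Longrightarrow> vge P n (f + h)"
  using pt_min[of P f h] unfolding vge_def
  by (cases "f = 0"; cases "h = 0"; cases "f + h = 0") (simp_all add: min_def split: if_splits)

lemma vge_mult: "P \<in> points C \<Longrightarrow> vge P n f \<Longrightarrow> vge P m h \<Longrightarrow> vge P (n + m) (f * h)"
  unfolding vge_def by (cases "f = 0"; cases "h = 0") (simp_all add: pt_mult)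

lemma vge_mult': "P \<in> points C \<Longrightarrow> h \<noteq> 0 \<Longrightarrow> vge P n (h * f) \<longleftrightarrow> vge P (n - P h) f"
  unfolding vge_def by (cases "f = 0") (auto simp: pt_mult)

lemma vge_scl: "P \<in> points C \<Longrightarrow> vge P n f \<Longrightarrow> vge P n (scl C c f)"
  by (cases "c = 0"; cases "f = 0") (simp_all add: vge_def scl_def pt_mult pt_emb)

lemma vge_mono: "vge P n f \<Longrightarrow> m \<le> n \<Longrightarrow> vge P m f"
  unfolding vge_def by auto

lemma vge_sum: "P \<in> points C \<Longrightarrow> (\<And>i. i \<in> I \<Longrightarrow> vge P n (f i)) \<Longrightarrow> vge P n (\<Sum>i\<in>I. f i)"
  by (induction I rule: infinite_finite_induct) (auto intro: vge_add)

text \<open>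
  Functions of order \<open>0\<close> at \<open>P\<close> are units of the larger ring too, so
  \<open>Q\<close> is a multiple of \<open>P\<close>; both are normalized.
\<close>

lemma point_eq_of_local_ring_le:
  assumes P: "P \<in> points C" and Q: "Q \<in> points C"
    and sub: "\<And>f. f \<noteq> 0 \<Longrightarrow> 0 \<le> P f \<Longrightarrow> 0 \<le> Q f"
  shows "Q = P"
proof -
  obtain u where u: "u \<noteq> 0" "P u = 1" using pt_ex1[OF P] by blast
  have unit: "Q f = 0" if "f \<noteq> 0" "P f = 0" for f
    using sub[of f] sub[of "inverse f"] that by (simp add: pt_inverse P Q)
  have Qf: "Q f = P f * Q u" if "f \<noteq> 0" for f
  proof -
    have "Q (f / u powi P f) = 0" using that u by (intro unit) (auto simp: pt_divide pt_powi P)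
    then show ?thesis using that u by (simp add: pt_divide pt_powi Q)
  qed
  obtain w where w: "w \<noteq> 0" "Q w = 1" using pt_ex1[OF Q] by blast
  have "Q u dvd 1" using Qf[OF w(1)] w(2) by (metis dvd_triv_right)
  moreover have "0 \<le> Q u" using sub u by simp
  ultimately have "Q u = 1" by simp
  then show ?thesis using Qf P Q by (metis mult.right_neutral pt_0 ext)
qed

text \<open>
  For two points, divide a function with a pole at the one but not at the other by a function for which
  they change roles.  In the induction step, a high power of such a quotient corrects the behaviour at
  the new point without cancelling elsewhere.
\<close>

lemma separating_function:
  assumes "finite S" "S \<subseteq> points C" "P \<in> points C" "P \<notin> S"
  shows "\<exists>u. u \<noteq> 0 \<and> 0 < P u \<and> (\<forall>Q\<in>S. Q u < 0)"
  using assms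
proof (induction S rule: finite_induct)
  case empty
  then show ?case using pt_ex1[of P] by force
next
  case (insert R S)
  note P = insert.prems(2)
  have R: "R \<in> points C" "R \<noteq> P" using insert.prems by auto
  obtain u where u: "u \<noteq> 0" "0 < P u" "\<And>Q. Q \<in> S \<Longrightarrow> Q u < 0"
    using insert by auto
  obtain y1 where y1: "y1 \<noteq> 0" "0 \<le> P y1" "R y1 < 0"
    using point_eq_of_local_ring_le[OF P R(1)] R(2) not_less by metis
  obtain y2 where y2: "y2 \<noteq> 0" "0 \<le> R y2" "P y2 < 0"
    using point_eq_of_local_ring_le[OF R(1) P] R(2) not_less by metis
  define v where "v = y1 / y2"
  have v: "v \<noteq> 0" "0 < P v" "R v < 0"
    using y1 y2 by (auto simp: v_def pt_divide P R(1))
  define k where "k = Suc (nat (Max ((\<lambda>Q. \<bar>Q u\<bar>) ` insert R S)))"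
  have k: "\<bar>Q u\<bar> < int k" if "Q \<in> insert R S" for Q
  proof -
    have "\<bar>Q u\<bar> \<le> Max ((\<lambda>Q. \<bar>Q u\<bar>) ` insert R S)"
      using insert.hyps that by (intro Max_ge) auto
    then show ?thesis unfolding k_def by linarith
  qed
  have vk: "v ^ k \<noteq> 0" using v by simp
  \<comment> \<open>Since \<open>k\<close> exceeds all \<open>\<bar>Q u\<bar>\<close>, the two summands of \<open>u + v ^ k\<close> have different orders.\<close>
  have neg: "u + v ^ k \<noteq> 0 \<and> Q (u + v ^ k) < 0" if Q: "Q \<in> insert R S" for Q
  proof -
    have QC: "Q \<in> points C" using Q insert.prems by auto
    have Qv: "Q (v ^ k) = int k * Q v" using v by (simp add: pt_power QC)
    have m: "Q u < 0 \<or> Q v < 0" using Q u v by auto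
    consider "Q v < 0" | "Q v \<ge> 0" "Q u < 0" using m by linarith
    then show ?thesis
    proof cases
      case 1
      then have "int k * Q v \<le> int k * (- 1)" by (intro mult_left_mono) auto
      then have "Q (v ^ k) < Q u" using k[OF Q] Qv by simp
      moreover have "Q (v ^ k) < 0" using 1 Qv by (simp add: k_def mult_pos_neg)
      ultimately show ?thesis using pt_add_less[OF QC vk u(1)] by (simp add: add.commute)
    next
      case 2
      then have "0 \<le> Q (v ^ k)" using Qv by simp
      then show ?thesis using pt_add_less[OF QC u(1) vk] 2 by simp
    qed
  qed
  have "0 < P (u + v ^ k)"
  proof -
    have "0 < P (v ^ k)" using v by (simp add: pt_power P k_def del: power_Suc)
    then show ?thesis using pt_min[OF P u(1) vk] neg[of R] u(2) by auto
  qed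
  then show ?case using neg by blast
qed

text \<open>
  With \<open>u\<close> from the previous lemma, \<open>1 / (1 + u\<^sup>M)\<close> is close to
  \<open>1\<close> where \<open>u\<close> vanishes and close to \<open>0\<close> at the poles of
  \<open>u\<close>.
\<close>

lemma approximation:
  assumes S: "finite S" "S \<subseteq> points C" and P: "P \<in> points C" "P \<notin> S"
  shows "\<exists>z. z \<noteq> 0 \<and> P z = 0 \<and> vge P 1 (z - 1) \<and> (\<forall>Q\<in>S. int N \<le> Q z)"
proof -
  obtain u where u: "u \<noteq> 0" "0 < P u" "\<And>Q. Q \<in> S \<Longrightarrow> Q u < 0"
    using separating_function[OF S P] by blast
  define M where "M = Suc N"
  have uM: "u ^ M \<noteq> 0" using u by simp
  have PM: "0 < P (u ^ M)" using u by (simp add: pt_power P M_def del: power_Suc)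
  have d: "1 + u ^ M \<noteq> 0" "P (1 + u ^ M) = 0"
    using pt_add_less[OF P(1) _ uM, of 1] PM P by (auto simp: pt_1)
  define z where "z = inverse (1 + u ^ M)"
  have z: "z \<noteq> 0" "P z = 0" using d by (auto simp: z_def pt_inverse P)
  have "z - 1 = - (u ^ M * z)" using d by (simp add: z_def field_simps)
  then have "vge P 1 (z - 1)" using z PM uM by (simp add: vge_def pt_mult pt_uminus P)
  moreover have "int N \<le> Q z" if Q: "Q \<in> S" for Q
  proof -
    have QC: "Q \<in> points C" using Q S by auto
    have "int M * Q u \<le> int M * (- 1)" using u(3)[OF Q] by (intro mult_left_mono) auto
    then have le: "Q (u ^ M) \<le> - int M" using u by (simp add: pt_power QC)
    then have "Q (u ^ M + 1) = Q (u ^ M)"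
      using pt_add_less[OF QC uM, of 1] QC by (simp add: M_def pt_1)
    then show ?thesis using le by (simp add: z_def pt_inverse QC M_def add.commute)
  qed
  ultimately show ?thesis using z by blast
qed

section \<open>Local conditions and residue fields\<close>

text \<open>
  The functions whose poles at the points of \<open>S\<close> are bounded by \<open>D\<close>.  For
  finite \<open>S\<close> this is a semi-local version of \<open>L(D)\<close>, for
  \<open>S = points C\<close> it is \<open>L(D)\<close> itself.
\<close>

definition LS :: "('a \<Rightarrow> int) set \<Rightarrow> 'a divisor \<Rightarrow> 'a set" where
  "LS S D = {f. \<forall>P\<in>S. vge P (- D P) f}"

lemma subspace_LS: "S \<subseteq> points C \<Longrightarrow> vs.subspace (LS S D)"
  by (rule vs.subspaceI) (auto simp: LS_def intro!: vge_add vge_scl)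

lemma LS_mono: "(\<And>P. P \<in> S \<Longrightarrow> D P \<le> D' P) \<Longrightarrow> LS S D \<subseteq> LS S D'"
  unfolding LS_def using vge_mono by fastforce

text \<open>
  In a polynomial relation at \<open>x\<close>, the constant terms of the coefficients form a linear
  relation modulo \<open>V\<close>, hence vanish; divide by \<open>x\<close> and repeat.
\<close>

lemma kx_indep_of_indep_mod:
  assumes V: "vs.subspace V" and x: "x \<noteq> 0" and B: "vs.indep_mod V B"
    and mem: "\<And>b p. b \<in> B \<Longrightarrow> x * (pev p x * b) \<in> V"
  shows "kx_indep x B"
proof -
  have fB: "finite B" using B vs.indep_mod_def by blast
  have *: "\<forall>b\<in>B. p b = 0"
    if "(\<Sum>b\<in>B. pev (p b) x * b) = 0" "\<forall>b\<in>B. p b = 0 \<or> degree (p b) < n" for p n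
    using that
  proof (induction n arbitrary: p)
    case (Suc n)
    define a where "a b = coeff (p b) 0" for b
    define r where "r b = poly_shift 1 (p b)" for b
    have pr: "p b = pCons (a b) (r b)" for b
      by (rule poly_eqI) (simp add: a_def r_def coeff_poly_shift coeff_pCons split: nat.splits)
    have split: "(\<Sum>b\<in>B. pev (p b) x * b) = (\<Sum>b\<in>B. scl C (a b) b) + x * (\<Sum>b\<in>B. pev (r b) x * b)"
      by (simp add: pr scl_def sum.distrib[symmetric] sum_distrib_left algebra_simps)
    have "x * (\<Sum>b\<in>B. pev (r b) x * b) \<in> V"
      unfolding sum_distrib_left by (rule vs.subspace_sum[OF V mem])
    then have "- (x * (\<Sum>b\<in>B. pev (r b) x * b)) \<in> V"
      by (rule vs.subspace_neg[OF V])
    moreover have "- (x * (\<Sum>b\<in>B. pev (r b) x * b)) = (\<Sum>b\<in>B. scl C (a b) b)"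
      using split Suc.prems(1) by (metis eq_neg_iff_add_eq_0)
    ultimately have "(\<Sum>b\<in>B. scl C (a b) b) \<in> V" by simp
    then have a0: "\<forall>b\<in>B. a b = 0" using B unfolding vs.indep_mod_def by blast
    then have "x * (\<Sum>b\<in>B. pev (r b) x * b) = 0" using split Suc.prems(1) by simp
    then have "(\<Sum>b\<in>B. pev (r b) x * b) = 0" using x by simp
    moreover have "\<forall>b\<in>B. r b = 0 \<or> degree (r b) < n"
      using Suc.prems(2) by (auto simp: pr split: if_splits)
    ultimately have "\<forall>b\<in>B. r b = 0" by (rule Suc.IH)
    then show ?case using a0 by (simp add: pr)
  qed simp
  show ?thesis unfolding kx_indep_def
  proof (intro conjI allI impI)
    show "finite B" by fact
    fix p assume s: "(\<Sum>b\<in>B. pev (p b) x * b) = 0"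
    have "\<forall>b\<in>B. p b = 0 \<or> degree (p b) < Suc (Max ((\<lambda>b. degree (p b)) ` B))"
      using fB by (auto simp: less_Suc_eq_le)
    from *[OF s this] show "\<forall>u\<in>B. p u = 0" .
  qed
qed

text \<open>
  In particular, functions that are regular on \<open>S\<close> and independent modulo \<open>x\<close>
  are independent over \<open>K(x)\<close>.
\<close>

lemma kx_indep_of_local:
  assumes S: "S \<subseteq> points C" and x: "x \<noteq> 0"
    and B: "B \<subseteq> LS S 0" "vs.indep_mod (LS S (\<lambda>P. - P x)) B" and pos: "\<And>P. P \<in> S \<Longrightarrow> 0 \<le> P x"
  shows "kx_indep x B"
proof (rule kx_indep_of_indep_mod[OF subspace_LS[OF S] x B(2)])
  fix b p assume b: "b \<in> B"
  have "vge P (P x + (0 + 0)) (x * (pev p x * b))" if P: "P \<in> S" for P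
  proof (intro vge_mult)
    show PC: "P \<in> points C" "P \<in> points C" using P S by auto
    show "vge P (P x) x" by (simp add: vge_def)
    show "vge P 0 b" using B(1) b P by (auto simp: LS_def)
    show "vge P 0 (pev p x)" unfolding pev_altdef
      using pos[OF P] by (intro vge_sum vge_scl PC) (auto simp: vge_def pt_power x PC)
  qed
  then show "x * (pev p x * b) \<in> LS S (\<lambda>P. - P x)" by (simp add: LS_def)
qed

lemma local_ring_LS: "local_ring P = LS {P} 0" "max_ideal P = LS {P} (\<lambda>_. - 1)"
  by (auto simp: local_ring_def max_ideal_def LS_def vge_def)

text \<open>
  Residue fields have finite degree over \<open>K\<close>: for \<open>x\<close> of order \<open>1\<close>
  at \<open>P\<close>, independence in the residue field implies independence over \<open>K(x)\<close>.
  A smallest set of generators of the residue field is a basis.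
\<close>

lemma residue_basis:
  assumes P: "P \<in> points C"
  shows "\<exists>B. B \<subseteq> local_ring P \<and> vs.indep_mod (max_ideal P) B \<and>
    local_ring P \<subseteq> max_ideal P + vs.span B \<and> card B = point_deg C P"
proof -
  obtain x where x: "x \<noteq> 0" "P x = 1" using pt_ex1[OF P] by blast
  have sm: "vs.subspace (max_ideal P)" "vs.subspace (local_ring P)"
    using P by (auto simp: local_ring_LS intro!: subspace_LS)
  have ml: "max_ideal P \<subseteq> local_ring P" by (auto simp: local_ring_def max_ideal_def)
  have mx: "LS {P} (\<lambda>P. - P x) = max_ideal P" using x by (auto simp: local_ring_LS LS_def)
  have bd: "card Y \<le> kx_rank x" if "Y \<subseteq> local_ring P" "vs.indep_mod (max_ideal P) Y" for Y
    using that P x kx_indep_of_local[of "{P}" x Y] unfolding mx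
    by (intro kx_rank_ge) (auto simp: local_ring_LS)
  have gen: "vs.span B + max_ideal P = local_ring P" if "B \<subseteq> local_ring P" "local_ring P \<subseteq> max_ideal P + vs.span B" for B
  proof
    have "vs.span B \<subseteq> local_ring P" using that(1) sm(2) by (rule vs.span_minimal)
    then show "vs.span B + max_ideal P \<subseteq> local_ring P"
      using ml vs.subspace_add[OF sm(2)] by (auto simp: set_plus_def)
    show "local_ring P \<subseteq> vs.span B + max_ideal P" using that(2) by (simp add: add.commute)
  qed
  let ?Q = "\<lambda>n. \<exists>B. finite B \<and> card B = n \<and> B \<subseteq> local_ring P \<and> local_ring P = vs.span B + max_ideal P"
  obtain Y where Y: "Y \<subseteq> local_ring P" "vs.indep_mod (max_ideal P) Y"
    "local_ring P \<subseteq> max_ideal P + vs.span Y"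
    using vs.rel_basis_of_bound[OF sm(1) bd, of "local_ring P"] by blast
  then have "?Q (card Y)" using gen[of Y] by (auto simp: vs.indep_mod_def)
  then have "?Q (point_deg C P)"
    unfolding point_deg_def by (rule LeastI)
  then obtain B where B: "finite B" "card B = point_deg C P" "B \<subseteq> local_ring P"
    "local_ring P = vs.span B + max_ideal P" by blast
  have "vs.indep_mod (max_ideal P) B"
  proof (rule vs.indep_mod_of_minimal[OF sm(1) B(1)])
    show "local_ring P \<subseteq> max_ideal P + vs.span B" using B(4) by (simp add: add.commute)
    fix B' assume B': "B' \<subseteq> B" "local_ring P \<subseteq> max_ideal P + vs.span B'"
    then have "finite B'" "B' \<subseteq> local_ring P" "local_ring P = vs.span B' + max_ideal P"
      using B(1,3) gen[of B'] by (auto dest: finite_subset)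
    then have "?Q (card B')" by blast
    then show "card B \<le> card B'" unfolding B(2) point_deg_def by (rule Least_le)
  qed
  then show ?thesis using B by (auto simp: add.commute)
qed

lemma point_deg_ge_1:
  assumes P: "P \<in> points C" shows "1 \<le> point_deg C P"
proof -
  obtain B where B: "local_ring P \<subseteq> max_ideal P + vs.span B" "card B = point_deg C P"
    "vs.indep_mod (max_ideal P) B"
    using residue_basis[OF P] by blast
  have "B \<noteq> {}"
  proof
    assume "B = {}"
    then have "local_ring P \<subseteq> max_ideal P" using B(1) by (auto simp: set_plus_def)
    moreover have "1 \<in> local_ring P" "1 \<notin> max_ideal P" using P by (auto simp: local_ring_def max_ideal_def pt_1)
    ultimately show False by blast
  qed
  moreover have "finite B" using B(3) vs.indep_mod_def by blast
  ultimately have "card B \<noteq> 0" by simp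
  then show ?thesis using B(2) by simp
qed

lemma infty_point: "infty C \<in> points C"
  using rational_infty by (simp add: rational_point_def)

lemma point_deg_infty: "point_deg C (infty C) = 1"
proof -
  have "vs.span {1} = range (emb C)"
    by (auto simp: vs.span_singleton scl_def)
  then have "local_ring (infty C) = vs.span {1} + max_ideal (infty C)"
    using rational_infty by (simp add: rational_point_def)
  moreover have "{1} \<subseteq> local_ring (infty C)" by (simp add: local_ring_def infty_point pt_1)
  moreover have "finite {1 :: 'a}" "card {1 :: 'a} = 1" by simp_all
  ultimately have "\<exists>B. finite B \<and> card B = 1 \<and> B \<subseteq> local_ring (infty C) \<and>
     local_ring (infty C) = vs.span B + max_ideal (infty C)"
    by blast
  then have "point_deg C (infty C) \<le> 1" unfolding point_deg_def by (rule Least_le)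
  then show ?thesis using point_deg_ge_1[OF infty_point] by simp
qed

text \<open>Multiplication by a function of order \<open>D' P\<close> at \<open>P\<close> embeds the quotient into the residue field of \<open>P\<close>.\<close>

lemma LS_add_point_le:
  assumes S: "S \<subseteq> points C" and P: "P \<in> S"
    and D': "D' P = D P + 1" "\<And>Q. Q \<in> S \<Longrightarrow> Q \<noteq> P \<Longrightarrow> D' Q = D Q"
    and Y: "Y \<subseteq> LS S D'" "vs.indep_mod (LS S D) Y"
  shows "card Y \<le> point_deg C P"
proof -
  have PC: "P \<in> points C" using S P by auto
  obtain B where B: "local_ring P \<subseteq> max_ideal P + vs.span B" "card B = point_deg C P"
    "vs.indep_mod (max_ideal P) B"
    using residue_basis[OF PC] by blast
  obtain u where u: "u \<noteq> 0" "P u = 1" using pt_ex1[OF PC] by blast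
  define t where "t = u powi (D' P)"
  have t: "t \<noteq> 0" "P t = D' P" using u by (auto simp: t_def pt_powi PC)
  have sm: "vs.subspace (max_ideal P)"
    using PC by (auto simp: local_ring_LS intro!: subspace_LS)
  have fY: "finite Y" using Y vs.indep_mod_def by blast
  have *: "c y = 0" if c: "(\<Sum>y\<in>Y. scl C (c y) (t * y)) \<in> max_ideal P" and y: "y \<in> Y" for c y
  proof -
    define v where "v = (\<Sum>y\<in>Y. scl C (c y) y)"
    have "t * v \<in> max_ideal P" using c by (simp add: v_def scl_def sum_distrib_left mult_ac)
    then have "vge P (- D P) v"
      using vge_mult'[OF PC t(1), of 1 v] t D'(1) by (simp add: local_ring_LS LS_def)
    moreover have "v \<in> LS S D'" unfolding v_def
      using Y(1) by (intro vs.subspace_sum[OF subspace_LS[OF S]] vs.subspace_scale[OF subspace_LS[OF S]]) auto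
    ultimately have "v \<in> LS S D" unfolding LS_def using D'(2) by fastforce
    then show ?thesis using Y(2) y unfolding vs.indep_mod_def v_def by blast
  qed
  have m: "vs.indep_mod (max_ideal P) ((*) t ` Y)" "card ((*) t ` Y) = card Y"
    by (rule vs.indep_mod_family[OF fY sm], erule (1) *)+
  have "(*) t ` Y \<subseteq> local_ring P"
    using Y(1) P t vge_mult'[OF PC t(1), of 0] by (force simp: local_ring_LS LS_def)
  then have "(*) t ` Y \<subseteq> max_ideal P + vs.span B" using B(1) by blast
  moreover have "finite B" using B(3) vs.indep_mod_def by blast
  ultimately have "card ((*) t ` Y) \<le> card B"
    using vs.indep_mod_card_le[OF sm m(1)] by blast
  then show ?thesis using m(2) B(2) by simp
qed

text \<open>By approximation, every residue class at \<open>P\<close> comes from a function that respects the bounds at the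
  other points of a finite set.\<close>

lemma LS_add_point_eq:
  assumes S: "finite S" "S \<subseteq> points C" and P: "P \<in> S"
    and D': "D' P = D P + 1" "\<And>Q. Q \<in> S \<Longrightarrow> Q \<noteq> P \<Longrightarrow> D' Q = D Q"
  shows "\<exists>Y. Y \<subseteq> LS S D' \<and> vs.indep_mod (LS S D) Y \<and> card Y = point_deg C P"
proof -
  have PC: "P \<in> points C" using S P by auto
  obtain B where B: "B \<subseteq> local_ring P" "card B = point_deg C P"
    "vs.indep_mod (max_ideal P) B"
    using residue_basis[OF PC] by blast
  have fB: "finite B" using B vs.indep_mod_def by blast
  have B0: "b \<noteq> 0" if "b \<in> B" for b
    using vs.indep_mod_notin[OF B(3) that] by (auto simp: max_ideal_def)
  obtain u where u: "u \<noteq> 0" "P u = 1" using pt_ex1[OF PC] by blast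
  define t where "t = u powi (- D' P)"
  have t: "t \<noteq> 0" "P t = - D' P" using u by (auto simp: t_def pt_powi PC)
  define n where "n b Q = nat (- D' Q - Q t - Q b)" for b Q
  define N where "N = Max (insert 0 ((\<lambda>(b, Q). n b Q) ` (B \<times> S)))"
  have N: "n b Q \<le> N" if "b \<in> B" "Q \<in> S" for b Q
    unfolding N_def using fB S(1) that by (intro Max_ge) force+
  obtain z where z: "z \<noteq> 0" "P z = 0" "\<And>Q. Q \<in> S - {P} \<Longrightarrow> int N \<le> Q z"
    using approximation[of "S - {P}" P N] S PC by blast
  have mem: "z * t * b \<in> LS S D'" if b: "b \<in> B" for b
    unfolding LS_def
  proof (intro CollectI ballI)
    fix Q assume Q: "Q \<in> S"
    then have QC: "Q \<in> points C" using S by auto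
    have e: "Q (z * t * b) = Q z + Q t + Q b" using z t B0[OF b] by (simp add: pt_mult QC)
    show "vge Q (- D' Q) (z * t * b)"
    proof (cases "Q = P")
      case True
      then show ?thesis using e z t B(1) b by (auto simp: vge_def local_ring_def)
    next
      case False
      then have "int (n b Q) \<le> Q z" using N[OF b Q] z(3)[of Q] Q by simp
      then have "- D' Q - Q t - Q b \<le> Q z" unfolding n_def by linarith
      then show ?thesis using e by (simp add: vge_def)
    qed
  qed
  have *: "c b = 0" if c: "(\<Sum>b\<in>B. scl C (c b) (z * t * b)) \<in> LS S D" and b: "b \<in> B" for c b
  proof -
    define v where "v = (\<Sum>b\<in>B. scl C (c b) b)"
    have "z * t * v \<in> LS S D" using c by (simp add: v_def scl_def sum_distrib_left mult_ac)
    then have "vge P (- D P) (z * t * v)" using P by (simp add: LS_def)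
    then have "v \<in> max_ideal P"
      using vge_mult'[OF PC, of "z * t" "- D P" v] t z D'(1)
      by (simp add: local_ring_LS LS_def pt_mult PC)
    then show ?thesis using B(3) b unfolding vs.indep_mod_def v_def by blast
  qed
  have m: "vs.indep_mod (LS S D) ((\<lambda>b. z * t * b) ` B)" "card ((\<lambda>b. z * t * b) ` B) = card B"
    by (rule vs.indep_mod_family[OF fB subspace_LS[OF S(2)]], erule (1) *)+
  show ?thesis using m mem B(2) by (intro exI[of _ "(\<lambda>b. z * t * b) ` B"]) auto
qed

text \<open>
  Add the points of \<open>D' - D\<close> one at a time.
\<close>

lemma LS_rel_basis:
  assumes S: "finite S" "S \<subseteq> points C" and D: "\<And>P. P \<in> S \<Longrightarrow> D P \<le> D' P"
  shows "\<exists>Y. Y \<subseteq> LS S D' \<and> vs.indep_mod (LS S D) Y \<and>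
    card Y = (\<Sum>P\<in>S. nat (D' P - D P) * point_deg C P)"
  using D
proof (induction "\<Sum>P\<in>S. nat (D' P - D P)" arbitrary: D)
  case 0
  then have "D' P = D P" if "P \<in> S" for P using S(1) that by force
  then show ?case by (intro exI[of _ "{}"]) (simp add: vs.indep_mod_def)
next
  case (Suc n)
  then have "(\<Sum>P\<in>S. nat (D' P - D P)) \<noteq> 0" by linarith
  then have "\<exists>P\<in>S. nat (D' P - D P) \<noteq> 0"
    by (rule contrapos_np) (rule sum.neutral, blast)
  then obtain P where P: "P \<in> S" "D P < D' P" by auto
  define E where "E = D(P := D P + 1)"
  have E1: "nat (D' P - D P) = Suc (nat (D' P - E P))" using P by (simp add: E_def nat_diff_distrib')
  have rest: "(\<Sum>Q\<in>S - {P}. f (D' Q - D Q) Q) = (\<Sum>Q\<in>S - {P}. f (D' Q - E Q) Q)" for f :: "int \<Rightarrow> _ \<Rightarrow> nat"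
    by (rule sum.cong) (auto simp: E_def)
  have "n = (\<Sum>P\<in>S. nat (D' P - E P))"
    using Suc(2) rest[of "\<lambda>i Q. nat i"] E1 by (simp add: sum.remove[OF S(1) P(1)])
  moreover have "E Q \<le> D' Q" if "Q \<in> S" for Q using Suc.prems[OF that] P by (simp add: E_def)
  ultimately obtain Y where Y: "Y \<subseteq> LS S D'" "vs.indep_mod (LS S E) Y"
      "card Y = (\<Sum>P\<in>S. nat (D' P - E P) * point_deg C P)"
    using Suc.hyps(1)[of E] by blast
  obtain Z where Z: "Z \<subseteq> LS S E" "vs.indep_mod (LS S D) Z" "card Z = point_deg C P"
    using LS_add_point_eq[OF S P(1), of E D] by (auto simp: E_def)
  have DE: "LS S D \<subseteq> LS S E" "LS S E \<subseteq> LS S D'"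
    using P Suc.prems by (auto intro!: LS_mono simp: E_def)
  note un = vs.indep_mod_Un[OF subspace_LS[OF S(2)] subspace_LS[OF S(2)] DE(1) Z(2,1) Y(2)]
  have "card (Z \<union> Y) = (\<Sum>P\<in>S. nat (D' P - D P) * point_deg C P)"
    using un(2) Z Y rest[of "\<lambda>i Q. nat i * point_deg C Q"] E1
    by (simp add: card_Un_disjoint vs.indep_mod_def sum.remove[OF S(1) P(1)])
  then show ?case using un(1) Z(1) Y(1) DE by (intro exI[of _ "Z \<union> Y"]) auto
qed

text \<open>
  The sum is the dimension over \<open>K\<close> of the semi-local ring of \<open>S\<close> modulo
  \<open>x\<close>, and independence modulo \<open>x\<close> implies independence over
  \<open>K(x)\<close>.
\<close>

lemma zeros_bound:
  assumes S: "finite S" "S \<subseteq> points C" and x: "x \<noteq> 0" and pos: "\<And>P. P \<in> S \<Longrightarrow> 0 \<le> P x"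
  shows "(\<Sum>P\<in>S. nat (P x) * point_deg C P) \<le> kx_rank x"
proof -
  obtain Y where Y: "Y \<subseteq> LS S 0" "vs.indep_mod (LS S (\<lambda>P. - P x)) Y"
    "card Y = (\<Sum>P\<in>S. nat (0 P - - P x) * point_deg C P)"
    using LS_rel_basis[OF S, of "\<lambda>P. - P x" 0] pos by auto
  have "kx_indep x Y" by (rule kx_indep_of_local[OF S(2) x Y(1,2)]) (rule pos)
  then show ?thesis using kx_rank_ge[of x Y] Y(3) by simp
qed

lemma finite_zeros:
  assumes x: "x \<noteq> 0" shows "finite {P \<in> points C. 0 < P x}"
proof (rule ccontr)
  assume inf: "infinite {P \<in> points C. 0 < P x}"
  obtain S where S: "finite S" "card S = Suc (kx_rank x)" "S \<subseteq> {P \<in> points C. 0 < P x}"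
    using infinite_arbitrarily_large[OF inf, of "Suc (kx_rank x)"] by blast
  have "card S = (\<Sum>P\<in>S. 1)" by simp
  also have "\<dots> \<le> (\<Sum>P\<in>S. nat (P x) * point_deg C P)"
  proof (rule sum_mono)
    fix P assume "P \<in> S"
    then have "P \<in> points C" "0 < P x" using S(3) by auto
    then have "1 \<le> nat (P x)" "1 \<le> point_deg C P" using point_deg_ge_1 by simp_all
    then show "1 \<le> nat (P x) * point_deg C P" using mult_le_mono[of 1 _ 1] by simp
  qed
  also have "\<dots> \<le> kx_rank x" using S by (intro zeros_bound x) auto
  finally show False using S by simp
qed

lemma is_divisor_principal:
  assumes "f \<noteq> 0" shows "is_divisor C (principal_div C f)"
proof -
  have "{P. principal_div C f P \<noteq> 0} \<subseteq> {P \<in> points C. 0 < P f} \<union> {P \<in> points C. 0 < P (inverse f)}"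
    by (auto simp: principal_div_def pt_inverse split: if_splits)
  moreover have "finite \<dots>" using finite_zeros[of f] finite_zeros[of "inverse f"] assms by simp
  ultimately show ?thesis
    unfolding is_divisor_def by (auto simp: principal_div_def finite_subset split: if_splits)
qed

section \<open>The constant field\<close>

lemma transcendental_of_order:
  assumes P: "P \<in> points C" and f: "f \<noteq> 0" "P f \<noteq> 0"
  shows "transcendental f"
  unfolding transcendental_def
proof (intro allI impI)
  fix p :: "'k poly" assume p: "p \<noteq> 0"
  \<comment> \<open>The nonzero monomials of \<open>pev p f\<close> have pairwise different orders at \<open>P\<close>.\<close>
  have "pev p f \<noteq> 0 \<and> (\<exists>i\<le>degree p. P (pev p f) = int i * P f)" if "p \<noteq> 0" "P f > 0" for p f
    using that
  proof (induction p)
    case (pCons a p)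
    have f: "f \<noteq> 0" using pCons.prems(2) P by (auto simp: pt_0)
    show ?case
    proof (cases "p = 0")
      case True
      then show ?thesis using pCons.prems by (simp add: P pt_emb)
    next
      case False
      then obtain i where i: "pev p f \<noteq> 0" "i \<le> degree p" "P (pev p f) = int i * P f"
        using pCons by blast
      have pf: "f * pev p f \<noteq> 0" "P (f * pev p f) = int (Suc i) * P f"
        using i f by (auto simp: pt_mult P algebra_simps)
      show ?thesis
      proof (cases "a = 0")
        case True
        then show ?thesis using i pf False by (intro conjI exI[of _ "Suc i"]) auto
      next
        case a: False
        have "P (emb C a) < P (f * pev p f)" using pf(2) pCons.prems by (simp add: P pt_emb)
        then have "emb C a + f * pev p f \<noteq> 0" "P (emb C a + f * pev p f) = 0"
          using pt_add_less[OF P, of "emb C a"] a pf(1) P by (auto simp: pt_emb)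
        then show ?thesis by (intro conjI exI[of _ 0]) auto
      qed
    qed
  qed simp
  note pos = this
  show "pev p f \<noteq> 0"
  proof (cases "P f > 0")
    case True
    then show ?thesis using pos p by blast
  next
    case False
    then have "P (inverse f) > 0" using f P by (simp add: pt_inverse)
    then have "pev (reflect_poly p) (inverse f) \<noteq> 0" using pos[of "reflect_poly p"] p by auto
    moreover have "pev (reflect_poly p) (inverse f) * f ^ degree p = pev p f"
    proof -
      have "map_poly (emb C) (reflect_poly p) = reflect_poly (map_poly (emb C) p)"
        by (rule poly_eqI) (simp add: coeff_map_poly coeff_reflect_poly degree_map_poly)
      moreover have "degree (map_poly (emb C) p) = degree p" by (rule degree_map_poly) simp
      ultimately show ?thesis
        using poly_reflect_poly_nz[of f "map_poly (emb C) p"] f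
          poly_reflect_poly_nz[of "inverse f" "map_poly (emb C) p"]
        by (simp add: pev_def field_simps)
    qed
    ultimately show ?thesis using f by auto
  qed
qed

text \<open>
  The base field is algebraically closed in the function field because \<open>P\<^sub>\<infinity>\<close>
  is rational: subtracting the value at \<open>P\<^sub>\<infinity>\<close> gives a function of nonzero
  order there.
\<close>

lemma transcendental_of_nonconst:
  assumes "f \<notin> range (emb C)" shows "transcendental f"
proof -
  have nz: "f - emb C c \<noteq> 0" for c using assms by auto
  have f0: "f \<noteq> 0" using nz[of 0] by simp
  have "\<exists>c. infty C (f - emb C c) \<noteq> 0"
  proof (cases "infty C f = 0")
    case True
    then have "f \<in> local_ring (infty C)" by (simp add: local_ring_def)
    then obtain c m where "f = emb C c + m" "m \<in> max_ideal (infty C)"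
      using rational_infty by (auto simp: rational_point_def set_plus_def)
    then show ?thesis using nz[of c] by (intro exI[of _ c]) (auto simp: max_ideal_def)
  next
    case False
    then show ?thesis by (intro exI[of _ 0]) simp
  qed
  then obtain c where c: "infty C (f - emb C c) \<noteq> 0" by blast
  have tr: "transcendental (f - emb C c)"
    by (rule transcendental_of_order[OF infty_point nz c])
  show ?thesis unfolding transcendental_def
  proof (intro allI impI)
    fix p :: "'k poly" assume p: "p \<noteq> 0"
    have "pcompose p [:c, 1:] \<noteq> 0" using p by (simp add: pcompose_eq_0_iff)
    then have "pev (pcompose p [:c, 1:]) (f - emb C c) \<noteq> 0" using tr by (simp add: transcendental_def)
    then show "pev p f \<noteq> 0" by (simp add: pev_pcompose)
  qed
qed

end

section \<open>Existence of poles\<close>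

text \<open>
  A valuation ring over \<open>K\<close> with a nonzero nonunit \<open>u\<close>.  It is shown to be
  discrete, and so defines a point.
\<close>

locale valuation_ring = pointed_curve C
  for C :: "('k::field, 'a::field) curve" +
  fixes R :: "'a set" and u :: 'a
  assumes const: "emb C c \<in> R"
    and add: "a \<in> R \<Longrightarrow> b \<in> R \<Longrightarrow> a + b \<in> R"
    and mult: "a \<in> R \<Longrightarrow> b \<in> R \<Longrightarrow> a * b \<in> R"
    and total: "a \<noteq> 0 \<Longrightarrow> a \<in> R \<or> inverse a \<in> R"
    and nonunit: "u \<in> R" "u \<noteq> 0" "inverse u \<notin> R"
begin

definition M :: "'a set" where
  "M = {f \<in> R. f = 0 \<or> inverse f \<notin> R}"

lemma R_01 [simp]: "0 \<in> R" "1 \<in> R"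
  using const[of 0] const[of 1] by simp_all

lemma R_power: "a \<in> R \<Longrightarrow> a ^ n \<in> R"
  by (induction n) (auto intro: mult)

lemma R_sum: "(\<And>i. i \<in> I \<Longrightarrow> f i \<in> R) \<Longrightarrow> (\<Sum>i\<in>I. f i) \<in> R"
  by (induction I rule: infinite_finite_induct) (auto intro: add)

lemma M_R: "f \<in> M \<Longrightarrow> f \<in> R" by (simp add: M_def)

lemma M_mult: assumes f: "f \<in> M" and a: "a \<in> R" shows "f * a \<in> M"
proof (cases "f * a = 0")
  case False
  have "inverse (f * a) \<notin> R"
  proof
    assume "inverse (f * a) \<in> R"
    then have "inverse (f * a) * a \<in> R" using a by (rule mult)
    moreover have "inverse (f * a) * a = inverse f" using False by (simp add: field_simps)
    ultimately have "inverse f \<in> R" by (simp only:)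
    then show False using f False by (auto simp: M_def)
  qed
  then show ?thesis using mult[OF M_R[OF f] a] by (simp add: M_def)
qed (auto simp: M_def)

lemma M_add: assumes f: "f \<in> M" and h: "h \<in> M" shows "f + h \<in> M"
proof -
  have *: "f + h \<in> M" if fh: "f \<in> M" "h \<in> M" "f \<noteq> 0" "h \<noteq> 0" "h / f \<in> R" for f h
  proof -
    have "f * (1 + h / f) \<in> M" by (intro M_mult add fh) simp
    moreover have "f * (1 + h / f) = f + h" using fh by (simp add: field_simps)
    ultimately show ?thesis by simp
  qed
  have "f + h \<in> M" if "f \<noteq> 0" "h \<noteq> 0"
    using total[of "h / f"] *[OF f h] *[OF h f] that by (auto simp: add.commute)
  then show ?thesis using f h by (cases "f = 0"; cases "h = 0") auto
qed

lemma M_sum: "(\<And>i. i \<in> I \<Longrightarrow> f i \<in> M) \<Longrightarrow> (\<Sum>i\<in>I. f i) \<in> M"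
proof (induction I rule: infinite_finite_induct)
  case (insert i I)
  then show ?case using M_add[of "f i" "sum f I"] by simp
qed (simp_all add: M_def)

lemma const_notin_M: "c \<noteq> 0 \<Longrightarrow> emb C c \<notin> M"
  using const[of "inverse c"] by (auto simp: M_def emb_inverse)

lemma subspace_scaled_M: "vs.subspace {x * f |f. f \<in> M}"
proof (rule vs.subspaceI)
  show "0 \<in> {x * f |f. f \<in> M}" by (force simp: M_def)
  fix a b assume "a \<in> {x * f |f. f \<in> M}" "b \<in> {x * f |f. f \<in> M}"
  then obtain f h where "a = x * f" "b = x * h" "f \<in> M" "h \<in> M" by blast
  then have "a + b = x * (f + h)" "f + h \<in> M" by (auto intro: M_add simp: algebra_simps)
  then show "a + b \<in> {x * f |f. f \<in> M}" by blast
next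
  fix c a assume "a \<in> {x * f |f. f \<in> M}"
  then obtain f where "a = x * f" "f \<in> M" by blast
  then have "scl C c a = x * (f * emb C c)" "f * emb C c \<in> M"
    by (auto intro: M_mult const simp: scl_def)
  then show "scl C c a \<in> {x * f |f. f \<in> M}" by blast
qed

text \<open>
  A sequence of nonunits, each a multiple of the next by a nonunit; in the valuation ring of a point, the
  orders strictly decrease.
\<close>

definition chain :: "(nat \<Rightarrow> 'a) \<Rightarrow> nat \<Rightarrow> bool" where
  "chain f n \<longleftrightarrow> (\<forall>i\<le>n. f i \<in> M \<and> f i \<noteq> 0) \<and> (\<forall>i<n. f i / f (Suc i) \<in> M)"

lemma chain_quotient:
  assumes "chain f n" "i < j" "j \<le> n" shows "f i / f j \<in> M"
  using assms(2,3)
proof (induction j)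
  case (Suc j)
  have fj: "f j / f (Suc j) \<in> M" using assms(1) Suc.prems by (simp add: chain_def)
  show ?case
  proof (cases "i = j")
    case False
    then have "f i / f j * (f j / f (Suc j)) \<in> M" using Suc fj by (intro M_mult) (auto intro: M_R)
    moreover have "f j \<noteq> 0" using assms(1) Suc.prems by (simp add: chain_def)
    ultimately show ?thesis by simp
  qed (use fj in simp)
qed simp

text \<open>
  The members of a chain are independent over \<open>K(f 0)\<close>.  In a linear relation modulo
  \<open>f 0 * M\<close>, divide by the last member with a nonzero coefficient: all other terms become
  nonunits, so this nonzero constant would be a nonunit as well.
\<close>

lemma chain_bound:
  assumes ch: "chain f n" shows "n < kx_rank (f 0)"
proof -
  define x where "x = f 0"
  have x: "x \<in> M" "x \<noteq> 0" using ch by (auto simp: x_def chain_def)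
  let ?V = "{x * f |f. f \<in> M}"
  have nz: "f i \<noteq> 0" "f i \<in> M" if "i \<le> n" for i using ch that by (auto simp: chain_def)
  have q: "f 0 / f j \<in> R" if "j \<le> n" for j
    using chain_quotient[OF ch, of 0 j] nz[of 0] that by (cases "j = 0") (auto intro: M_R)
  have *: "c i = 0" if c: "(\<Sum>i\<le>n. scl C (c i) (f i)) \<in> ?V" and i: "i \<in> {..n}" for c i
  proof (rule ccontr)
    assume "c i \<noteq> 0"
    define j where "j = (GREATEST j. j \<le> n \<and> c j \<noteq> 0)"
    have ex: "i \<le> n \<and> c i \<noteq> 0" using i \<open>c i \<noteq> 0\<close> by simp
    have j: "j \<le> n" "c j \<noteq> 0"
      using GreatestI_nat[of "\<lambda>j. j \<le> n \<and> c j \<noteq> 0" i n, OF ex] by (auto simp: j_def)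
    have above: "c k = 0" if "j < k" "k \<le> n" for k
      using Greatest_le_nat[of "\<lambda>j. j \<le> n \<and> c j \<noteq> 0" k n] that by (force simp: j_def)
    obtain h where h: "(\<Sum>i\<le>n. scl C (c i) (f i)) = x * h" "h \<in> M" using c by blast
    have "(\<Sum>i\<le>n. scl C (c i) (f i)) = scl C (c j) (f j) + (\<Sum>i\<in>{..n} - {j}. scl C (c i) (f i))"
      using j by (simp add: sum.remove)
    then have "emb C (c j) * f j = x * h - (\<Sum>i\<in>{..n} - {j}. scl C (c i) (f i))"
      using h(1) by (simp add: scl_def eq_diff_eq)
    then have "emb C (c j) = (x * h - (\<Sum>i\<in>{..n} - {j}. scl C (c i) (f i))) / f j"
      using nz[OF j(1)] by (simp add: field_simps)
    also have "\<dots> = h * (f 0 / f j) + (\<Sum>i\<in>{..n} - {j}. f i / f j * emb C (- c i))"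
      by (simp add: diff_divide_distrib sum_divide_distrib x_def scl_def emb_minus sum_negf mult_ac)
    also have "\<dots> \<in> M"
    proof (rule M_add[OF M_mult[OF h(2) q[OF j(1)]] M_sum])
      fix k assume k: "k \<in> {..n} - {j}"
      show "f k / f j * emb C (- c k) \<in> M"
      proof (cases "k < j")
        case True
        then show ?thesis using chain_quotient[OF ch True j(1)] by (intro M_mult const)
      next
        case False
        then show ?thesis using above[of k] k by (simp add: M_def)
      qed
    qed
    finally show False using const_notin_M[OF j(2)] by blast
  qed
  have m: "vs.indep_mod ?V (f ` {..n})" "card (f ` {..n}) = card {..n}"
    by (rule vs.indep_mod_family[OF finite_atMost subspace_scaled_M], erule (1) *)+
  have "kx_indep x (f ` {..n})"
  proof (rule kx_indep_of_indep_mod[OF subspace_scaled_M x(2) m(1)])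
    fix b p assume "b \<in> f ` {..n}"
    then have "b \<in> M" using nz by auto
    moreover have "pev p x \<in> R" unfolding pev_altdef scl_def
      using x(1) by (intro R_sum mult const R_power M_R)
    ultimately have "pev p x * b \<in> M" using M_mult by (simp add: mult.commute)
    then show "x * (pev p x * b) \<in> ?V" by blast
  qed
  from kx_rank_ge[OF this] show ?thesis using m(2) by (simp add: x_def)
qed

text \<open>
  The last member of a longest chain that starts with \<open>u\<close> generates the maximal ideal;
  otherwise the chain could be prolonged.
\<close>

lemma uniformizer: "\<exists>\<pi>. \<pi> \<noteq> 0 \<and> \<pi> \<in> M \<and> (\<forall>a\<in>M. a / \<pi> \<in> R)"
proof -
  let ?P = "\<lambda>n. \<exists>f. f 0 = u \<and> chain f n"
  have "?P 0" using nonunit by (intro exI[of _ "\<lambda>_. u"]) (simp add: chain_def M_def)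
  moreover have bd: "n \<le> kx_rank u" if "?P n" for n using that chain_bound by fastforce
  ultimately have "?P (GREATEST n. ?P n)" by (rule GreatestI_nat[of ?P])
  then obtain f where f: "f 0 = u" "chain f (GREATEST n. ?P n)" by blast
  obtain n where n: "n = (GREATEST n. ?P n)" by blast
  have ch: "chain f n" using f(2) n by simp
  have fn: "f n \<noteq> 0" "f n \<in> M" using ch by (auto simp: chain_def)
  have "a / f n \<in> R" if a: "a \<in> M" for a
  proof (rule ccontr)
    assume na: "a / f n \<notin> R"
    then have a0: "a \<noteq> 0" by auto
    have "inverse (a / f n) \<in> R" using total[of "a / f n"] na a0 fn by auto
    then have q: "f n / a \<in> M" using na a0 fn by (simp add: M_def)
    have "chain (f(Suc n := a)) (Suc n)"
      using ch q a a0 by (auto simp: chain_def le_Suc_eq less_Suc_eq)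
    then have "?P (Suc n)" using f(1) by (intro exI[of _ "f(Suc n := a)"]) simp
    then have "Suc n \<le> (GREATEST n. ?P n)" by (rule Greatest_le_nat[of ?P]) (rule bd)
    then have "Suc n \<le> n" using n by simp
    then show False by simp
  qed
  then show ?thesis using fn by blast
qed

text \<open>
  The powers of a uniformizer \<open>\<pi>\<close> that divide \<open>h\<close> give a chain that starts
  with \<open>h\<close>, so their number is bounded and \<open>h\<close> is a unit times a power of
  \<open>\<pi>\<close>.  The exponent of that power is the valuation.
\<close>

lemma point_of_valuation_ring: "\<exists>P\<in>points C. 0 < P u"
proof -
  obtain \<pi> where \<pi>: "\<pi> \<noteq> 0" "\<pi> \<in> M" "\<And>a. a \<in> M \<Longrightarrow> a / \<pi> \<in> R" using uniformizer by blast
  define unit where "unit f \<longleftrightarrow> f \<in> R \<and> f \<noteq> 0 \<and> inverse f \<in> R" for f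
  have unit_mult: "unit (f * h)" if "unit f" "unit h" for f h
    using that by (auto simp: unit_def intro: mult)
  have unit_inverse: "unit (inverse f)" if "unit f" for f using that by (auto simp: unit_def)
  have fact_R: "\<exists>k::nat. unit (h / \<pi> ^ k)" if h: "h \<in> R" "h \<noteq> 0" for h
  proof (cases "h \<in> M")
    case False
    then show ?thesis using h by (intro exI[of _ 0]) (simp add: unit_def M_def)
  next
    case True
    let ?P = "\<lambda>k. h / \<pi> ^ k \<in> R"
    have bd: "k \<le> kx_rank h" if k: "?P k" for k
    proof (cases k)
      case (Suc n)
      define f where "f i = (if i = 0 then h else \<pi> ^ (k - i))" for i
      have "chain f n" unfolding chain_def
      proof (intro conjI allI impI)
        fix i assume i: "i \<le> n"
        then obtain l where l: "k - i = Suc l" using Suc by (metis Suc_diff_le)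
        have "\<pi> * \<pi> ^ l \<in> M" using \<pi>(2) by (intro M_mult R_power M_R)
        then show "f i \<in> M" using True l by (simp add: f_def)
        show "f i \<noteq> 0" using h \<pi> by (simp add: f_def)
      next
        fix i assume i: "i < n"
        show "f i / f (Suc i) \<in> M"
        proof (cases "i = 0")
          case True
          have "\<pi> * (h / \<pi> ^ k) \<in> M" using \<pi>(2) k by (rule M_mult)
          moreover have "\<pi> * (h / \<pi> ^ k) = f i / f (Suc i)" using True Suc \<pi> by (simp add: f_def)
          ultimately show ?thesis by simp
        next
          case False
          have "k - i = Suc (k - Suc i)" using i Suc by simp
          then have "f i / f (Suc i) = \<pi>" using False \<pi>(1) by (simp add: f_def)
          then show ?thesis using \<pi>(2) by simp
        qed
      qed
      from chain_bound[OF this] show ?thesis using Suc by (simp add: f_def)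
    qed simp
    have "?P 0" using h by simp
    then have P: "?P (GREATEST k. ?P k)" by (rule GreatestI_nat[of ?P]) (rule bd)
    define k where "k = (GREATEST k. ?P k)"
    have "h / \<pi> ^ k \<notin> M"
    proof
      assume "h / \<pi> ^ k \<in> M"
      from \<pi>(3)[OF this] have "?P (Suc k)" by (simp add: mult.commute)
      then have "Suc k \<le> k" unfolding k_def by (rule Greatest_le_nat[of ?P]) (rule bd)
      then show False by simp
    qed
    then have "unit (h / \<pi> ^ k)" using P h \<pi> by (auto simp: unit_def M_def k_def)
    then show ?thesis by blast
  qed
  have ex: "\<exists>i::int. unit (h / \<pi> powi i)" if h: "h \<noteq> 0" for h
  proof (cases "h \<in> R")
    case True
    then obtain k where "unit (h / \<pi> ^ k)" using fact_R h by blast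
    then show ?thesis by (intro exI[of _ "int k"]) simp
  next
    case False
    then obtain k where "unit (inverse h / \<pi> ^ k)" using fact_R[of "inverse h"] h total by auto
    then have "unit (inverse (inverse h / \<pi> ^ k))" by (rule unit_inverse)
    then show ?thesis by (intro exI[of _ "- int k"]) (simp add: power_int_minus field_simps)
  qed
  have pos: "0 \<le> i" if "\<pi> powi i \<in> R" for i
  proof (rule ccontr)
    assume "\<not> 0 \<le> i"
    then obtain k where i: "i = - int (Suc k)" using negD[of i] by auto
    have "\<pi> powi i * \<pi> ^ k \<in> R" by (rule mult[OF that R_power[OF M_R[OF \<pi>(2)]]])
    moreover have "\<pi> powi i * \<pi> ^ k = inverse \<pi>" using \<pi>(1) by (simp only: i power_int_minus power_int_of_nat) (simp add: field_simps)
    ultimately show False using \<pi> by (simp add: M_def)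
  qed
  have uniq: "i = j" if "unit (h / \<pi> powi i)" "unit (h / \<pi> powi j)" for h i j
  proof -
    have *: "0 \<le> i - j" if "unit (h / \<pi> powi i)" "unit (h / \<pi> powi j)" for i j
    proof (rule pos)
      have "unit (inverse (h / \<pi> powi i) * (h / \<pi> powi j))" using that by (intro unit_mult unit_inverse)
      moreover have "inverse (h / \<pi> powi i) * (h / \<pi> powi j) = \<pi> powi (i - j)"
        using that \<pi>(1) by (auto simp: unit_def power_int_diff field_simps)
      ultimately show "\<pi> powi (i - j) \<in> R" by (simp add: unit_def)
    qed
    show ?thesis using *[OF that] *[OF that(2,1)] by simp
  qed
  define P where "P h = (if h = 0 then 0 else SOME i. unit (h / \<pi> powi i))" for h
  have P: "unit (h / \<pi> powi (P h))" if "h \<noteq> 0" for h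
    using someI_ex[OF ex[OF that]] that by (simp add: P_def)
  have Peq: "P h = i" if "unit (h / \<pi> powi i)" for h i
    using that P[of h] by (intro uniq[of h]) (auto simp: unit_def)
  have Pmult: "P (f * h) = P f + P h" if "f \<noteq> 0" "h \<noteq> 0" for f h
    using unit_mult[OF P[OF that(1)] P[OF that(2)]] \<pi>(1)
    by (intro Peq) (simp add: power_int_add)
  have R_iff: "h \<in> R \<longleftrightarrow> 0 \<le> P h" if h: "h \<noteq> 0" for h
  proof
    assume "h \<in> R"
    then obtain k where "unit (h / \<pi> ^ k)" using fact_R h by blast
    then have "P h = int k" by (intro Peq) simp
    then show "0 \<le> P h" by simp
  next
    assume "0 \<le> P h"
    then have "\<pi> powi P h \<in> R" using R_power[OF M_R[OF \<pi>(2)]] by (simp add: power_int_def)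
    then have "h / \<pi> powi P h * \<pi> powi P h \<in> R" using P[OF h] by (intro mult) (auto simp: unit_def)
    then show "h \<in> R" using \<pi>(1) by simp
  qed
  have "P \<in> points C" unfolding points_def
  proof (intro CollectI conjI allI impI)
    show "P 0 = 0" by (simp add: P_def)
    have "P \<pi> = 1" using \<pi>(1) by (intro Peq) (simp add: unit_def)
    then show "1 \<in> P ` (UNIV - {0})" using \<pi>(1) by force
    fix f h :: 'a assume fh: "f \<noteq> 0" "h \<noteq> 0"
    show "P (f * h) = P f + P h" using Pmult fh by blast
    assume s: "f + h \<noteq> 0"
    have *: "P f \<le> P (f + h)" if fh: "f \<noteq> 0" "h \<noteq> 0" and s: "f + h \<noteq> 0" and le: "P f \<le> P h" for f h
    proof -
      have "h = f * (h / f)" using fh by simp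
      then have "P h = P f + P (h / f)" using Pmult[of f "h / f"] fh by simp
      then have "h / f \<in> R" using le R_iff[of "h / f"] fh by simp
      then have r: "1 + h / f \<in> R" by (intro add) simp_all
      have e: "f + h = f * (1 + h / f)" using fh by (simp add: field_simps)
      then have nz: "1 + h / f \<noteq> 0" using s by auto
      have "P (f + h) = P f + P (1 + h / f)" unfolding e by (rule Pmult[OF fh(1) nz])
      then show ?thesis using R_iff[OF nz] r by simp
    qed
    show "min (P f) (P h) \<le> P (f + h)"
      using *[OF fh s] *[of h f] fh s by (simp add: add.commute min_def)
  next
    fix c :: 'k assume "c \<noteq> 0"
    then have "unit (emb C c / \<pi> powi 0)" using const[of c] const[of "inverse c"] by (simp add: unit_def emb_inverse)
    then show "P (emb C c) = 0" by (rule Peq)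
  qed
  moreover have "0 < P u"
  proof -
    have "P (inverse u) < 0" using R_iff[of "inverse u"] nonunit by simp
    moreover have "P 1 = 0" by (intro Peq) (simp add: unit_def)
    then have "P u + P (inverse u) = 0" using Pmult[of u "inverse u"] nonunit by simp
    ultimately show ?thesis by simp
  qed
  ultimately show ?thesis by blast
qed

end

context pointed_curve
begin

definition const_subring :: "'a set \<Rightarrow> bool" where
  "const_subring A \<longleftrightarrow> range (emb C) \<subseteq> A \<and> (\<forall>a\<in>A. \<forall>b\<in>A. a + b \<in> A \<and> a * b \<in> A)"

text \<open>
  Zorn's lemma, starting from \<open>K[1 / y]\<close>; this ring does not contain \<open>y\<close>
  because \<open>1 / y\<close> is transcendental.
\<close>

lemma maximal_subring_without:
  assumes y: "y \<notin> range (emb C)"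
  shows "\<exists>A. const_subring A \<and> inverse y \<in> A \<and> y \<notin> A \<and>
    (\<forall>B. const_subring B \<longrightarrow> A \<subseteq> B \<longrightarrow> y \<notin> B \<longrightarrow> B = A)"
proof -
  define F where "F = {A. const_subring A \<and> inverse y \<in> A \<and> y \<notin> A}"
  have y0: "y \<noteq> 0" using y rangeI[of "emb C" 0] by auto
  have "inverse y \<notin> range (emb C)"
  proof
    assume "inverse y \<in> range (emb C)"
    then obtain c where "inverse y = emb C c" by blast
    then have "y = emb C (inverse c)" using emb_inverse[of c] inverse_inverse_eq[of y] by simp
    then show False using y by blast
  qed
  then have tr: "transcendental (inverse y)" by (rule transcendental_of_nonconst)
  define A0 where "A0 = {pev p (inverse y) |p. True}"
  have "A0 \<in> F" unfolding F_def const_subring_def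
  proof (intro CollectI conjI ballI)
    show "range (emb C) \<subseteq> A0"
    proof
      fix z assume "z \<in> range (emb C)"
      then obtain c where "z = emb C c" by blast
      then have "z = pev [:c:] (inverse y)" by simp
      then show "z \<in> A0" unfolding A0_def by blast
    qed
    fix a b assume "a \<in> A0" "b \<in> A0"
    then obtain p q where "a = pev p (inverse y)" "b = pev q (inverse y)" by (auto simp: A0_def)
    then have "a + b = pev (p + q) (inverse y)" "a * b = pev (p * q) (inverse y)"
      by (simp_all add: pev_add pev_mult)
    then show "a + b \<in> A0" "a * b \<in> A0" unfolding A0_def by blast+
  next
    have "inverse y = pev [:0, 1:] (inverse y)" by simp
    then show "inverse y \<in> A0" unfolding A0_def by blast
    show "y \<notin> A0"
    proof
      assume "y \<in> A0"
      then obtain p where p: "y = pev p (inverse y)" by (auto simp: A0_def)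
      have "pev (pCons (- 1) p) (inverse y) = - 1 + inverse y * y"
        by (simp add: emb_minus p[symmetric])
      then have "pev (pCons (- 1) p) (inverse y) = 0" using y0 by simp
      moreover have "pCons (- 1) p \<noteq> 0" by simp
      ultimately show False using tr unfolding transcendental_def by blast
    qed
  qed
  then have ne: "F \<noteq> {}" by blast
  have "\<exists>A\<in>F. \<forall>B\<in>F. A \<subseteq> B \<longrightarrow> B = A"
  proof (rule subset_Zorn_nonempty[OF ne])
    fix \<C> assume ch: "\<C> \<noteq> {}" "subset.chain F \<C>"
    then have sub: "\<And>A. A \<in> \<C> \<Longrightarrow> A \<in> F" and lin: "\<And>A B. A \<in> \<C> \<Longrightarrow> B \<in> \<C> \<Longrightarrow> A \<subseteq> B \<or> B \<subseteq> A"
      by (auto simp: subset.chain_def)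
    obtain A where A: "A \<in> \<C>" using ch(1) by blast
    show "\<Union>\<C> \<in> F" unfolding F_def const_subring_def
    proof (intro CollectI conjI ballI)
      show "range (emb C) \<subseteq> \<Union>\<C>" "inverse y \<in> \<Union>\<C>"
        using A sub[OF A] by (auto simp: F_def const_subring_def)
      show "y \<notin> \<Union>\<C>" using sub by (auto simp: F_def)
      fix a b assume "a \<in> \<Union>\<C>" "b \<in> \<Union>\<C>"
      then obtain A B where AB: "A \<in> \<C>" "B \<in> \<C>" "a \<in> A" "b \<in> B" by blast
      then obtain D where D: "D \<in> \<C>" "a \<in> D" "b \<in> D" using lin[of A B] by blast
      then have "a + b \<in> D" "a * b \<in> D" using sub[OF D(1)] by (auto simp: F_def const_subring_def)
      then show "a + b \<in> \<Union>\<C>" "a * b \<in> \<Union>\<C>" using D(1) by blast+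
    qed
  qed
  then obtain A where A: "A \<in> F" "\<And>B. B \<in> F \<Longrightarrow> A \<subseteq> B \<Longrightarrow> B = A" by blast
  have "B = A" if "const_subring B" "A \<subseteq> B" "y \<notin> B" for B
    using A that by (intro A(2)) (auto simp: F_def)
  then show ?thesis using A(1) by (auto simp: F_def)
qed

text \<open>
  If neither \<open>z\<close> nor \<open>1 / z\<close> belongs to \<open>A\<close>, then by maximality
  \<open>y\<close> is a polynomial over \<open>A\<close> both in \<open>z\<close> and in
  \<open>1 / z\<close>.  Such expressions can be shortened in turn until one of them is constant, which
  contradicts \<open>y \<notin> A\<close>.
\<close>

lemma maximal_subring_is_valuation_ring:
  assumes A: "const_subring A" and y: "y \<noteq> 0" "inverse y \<in> A" "y \<notin> A"
    and max: "\<And>B. const_subring B \<Longrightarrow> A \<subseteq> B \<Longrightarrow> y \<notin> B \<Longrightarrow> B = A"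
    and z: "z \<noteq> 0"
  shows "z \<in> A \<or> inverse z \<in> A"
proof -
  have add: "a + b \<in> A" and mult: "a * b \<in> A" if "a \<in> A" "b \<in> A" for a b
    using A that by (auto simp: const_subring_def)
  have const: "emb C c \<in> A" for c using A by (auto simp: const_subring_def)
  have A01: "0 \<in> A" "1 \<in> A" using const[of 0] const[of 1] by simp_all
  have minus: "- a \<in> A" if "a \<in> A" for a
    using mult[OF const[of "- 1"] that] by (simp add: emb_minus)
  have diff: "a - b \<in> A" if "a \<in> A" "b \<in> A" for a b
    using add[OF that(1) minus[OF that(2)]] by simp
  have power: "a ^ n \<in> A" if "a \<in> A" for a n
    using that by (induction n) (auto intro: mult A01)
  have sum: "(\<Sum>i\<in>I. f i) \<in> A" if "\<And>i. i \<in> I \<Longrightarrow> f i \<in> A" for f :: "nat \<Rightarrow> 'a" and I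
    using that by (induction I rule: infinite_finite_induct) (auto intro: add A01)
  define u where "u = inverse y"
  have u: "u \<in> A" "u * y = 1" using y by (auto simp: u_def)
  \<comment> \<open>Inverting \<open>1 - u * a\<close> does not produce \<open>y\<close>, so by maximality it is a unit.\<close>
  have unit: "inverse (1 - u * a) \<in> A \<and> 1 - u * a \<noteq> 0" if a: "a \<in> A" for a
  proof -
    define e where "e = 1 - u * a"
    have eA: "e \<in> A" unfolding e_def using a u by (intro diff mult A01)
    have e0: "e \<noteq> 0"
    proof
      assume "e = 0"
      then have "y * (u * a) = y" by (simp add: e_def)
      then have "a = y" using u(2) by (metis mult.assoc mult.commute mult.left_neutral)
      then show False using a y by simp
    qed
    have ek: "\<exists>c\<in>A. e ^ k = 1 - u * c" for k
    proof (induction k)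
      case 0
      show ?case using A01 by (intro bexI[of _ 0]) auto
    next
      case (Suc k)
      then obtain c where c: "c \<in> A" "e ^ k = 1 - u * c" by blast
      have "e ^ Suc k = 1 - u * (a + c - u * a * c)" by (simp add: c(2)) (simp add: e_def algebra_simps)
      moreover have "a + c - u * a * c \<in> A" using a c u by (intro add diff mult)
      ultimately show ?case by blast
    qed
    define B where "B = {b / e ^ k |b k. b \<in> A}"
    have AB: "A \<subseteq> B"
    proof
      fix b assume "b \<in> A"
      moreover have "b = b / e ^ 0" by simp
      ultimately show "b \<in> B" unfolding B_def by blast
    qed
    have "const_subring B" unfolding const_subring_def
    proof (intro conjI ballI)
      show "range (emb C) \<subseteq> B" using const AB by blast
      fix v w assume "v \<in> B" "w \<in> B"
      then obtain b k c l where bc: "v = b / e ^ k" "b \<in> A" "w = c / e ^ l" "c \<in> A"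
        unfolding B_def by blast
      have "v + w = (b * e ^ l + c * e ^ k) / e ^ (k + l)"
        using e0 by (simp add: bc power_add add_frac_eq)
      moreover have "b * e ^ l + c * e ^ k \<in> A" using bc eA by (intro add mult power)
      ultimately show "v + w \<in> B" unfolding B_def by blast
      have "v * w = (b * c) / e ^ (k + l)" by (simp add: bc power_add)
      moreover have "b * c \<in> A" using bc by (intro mult)
      ultimately show "v * w \<in> B" unfolding B_def by blast
    qed
    moreover have "y \<notin> B"
    proof
      assume "y \<in> B"
      then obtain b k where b: "y = b / e ^ k" "b \<in> A" unfolding B_def by blast
      obtain c where c: "c \<in> A" "e ^ k = 1 - u * c" using ek by blast
      have "y * e ^ k = b" using b e0 by simp
      then have "y - (u * y) * c = b" using c by (simp add: algebra_simps)
      then have "y = b + c" using u by (simp add: algebra_simps)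
      then show False using b c y add by simp
    qed
    ultimately have "B = A" using max AB by blast
    moreover have "inverse e \<in> B" unfolding B_def using A01
      by (intro CollectI exI[of _ 1] exI[of _ "1::nat"]) (simp add: divide_inverse)
    ultimately show ?thesis using e0 by (simp add: e_def)
  qed
  define E where "E w n \<longleftrightarrow> (\<exists>p. (\<forall>i. coeff p i \<in> A) \<and> degree p \<le> n \<and> poly p w = y)" for w n
  have E0: "\<not> E w 0" for w
  proof
    assume "E w 0"
    then obtain p where p: "\<And>i. coeff p i \<in> A" "degree p = 0" "poly p w = y" by (auto simp: E_def)
    then have "coeff p 0 = y" by (metis degree_0_id poly_const_conv)
    then show False using p(1) y by metis
  qed
  \<comment> \<open>The shorter of two relations for \<open>w\<close> and \<open>inverse w\<close> lowers the degree of the longer one.\<close>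
  have reduce: "E w n" if w: "w \<noteq> 0" and 1: "E w (Suc n)" and 2: "E (inverse w) (Suc m)" and mn: "m \<le> n" for w n m
  proof -
    obtain p where p: "\<And>i. coeff p i \<in> A" "degree p \<le> Suc n" "poly p w = y" using 1 by (auto simp: E_def)
    obtain q where q: "\<And>i. coeff q i \<in> A" "degree q \<le> Suc m" "poly q (inverse w) = y" using 2 by (auto simp: E_def)
    obtain b q' where bq: "q = pCons b q'" by (cases q) blast
    have b: "b \<in> A" using q(1)[of 0] by (simp add: bq)
    have q'A: "coeff q' i \<in> A" for i using q(1)[of "Suc i"] by (simp add: bq)
    have dq': "degree q' \<le> n" using q(2) mn by (auto simp: bq split: if_splits)
    define r where "r = (\<Sum>i\<le>n. monom (coeff q' i) (n - i))"
    have rA: "coeff r i \<in> A" for i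
      unfolding r_def coeff_sum using q'A A01 by (intro sum) auto
    have dr: "degree r \<le> n" unfolding r_def
      by (intro degree_sum_le) (auto intro: order_trans[OF degree_monom_le])
    have "poly q' (inverse w) = (\<Sum>i\<le>n. coeff q' i * inverse w ^ i)"
      unfolding poly_altdef using dq' by (intro sum.mono_neutral_left) (auto simp: coeff_eq_0)
    then have "w ^ n * poly q' (inverse w) = (\<Sum>i\<le>n. coeff q' i * (w ^ n * inverse w ^ i))"
      by (simp add: sum_distrib_left mult_ac)
    also have "\<dots> = poly r w" unfolding r_def poly_sum poly_monom
      using w by (intro sum.cong refl arg_cong2[of _ _ _ _ "(*)"]) (simp add: power_diff power_inverse divide_inverse)
    finally have rw: "w ^ n * poly q' (inverse w) = poly r w" .
    define v where "v = inverse (1 - u * b)"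
    have v: "v \<in> A" "v * (1 - u * b) = 1" using unit[OF b] by (auto simp: v_def)
    have "u * y = u * b + u * inverse w * poly q' (inverse w)"
      using arg_cong[OF q(3), of "(*) u"] by (simp add: bq algebra_simps)
    then have "1 - u * b = u * inverse w * poly q' (inverse w)" using u by (simp add: algebra_simps)
    then have "1 = v * (u * inverse w * poly q' (inverse w))" using v(2) by simp
    then have "w ^ Suc n = w ^ Suc n * (v * (u * inverse w * poly q' (inverse w)))" by simp
    also have "\<dots> = v * u * (w ^ n * poly q' (inverse w))" using w by simp
    finally have wn: "w ^ Suc n = v * u * poly r w" by (simp add: rw)
    define a where "a = coeff p (Suc n)"
    define p' where "p' = p - monom a (Suc n) + smult (a * v * u) r"
    have "coeff p' i \<in> A" for i unfolding p'_def using p(1) rA v u A01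
      by (auto simp: a_def intro!: add diff mult)
    moreover have "degree p' \<le> n" unfolding p'_def
    proof (intro degree_add_le)
      show "degree (p - monom a (Suc n)) \<le> n"
      proof (rule degree_le, intro allI impI)
        fix i assume "n < i"
        then consider "i = Suc n" | "Suc n < i" by linarith
        then show "coeff (p - monom a (Suc n)) i = 0"
          using p(2) by cases (auto simp: a_def coeff_eq_0)
      qed
      show "degree (smult (a * v * u) r) \<le> n" using dr by (rule order_trans[OF degree_smult_le])
    qed
    moreover have "poly p' w = y" using p(3) wn
      by (simp add: p'_def poly_monom mult_ac)
    ultimately show ?thesis unfolding E_def by blast
  qed
  have no: "\<not> (E z n \<and> E (inverse z) m)" for n m
  proof (induction "n + m" arbitrary: n m rule: less_induct)
    case less
    show ?case
    proof
      assume En: "E z n \<and> E (inverse z) m"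
      obtain n' where n': "n = Suc n'" using En E0 by (cases n) auto
      obtain m' where m': "m = Suc m'" using En E0 by (cases m) auto
      show False
      proof (cases "m' \<le> n'")
        case True
        then have "E z n'" using reduce[of z n' m'] z En n' m' by simp
        then show False using less[of n' m] En n' by simp
      next
        case False
        then have "E (inverse z) m'" using reduce[of "inverse z" m' n'] z En n' m' by simp
        then show False using less[of n m'] En m' by simp
      qed
    qed
  qed
  have adj: "w \<in> A" if w: "\<And>n. \<not> E w n" for w
  proof -
    define B where "B = {poly p w |p. \<forall>i. coeff p i \<in> A}"
    have AB: "A \<subseteq> B"
    proof
      fix b assume b: "b \<in> A"
      have "b = poly [:b:] w" "\<forall>i. coeff [:b:] i \<in> A" using b A01 by (auto simp: coeff_pCons split: nat.splits)
      then show "b \<in> B" unfolding B_def by blast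
    qed
    have "const_subring B" unfolding const_subring_def
    proof (intro conjI ballI)
      show "range (emb C) \<subseteq> B" using const AB by blast
      fix v v' assume "v \<in> B" "v' \<in> B"
      then obtain p q where pq: "v = poly p w" "v' = poly q w" "\<forall>i. coeff p i \<in> A" "\<forall>i. coeff q i \<in> A"
        unfolding B_def by blast
      have "v + v' = poly (p + q) w" "\<forall>i. coeff (p + q) i \<in> A" using pq add by auto
      then show "v + v' \<in> B" unfolding B_def by blast
      have "v * v' = poly (p * q) w" "\<forall>i. coeff (p * q) i \<in> A"
        using pq by (auto simp: coeff_mult intro!: sum mult)
      then show "v * v' \<in> B" unfolding B_def by blast
    qed
    moreover have "y \<notin> B" using w unfolding B_def E_def by auto
    ultimately have "B = A" using max AB by blast
    moreover have "w \<in> B" unfolding B_def using A01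
      by (intro CollectI exI[of _ "[:0, 1:]"]) (auto simp: coeff_pCons split: nat.splits)
    ultimately show ?thesis by simp
  qed
  show ?thesis using no adj by blast
qed

theorem exists_pole:
  assumes y: "y \<notin> range (emb C)" shows "\<exists>P\<in>points C. P y < 0"
proof -
  obtain A where A: "const_subring A" "inverse y \<in> A" "y \<notin> A"
    "\<And>B. const_subring B \<Longrightarrow> A \<subseteq> B \<Longrightarrow> y \<notin> B \<Longrightarrow> B = A"
    using maximal_subring_without[OF y] by blast
  have y0: "y \<noteq> 0" using y rangeI[of "emb C" 0] by auto
  interpret valuation_ring C A "inverse y"
  proof unfold_locales
    show "a \<noteq> 0 \<Longrightarrow> a \<in> A \<or> inverse a \<in> A" for a
      using maximal_subring_is_valuation_ring[OF A(1) y0 A(2,3)] A(4) by blast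
    show "emb C c \<in> A" for c using A(1) unfolding const_subring_def by blast
    show "a \<in> A \<Longrightarrow> b \<in> A \<Longrightarrow> a + b \<in> A" "a \<in> A \<Longrightarrow> b \<in> A \<Longrightarrow> a * b \<in> A" for a b
      using A(1) unfolding const_subring_def by blast+
    show "inverse y \<in> A" by fact
    show "inverse y \<noteq> 0" "inverse (inverse y) \<notin> A" using y0 A(3) by simp_all
  qed
  obtain P where "P \<in> points C" "0 < P (inverse y)" using point_of_valuation_ring by blast
  then show ?thesis by (intro bexI[of _ P]) (simp_all add: pt_inverse)
qed

section \<open>Divisors and Riemann's theorem\<close>

lemma constants_of_no_poles:
  assumes "\<And>P. P \<in> points C \<Longrightarrow> 0 \<le> P f" shows "f \<in> range (emb C)"
  using exists_pole[of f] assms by force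

definition pdiv :: "('a \<Rightarrow> int) \<Rightarrow> int \<Rightarrow> 'a divisor" where
  "pdiv P n = (\<lambda>Q. if Q = P then n else 0)"

lemma is_divisor_0 [simp]: "is_divisor C 0"
  by (simp add: is_divisor_def)

lemma is_divisorI: "finite S \<Longrightarrow> {P. D P \<noteq> 0} \<subseteq> S \<Longrightarrow> {P. D P \<noteq> 0} \<subseteq> points C \<Longrightarrow> is_divisor C D"
  unfolding is_divisor_def using finite_subset by blast

lemma is_divisor_add: "is_divisor C D \<Longrightarrow> is_divisor C E \<Longrightarrow> is_divisor C (D + E)"
  by (rule is_divisorI[of "{P. D P \<noteq> 0} \<union> {P. E P \<noteq> 0}"]) (force simp: is_divisor_def)+

lemma is_divisor_uminus [simp]: "is_divisor C (- D) \<longleftrightarrow> is_divisor C D"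
  unfolding is_divisor_def by simp

lemma is_divisor_diff: "is_divisor C D \<Longrightarrow> is_divisor C E \<Longrightarrow> is_divisor C (D - E)"
  using is_divisor_add[of D "- E"] by simp

lemma is_divisor_pdiv: "P \<in> points C \<Longrightarrow> is_divisor C (pdiv P n)"
  by (rule is_divisorI[of "{P}"]) (auto simp: pdiv_def split: if_splits)

lemma is_divisor_max: "is_divisor C D \<Longrightarrow> is_divisor C (\<lambda>P. max (D P) 0)"
  by (rule is_divisorI[of "{P. D P \<noteq> 0}"]) (auto simp: is_divisor_def max_def split: if_splits)

lemma is_divisor_scale: "is_divisor C D \<Longrightarrow> is_divisor C (\<lambda>P. n * D P)"
  by (rule is_divisorI[of "{P. D P \<noteq> 0}"]) (auto simp: is_divisor_def)

lemma divisor_outside: "is_divisor C D \<Longrightarrow> P \<notin> points C \<Longrightarrow> D P = 0"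
  unfolding is_divisor_def by blast

lemma div_deg_superset:
  assumes "finite S" "{P. D P \<noteq> 0} \<subseteq> S"
  shows "div_deg C D = (\<Sum>P\<in>S. D P * int (point_deg C P))"
  unfolding div_deg_def using assms by (intro sum.mono_neutral_left) auto

lemma div_deg_0 [simp]: "div_deg C 0 = 0"
  by (simp add: div_deg_def)

lemma div_deg_add:
  assumes "is_divisor C D" "is_divisor C E"
  shows "div_deg C (D + E) = div_deg C D + div_deg C E"
proof -
  let ?S = "{P. D P \<noteq> 0} \<union> {P. E P \<noteq> 0}"
  have f: "finite ?S" using assms by (simp add: is_divisor_def)
  have "div_deg C (D + E) = (\<Sum>P\<in>?S. (D + E) P * int (point_deg C P))"
    by (rule div_deg_superset[OF f]) auto
  moreover have "div_deg C D = (\<Sum>P\<in>?S. D P * int (point_deg C P))"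
    by (rule div_deg_superset[OF f]) auto
  moreover have "div_deg C E = (\<Sum>P\<in>?S. E P * int (point_deg C P))"
    by (rule div_deg_superset[OF f]) auto
  ultimately show ?thesis by (simp add: sum.distrib distrib_right)
qed

lemma div_deg_uminus: "div_deg C (- D) = - div_deg C D"
  by (simp add: div_deg_def sum_negf)

lemma div_deg_diff:
  assumes "is_divisor C D" "is_divisor C E"
  shows "div_deg C (D - E) = div_deg C D - div_deg C E"
  using div_deg_add[of D "- E"] assms by (simp add: div_deg_uminus)

lemma div_deg_pdiv: "div_deg C (pdiv P n) = n * int (point_deg C P)"
  by (subst div_deg_superset[of "{P}"]) (auto simp: pdiv_def split: if_splits)

lemma div_deg_scale: "is_divisor C D \<Longrightarrow> div_deg C (\<lambda>P. n * D P) = n * div_deg C D"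
  by (subst div_deg_superset[of "{P. D P \<noteq> 0}"])
    (auto simp: is_divisor_def div_deg_def sum_distrib_left mult.assoc)

lemma div_deg_nonneg: "0 \<le> D \<Longrightarrow> 0 \<le> div_deg C D"
  unfolding div_deg_def by (intro sum_nonneg) (auto simp: le_fun_def)

lemma div_deg_mono:
  assumes "is_divisor C D" "is_divisor C E" "D \<le> E" shows "div_deg C D \<le> div_deg C E"
  using div_deg_nonneg[of "E - D"] assms by (simp add: div_deg_diff le_fun_def)

lemma effective_deg_0:
  assumes D: "is_divisor C D" "0 \<le> D" and deg: "div_deg C D \<le> 0" shows "D = 0"
proof (rule ccontr)
  assume "D \<noteq> 0"
  then obtain P where P: "D P \<noteq> 0" by (auto simp: fun_eq_iff)
  then have PC: "P \<in> points C" using D(1) divisor_outside by blast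
  have "pdiv P 1 \<le> D" using D(2) P by (auto simp: le_fun_def pdiv_def) (metis int_one_le_iff_zero_less order_le_less)
  then have "int (point_deg C P) \<le> div_deg C D"
    using div_deg_mono[OF is_divisor_pdiv[OF PC] D(1), of 1] by (simp add: div_deg_pdiv)
  then show False using point_deg_ge_1[OF PC] deg by simp
qed

abbreviation LL :: "'a divisor \<Rightarrow> 'a set" where "LL \<equiv> LS (points C)"

definition ell :: "'a divisor \<Rightarrow> nat" where "ell D = vs.dim (LL D)"

lemma RR_space_eq: assumes "is_divisor C D" shows "RR_space C D = LL D"
proof -
  have "0 \<le> principal_div C f + D \<longleftrightarrow> (\<forall>P\<in>points C. - D P \<le> P f)" for f
  proof
    assume "0 \<le> principal_div C f + D"
    then have le: "0 \<le> principal_div C f P + D P" for P by (simp add: le_fun_def)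
    show "\<forall>P\<in>points C. - D P \<le> P f"
    proof
      fix P assume "P \<in> points C"
      then show "- D P \<le> P f" using le[of P] by (simp add: principal_div_def)
    qed
  next
    assume le: "\<forall>P\<in>points C. - D P \<le> P f"
    have "0 \<le> principal_div C f P + D P" for P
      using le divisor_outside[OF assms, of P] by (cases "P \<in> points C") (force simp: principal_div_def)+
    then show "0 \<le> principal_div C f + D" by (simp add: le_fun_def)
  qed
  then show ?thesis by (auto simp: RR_space_def LS_def vge_def)
qed

lemma subspace_LL: "vs.subspace (LL D)"
  by (rule subspace_LS) simp

lemma LL_0: "LL 0 = range (emb C)"
proof
  show "LL 0 \<subseteq> range (emb C)"
  proof
    fix f assume f: "f \<in> LL 0"
    show "f \<in> range (emb C)"
      by (rule constants_of_no_poles) (use f in \<open>auto simp: LS_def vge_def pt_0\<close>)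
  qed
  show "range (emb C) \<subseteq> LL 0" by (auto simp: LS_def vge_def pt_emb)
qed

lemma dim_LL_0: "vs.fin_dim (LL 0)" "ell 0 = 1"
proof -
  have e: "LL 0 = vs.span {1}" unfolding LL_0 by (auto simp: vs.span_singleton scl_def)
  show "vs.fin_dim (LL 0)" unfolding e vs.fin_dim_def by (intro exI[of _ "{1}"]) simp
  show "ell 0 = 1" unfolding ell_def e
    using vs.dim_span_eq_card_independent[of "{1}"] by simp
qed

lemma LL_add_point:
  assumes P: "P \<in> points C" and f: "vs.fin_dim (LL D)"
  shows "vs.fin_dim (LL (D + pdiv P 1))" "ell (D + pdiv P 1) \<le> ell D + point_deg C P"
proof -
  have "card Y \<le> point_deg C P" if "Y \<subseteq> LL (D + pdiv P 1)" "vs.indep_mod (LL D) Y" for Y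
    using that by (intro LS_add_point_le[of "points C" P "D + pdiv P 1" D]) (auto simp: P pdiv_def)
  from vs.rel_basis_of_bound[OF subspace_LL this]
  obtain Y where Y: "vs.indep_mod (LL D) Y" "LL (D + pdiv P 1) \<subseteq> LL D + vs.span Y"
    "card Y \<le> point_deg C P" by blast
  have "finite Y" using Y(1) by (simp add: vs.indep_mod_def)
  note d = vs.dim_le_add_card[OF f this Y(2)]
  show "vs.fin_dim (LL (D + pdiv P 1))" by (rule d)
  show "ell (D + pdiv P 1) \<le> ell D + point_deg C P" using d(2) Y(3) by (simp add: ell_def)
qed

lemma LL_growth:
  assumes D: "is_divisor C D" "is_divisor C E" "D \<le> E" and f: "vs.fin_dim (LL D)"
  shows "vs.fin_dim (LL E) \<and> int (ell E) \<le> int (ell D) + div_deg C E - div_deg C D"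
proof -
  define S where "S = {P. D P \<noteq> 0} \<union> {P. E P \<noteq> 0}"
  have S: "finite S" "S \<subseteq> points C" using D by (auto simp: S_def is_divisor_def)
  have "vs.fin_dim (LL E) \<and> int (ell E) \<le> int (ell D) + div_deg C E - div_deg C D"
    if "is_divisor C D" "{P. D P \<noteq> 0} \<subseteq> S" "D \<le> E" "vs.fin_dim (LL D)" for D
    using that
  proof (induction "\<Sum>P\<in>S. nat (E P - D P)" arbitrary: D)
    case 0
    have "E P \<le> D P" for P
    proof (cases "P \<in> S")
      case True
      then show ?thesis using 0(1) S(1) by (simp add: sum_nonneg_eq_0_iff)
    next
      case False
      then have "D P = 0" "E P = 0" using 0(3) by (auto simp: S_def)
      then show ?thesis by simp
    qed
    then have "D = E" using 0(4) by (auto simp: fun_eq_iff le_fun_def intro: antisym)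
    then show ?case using 0 by simp
  next
    case (Suc n)
    have "\<not> (\<forall>P\<in>S. nat (E P - D P) = 0)"
    proof
      assume "\<forall>P\<in>S. nat (E P - D P) = 0"
      then have "(\<Sum>P\<in>S. nat (E P - D P)) = 0" by (rule sum.neutral)
      then show False using Suc(2) by linarith
    qed
    then obtain P where P: "P \<in> S" "D P < E P" by auto
    have PC: "P \<in> points C" using P S by auto
    define D' where "D' = D + pdiv P 1"
    have E1: "nat (E P - D P) = Suc (nat (E P - D' P))"
      using P by (simp add: D'_def pdiv_def nat_diff_distrib')
    have "(\<Sum>Q\<in>S - {P}. nat (E Q - D Q)) = (\<Sum>Q\<in>S - {P}. nat (E Q - D' Q))"
      by (rule sum.cong) (auto simp: D'_def pdiv_def)
    then have n: "n = (\<Sum>P\<in>S. nat (E P - D' P))"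
      using Suc(2) E1 by (simp add: sum.remove[OF S(1) P(1)])
    have d': "is_divisor C D'" unfolding D'_def using Suc.prems(1) is_divisor_pdiv[OF PC] by (rule is_divisor_add)
    have le: "D' \<le> E" using Suc.prems(3) P by (auto simp: D'_def pdiv_def le_fun_def)
    have s: "{P. D' P \<noteq> 0} \<subseteq> S" using Suc.prems(2) P(1) by (auto simp: D'_def pdiv_def split: if_splits)
    note a = LL_add_point[OF PC Suc.prems(4), folded D'_def]
    have "div_deg C D' = div_deg C D + int (point_deg C P)"
      unfolding D'_def using Suc.prems(1) is_divisor_pdiv[OF PC] by (simp add: div_deg_add div_deg_pdiv)
    then show ?case using Suc.hyps(1)[OF n d' s le a(1)] a(2) by linarith
  qed
  then show ?thesis using D f by (auto simp: S_def)
qed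

lemma LL_mono: "D \<le> E \<Longrightarrow> LL D \<subseteq> LL E"
  by (rule LS_mono) (simp add: le_fun_def)

lemma fin_dim_LL: assumes "is_divisor C D" shows "vs.fin_dim (LL D)"
proof -
  have "vs.fin_dim (LL (\<lambda>P. max (D P) 0))"
    using LL_growth[OF is_divisor_0 is_divisor_max[OF assms] _ dim_LL_0(1)] by (simp add: le_fun_def)
  then show ?thesis by (rule vs.fin_dim_mono) (intro LL_mono, simp add: le_fun_def)
qed

lemma ell_mono: "is_divisor C E \<Longrightarrow> D \<le> E \<Longrightarrow> ell D \<le> ell E"
  unfolding ell_def using vs.dim_le_dim[OF LL_mono fin_dim_LL] by blast

lemma ell_growth:
  "is_divisor C D \<Longrightarrow> is_divisor C E \<Longrightarrow> D \<le> E \<Longrightarrow> int (ell E) - div_deg C E \<le> int (ell D) - div_deg C D"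
  using LL_growth[of D E] fin_dim_LL[of D] by linarith

lemma ell_effective_le: "is_divisor C D \<Longrightarrow> 0 \<le> D \<Longrightarrow> int (ell D) \<le> div_deg C D + 1"
  using ell_growth[of 0 D] dim_LL_0(2) by simp

section \<open>Principal divisors have degree zero\<close>

definition zero_div :: "'a \<Rightarrow> 'a divisor" where
  "zero_div f = (\<lambda>P. max (principal_div C f P) 0)"

lemma is_divisor_principal' [simp]: "is_divisor C (principal_div C f)"
proof (cases "f = 0")
  case True
  then have e: "principal_div C f = 0" by (auto simp: principal_div_def fun_eq_iff pt_0)
  show ?thesis unfolding e by (rule is_divisor_0)
qed (rule is_divisor_principal)

lemma zero_div: "is_divisor C (zero_div f)" "0 \<le> zero_div f"
  unfolding zero_div_def using is_divisor_max[OF is_divisor_principal'] by (auto simp: le_fun_def)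

lemma principal_div_eq: "principal_div C f = zero_div f - zero_div (inverse f)"
  by (auto simp: fun_eq_iff zero_div_def principal_div_def pt_inverse)

lemma zero_div_le_rank: assumes f: "f \<noteq> 0" shows "div_deg C (zero_div f) \<le> int (kx_rank f)"
proof -
  define S where "S = {P \<in> points C. 0 < P f}"
  have S: "finite S" unfolding S_def by (rule finite_zeros[OF f])
  have "div_deg C (zero_div f) = (\<Sum>P\<in>S. zero_div f P * int (point_deg C P))"
    by (rule div_deg_superset[OF S]) (auto simp: S_def zero_div_def principal_div_def split: if_splits)
  also have "\<dots> = int (\<Sum>P\<in>S. nat (P f) * point_deg C P)"
    unfolding of_nat_sum by (rule sum.cong) (auto simp: S_def zero_div_def principal_div_def)
  also have "\<dots> \<le> int (kx_rank f)"
    unfolding of_nat_le_iff by (rule zeros_bound[OF S _ f]) (auto simp: S_def)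
  finally show ?thesis .
qed

lemma finite_in_LL:
  assumes "finite U" shows "\<exists>D. is_divisor C D \<and> 0 \<le> D \<and> U \<subseteq> LL D"
  using assms
proof (induction U rule: finite_induct)
  case empty
  show ?case by (rule exI[of _ 0]) (intro conjI is_divisor_0 order_refl empty_subsetI)
next
  case (insert u U)
  then obtain D where D: "is_divisor C D" "0 \<le> D" "U \<subseteq> LL D" by blast
  show ?case
  proof (cases "u = 0")
    case True
    then have "insert u U \<subseteq> LL D" using D(3) vs.subspace_0[OF subspace_LL] by blast
    then show ?thesis using D by blast
  next
    case False
    note z = zero_div[of "inverse u"]
    have "LL D \<subseteq> LL (D + zero_div (inverse u))" using z(2) by (intro LL_mono) (simp add: le_fun_def)
    moreover have "u \<in> LL (D + zero_div (inverse u))"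
      unfolding LS_def
    proof (intro CollectI ballI)
      fix P assume P: "P \<in> points C"
      have "0 \<le> D P" using D(2) by (simp add: le_fun_def)
      then show "vge P (- (D + zero_div (inverse u)) P) u"
        using P by (auto simp: vge_def zero_div_def principal_div_def pt_inverse max_def)
    qed
    ultimately have "insert u U \<subseteq> LL (D + zero_div (inverse u))" using D(3) by blast
    moreover have "0 \<le> D + zero_div (inverse u)" using D(2) z(2) by (rule add_nonneg_nonneg)
    ultimately show ?thesis using is_divisor_add[OF D(1) z(1)] by blast
  qed
qed

text \<open>
  With \<open>U\<close> independent over \<open>K(y)\<close> and \<open>E\<close> a bound for the poles
  of its elements, the products \<open>y\<^sup>i u\<close>, \<open>i \<le> r\<close>, are independent and
  lie in \<open>L(rB + E)\<close>, where \<open>B\<close> is the divisor of poles of \<open>y\<close>.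
\<close>

lemma pole_multiples_bound:
  assumes y: "y \<noteq> 0"
  shows "\<exists>E. is_divisor C E \<and> 0 \<le> E \<and>
    (\<forall>r::nat. (r + 1) * kx_rank y \<le> ell ((\<lambda>P. int r * zero_div (inverse y) P) + E))"
proof -
  obtain U where U: "kx_indep y U" "card U = kx_rank y" using kx_rank_attained by blast
  then have "finite U" by (simp add: kx_indep_def)
  then obtain E where E: "is_divisor C E" "0 \<le> E" "U \<subseteq> LL E" using finite_in_LL by blast
  have "(r + 1) * kx_rank y \<le> ell ((\<lambda>P. int r * zero_div (inverse y) P) + E)" for r
  proof -
    let ?D = "(\<lambda>P. int r * zero_div (inverse y) P) + E"
    have d: "is_divisor C ?D" using y E(1) by (intro is_divisor_add is_divisor_scale zero_div(1)) auto
    note e = kx_indep_powers[OF U(1) one_neq_zero, of r]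
    have "(\<lambda>(i, u). 1 * y ^ i * u) ` ({..r} \<times> U) \<subseteq> LL ?D"
    proof
      fix z assume "z \<in> (\<lambda>(i, u). 1 * y ^ i * u) ` ({..r} \<times> U)"
      then obtain i u where iu: "i \<in> {..r}" "u \<in> U" and z: "z = y ^ i * u" by auto
      have "vge P (- ?D P) (y ^ i * u)" if P: "P \<in> points C" for P
      proof -
        have m: "0 \<le> max (- P y) 0" by simp
        have "int i * - P y \<le> int i * max (- P y) 0" by (intro mult_left_mono) auto
        also have "\<dots> \<le> int r * max (- P y) 0" using iu by (intro mult_right_mono) auto
        finally have "vge P (- (int r * zero_div (inverse y) P)) (y ^ i)"
          using P y by (simp add: vge_def zero_div_def principal_div_def pt_power pt_inverse)
        moreover have "vge P (- E P) u" using E(3) iu P by (auto simp: LS_def)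
        ultimately show ?thesis using vge_mult[OF P] by fastforce
      qed
      then show "z \<in> LL ?D" by (simp add: LS_def z)
    qed
    from vs.independent_card_le[OF e(1) this fin_dim_LL[OF d]]
    show ?thesis using e(2) U(2) by (simp add: ell_def)
  qed
  then show ?thesis using E by blast
qed

text \<open>
  Compare the bound \<open>(r + 1) [F : K(y)] \<le> l(rB + E)\<close> with
  \<open>l(rB + E) \<le> r deg B + deg E + 1\<close> for large \<open>r\<close>.
\<close>

lemma rank_le_poles:
  assumes y: "y \<noteq> 0" shows "int (kx_rank y) \<le> div_deg C (zero_div (inverse y))"
proof (rule ccontr)
  let ?B = "zero_div (inverse y)"
  assume "\<not> ?thesis"
  then have less: "div_deg C ?B + 1 \<le> int (kx_rank y)" by simp
  obtain E where E: "is_divisor C E" "0 \<le> E"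
    "\<And>r::nat. (r + 1) * kx_rank y \<le> ell ((\<lambda>P. int r * ?B P) + E)"
    using pole_multiples_bound[OF y] by blast
  have B: "is_divisor C ?B" "0 \<le> ?B" using zero_div[of "inverse y"] y by auto
  define r where "r = nat (div_deg C E + 1)"
  have "int ((r + 1) * kx_rank y) \<le> int (ell ((\<lambda>P. int r * ?B P) + E))" using E(3) unfolding of_nat_le_iff .
  also have "\<dots> \<le> div_deg C ((\<lambda>P. int r * ?B P) + E) + 1"
    using B E by (intro ell_effective_le is_divisor_add is_divisor_scale) (auto simp: le_fun_def)
  also have "\<dots> = int r * div_deg C ?B + div_deg C E + 1"
    using B E by (simp add: div_deg_add is_divisor_scale div_deg_scale)
  finally have "(int r + 1) * int (kx_rank y) \<le> int r * div_deg C ?B + div_deg C E + 1" by (simp add: algebra_simps)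
  moreover have "(int r + 1) * (div_deg C ?B + 1) \<le> (int r + 1) * int (kx_rank y)"
    using less by (intro mult_left_mono) auto
  ultimately have "int r + div_deg C ?B + 1 \<le> div_deg C E + 1" by (simp add: algebra_simps)
  moreover have "int r = div_deg C E + 1" using div_deg_nonneg[OF E(2)] by (simp add: r_def)
  moreover have "0 \<le> div_deg C ?B" using div_deg_nonneg[OF B(2)] .
  ultimately show False by linarith
qed

text \<open>
  The bounds for \<open>y\<close> and \<open>1 / y\<close> form a closed circle of inequalities, since
  the zeros of the one are the poles of the other.
\<close>

lemma deg_poles_eq_rank:
  assumes y: "y \<noteq> 0"
  shows "div_deg C (zero_div (inverse y)) = int (kx_rank y)" "div_deg C (zero_div y) = int (kx_rank y)"
proof -
  have i: "inverse y \<noteq> 0" using y by simp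
  note r = zero_div_le_rank[OF y] zero_div_le_rank[OF i] rank_le_poles[OF y] rank_le_poles[OF i]
  show "div_deg C (zero_div (inverse y)) = int (kx_rank y)" "div_deg C (zero_div y) = int (kx_rank y)"
    using r unfolding inverse_inverse_eq by linarith+
qed

theorem deg_principal: "f \<noteq> 0 \<Longrightarrow> div_deg C (principal_div C f) = 0"
  unfolding principal_div_eq div_deg_diff[OF zero_div(1) zero_div(1)]
  using deg_poles_eq_rank[of f] by simp

lemma LL_shift:
  assumes f: "f \<noteq> 0"
  shows "LL (D - principal_div C f) = (*) f ` LL D"
proof
  have m: "f * h \<in> LL (D - principal_div C f) \<longleftrightarrow> h \<in> LL D" for h
    unfolding LS_def mem_Collect_eq
    by (rule ball_cong) (auto simp: vge_mult'[OF _ f] principal_div_def)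
  show "(*) f ` LL D \<subseteq> LL (D - principal_div C f)" using m by blast
  show "LL (D - principal_div C f) \<subseteq> (*) f ` LL D"
  proof
    fix z assume "z \<in> LL (D - principal_div C f)"
    then have "z / f \<in> LL D" using m[of "z / f"] f by simp
    then show "z \<in> (*) f ` LL D" using f by (intro image_eqI[of _ _ "z / f"]) auto
  qed
qed

lemma dim_times:
  assumes f: "f \<noteq> 0" and V: "vs.fin_dim V"
  shows "vs.fin_dim ((*) f ` V)" "vs.dim ((*) f ` V) = vs.dim V"
proof -
  have le: "vs.fin_dim ((*) f ` V) \<and> vs.dim ((*) f ` V) \<le> vs.dim V" if V: "vs.fin_dim V" for f V
  proof -
    obtain B where B: "V \<subseteq> vs.span B" "card B = vs.dim V" "finite B"
      using vs.fin_dim_basis[OF V] by blast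
    have "(*) f ` V \<subseteq> vs.span ((*) f ` B)"
    proof clarify
      fix v assume "v \<in> V"
      then obtain c where "v = (\<Sum>b\<in>B. scl C (c b) b)" using B vs.span_finite[OF B(3)] by blast
      then have "f * v = (\<Sum>b\<in>B. scl C (c b) (f * b))" by (simp add: sum_distrib_left scl_def mult_ac)
      also have "\<dots> \<in> vs.span ((*) f ` B)" by (intro vs.span_sum vs.span_scale vs.span_base) auto
      finally show "f * v \<in> vs.span ((*) f ` B)" .
    qed
    then show ?thesis using vs.dim_le_card[of "(*) f ` V" "(*) f ` B"] B card_image_le[OF B(3), of "(*) f"]
      unfolding vs.fin_dim_def by (metis finite_imageI order_trans)
  qed
  have "(*) (inverse f) ` (*) f ` V = V" using f by (simp add: image_image mult.assoc[symmetric])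
  then show "vs.fin_dim ((*) f ` V)" "vs.dim ((*) f ` V) = vs.dim V"
    using le[OF V, of f] le[of "(*) f ` V" "inverse f"] by auto
qed

lemma ell_shift: "f \<noteq> 0 \<Longrightarrow> is_divisor C D \<Longrightarrow> ell (D - principal_div C f) = ell D"
  unfolding ell_def LL_shift by (rule dim_times(2)) (auto intro: fin_dim_LL)

lemma LL_nonzero:
  assumes D: "is_divisor C D" and f: "f \<in> LL D" "f \<noteq> 0"
  shows "- principal_div C f \<le> D"
proof (rule le_funI)
  fix P
  show "(- principal_div C f) P \<le> D P"
  proof (cases "P \<in> points C")
    case True
    then have "- D P \<le> P f" using f by (auto simp: LS_def vge_def)
    then show ?thesis using True by (simp add: principal_div_def)
  qed (use divisor_outside[OF D] in \<open>simp add: principal_div_def\<close>)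
qed

lemma deg_nonneg_of_LL:
  assumes "is_divisor C D" "f \<in> LL D" "f \<noteq> 0" shows "0 \<le> div_deg C D"
  using div_deg_mono[OF _ assms(1), of "- principal_div C f"] LL_nonzero[OF assms] assms
  by (simp add: is_divisor_principal div_deg_uminus deg_principal)

lemma LL_neg_deg: "is_divisor C D \<Longrightarrow> div_deg C D < 0 \<Longrightarrow> LL D = {0}"
  using deg_nonneg_of_LL[of D] vs.subspace_0[OF subspace_LL[of D]] by force

lemma ell_neg_deg: "is_divisor C D \<Longrightarrow> div_deg C D < 0 \<Longrightarrow> ell D = 0"
  unfolding ell_def by (simp add: LL_neg_deg) (metis vs.dim_span_eq_card_independent vs.independent_empty vs.span_empty card.empty)

lemma exists_nonzero_of_ell: "0 < ell D \<Longrightarrow> \<exists>f\<in>LL D. f \<noteq> 0"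
proof (rule ccontr)
  assume l: "0 < ell D" and n: "\<not> (\<exists>f\<in>LL D. f \<noteq> 0)"
  then have "LL D \<subseteq> vs.span {}" by auto
  then show False using vs.dim_le_card[of "LL D" "{}"] l by (simp add: ell_def)
qed

text \<open>
  For multiples of the divisor \<open>B\<close> of poles of \<open>y\<close>, the bound follows from
  \<open>pole_multiples_bound\<close> and \<open>deg B = [F : K(y)]\<close>.  An effective divisor
  \<open>A\<close> is equivalent to a divisor below some \<open>rB\<close>, because
  \<open>L(rB - A)\<close> is nonzero for large \<open>r\<close>; and \<open>deg D - l(D)\<close> is
  monotone in \<open>D\<close>.
\<close>

theorem Riemann_bound: "\<exists>\<gamma>. \<forall>D. is_divisor C D \<longrightarrow> div_deg C D - int (ell D) \<le> \<gamma>"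
proof -
  obtain y where y: "y \<noteq> 0" "infty C y = 1" using pt_ex1[OF infty_point] by blast
  let ?B = "zero_div (inverse y)"
  have B: "is_divisor C ?B" "0 \<le> ?B" using zero_div[of "inverse y"] y by auto
  have n: "0 < div_deg C ?B"
  proof -
    have "pdiv (infty C) 1 \<le> zero_div y"
      using y infty_point by (auto simp: le_fun_def pdiv_def zero_div_def principal_div_def)
    then have "1 \<le> div_deg C (zero_div y)"
      using div_deg_mono[OF is_divisor_pdiv[OF infty_point] zero_div(1)[of y], of 1]
      by (simp add: div_deg_pdiv point_deg_infty)
    then show ?thesis using deg_poles_eq_rank[OF y(1)] by simp
  qed
  obtain E where E: "is_divisor C E" "0 \<le> E"
    "\<And>r::nat. (r + 1) * kx_rank y \<le> ell ((\<lambda>P. int r * ?B P) + E)"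
    using pole_multiples_bound[OF y(1)] by blast
  define rB where "rB r = (\<lambda>P. int r * ?B P)" for r
  have rB: "is_divisor C (rB r)" "div_deg C (rB r) = int r * div_deg C ?B" for r
    unfolding rB_def using B by (auto simp: is_divisor_scale div_deg_scale)
  define \<gamma> where "\<gamma> = div_deg C E - div_deg C ?B"
  have \<gamma>: "div_deg C (rB r) - int (ell (rB r)) \<le> \<gamma>" for r
  proof -
    have "int (ell (rB r + E)) - div_deg C (rB r + E) \<le> int (ell (rB r)) - div_deg C (rB r)"
      using rB E by (intro ell_growth is_divisor_add) (auto simp: le_fun_def)
    moreover have "int ((r + 1) * kx_rank y) \<le> int (ell (rB r + E))" using E(3)[of r] unfolding rB_def of_nat_le_iff .
    ultimately show ?thesis using rB E(1) deg_poles_eq_rank[OF y(1)]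
      by (simp add: \<gamma>_def div_deg_add algebra_simps)
  qed
  have "div_deg C D - int (ell D) \<le> \<gamma>" if D: "is_divisor C D" for D
  proof -
    define A where "A = (\<lambda>P. max (D P) 0)"
    have A: "is_divisor C A" "0 \<le> A" "D \<le> A"
      unfolding A_def using is_divisor_max[OF D] by (auto simp: le_fun_def)
    define r where "r = nat (\<gamma> + div_deg C A + 1)"
    have r: "\<gamma> + div_deg C A + 1 \<le> div_deg C (rB r)"
    proof -
      have "\<gamma> + div_deg C A + 1 \<le> int r" by (simp add: r_def)
      also have "\<dots> \<le> int r * div_deg C ?B" using n mult_left_mono[of 1 "div_deg C ?B" "int r"] by simp
      finally show ?thesis by (simp add: rB)
    qed
    have dA: "is_divisor C (rB r - A)" using rB A by (intro is_divisor_diff)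
    have "int (ell (rB r)) - div_deg C (rB r) \<le> int (ell (rB r - A)) - div_deg C (rB r - A)"
      using rB A dA by (intro ell_growth) (auto simp: le_fun_def)
    then have "0 < ell (rB r - A)" using \<gamma>[of r] r rB A by (simp add: div_deg_diff)
    then obtain f where f: "f \<in> LL (rB r - A)" "f \<noteq> 0" using exists_nonzero_of_ell by blast
    define A' where "A' = A - principal_div C f"
    have A': "is_divisor C A'" "div_deg C A' = div_deg C A" "ell A' = ell A"
      unfolding A'_def using A f is_divisor_principal[OF f(2)]
      by (auto simp: is_divisor_diff div_deg_diff deg_principal ell_shift)
    have "A' \<le> rB r" using LL_nonzero[OF dA f] by (auto simp: A'_def le_fun_def algebra_simps)
    then have "div_deg C A' - int (ell A') \<le> \<gamma>" using ell_growth[OF A'(1) rB(1)[of r]] \<gamma>[of r] by simp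
    then show ?thesis using ell_growth[OF D A(1,3)] A' by simp
  qed
  then show ?thesis by blast
qed

section \<open>The genus, and the dimension of \<open>L(D)\<close> in large degree\<close>

text \<open>
  The \<open>GREATEST\<close> in the definition of the genus is attained, thanks to Riemann's bound.
\<close>

lemma genus_props:
  shows Riemann: "is_divisor C D \<Longrightarrow> div_deg C D + 1 - int (genus C) \<le> int (ell D)"
    and genus_attained: "\<exists>D. is_divisor C D \<and> int (ell D) = div_deg C D + 1 - int (genus C)"
proof -
  let ?P = "\<lambda>n. \<exists>D. is_divisor C D \<and> int n = div_deg C D + 1 - int (kdim C (RR_space C D))"
  have e: "kdim C (RR_space C D) = ell D" if "is_divisor C D" for D
    using that by (simp add: RR_space_eq ell_def)
  obtain \<gamma> where \<gamma>: "\<And>D. is_divisor C D \<Longrightarrow> div_deg C D - int (ell D) \<le> \<gamma>"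
    using Riemann_bound by blast
  have bd: "n \<le> nat (\<gamma> + 1)" if "?P n" for n
  proof -
    from that obtain D where "is_divisor C D" "int n = div_deg C D + 1 - int (ell D)" using e by metis
    then show ?thesis using \<gamma>[of D] by linarith
  qed
  have "?P 0" using e[of 0] dim_LL_0(2) by (intro exI[of _ 0]) simp
  then have "?P (genus C)" unfolding genus_def by (rule GreatestI_nat[of ?P]) (rule bd)
  then show "\<exists>D. is_divisor C D \<and> int (ell D) = div_deg C D + 1 - int (genus C)"
    using e by (metis add_diff_cancel_left' diff_add_cancel diff_diff_eq2)
  assume D: "is_divisor C D"
  show "div_deg C D + 1 - int (genus C) \<le> int (ell D)"
  proof (cases "0 \<le> div_deg C D + 1 - int (ell D)")
    case True
    then have "?P (nat (div_deg C D + 1 - int (ell D)))" using D e by (intro exI[of _ D]) simp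
    then have "nat (div_deg C D + 1 - int (ell D)) \<le> genus C"
      unfolding genus_def by (rule Greatest_le_nat[of ?P]) (rule bd)
    then show ?thesis using True by linarith
  qed simp
qed

abbreviation ninf :: "int \<Rightarrow> 'a divisor" where "ninf \<equiv> pdiv (infty C)"

lemma ninf: "is_divisor C (ninf n)" "div_deg C (ninf n) = n"
  using is_divisor_pdiv[OF infty_point] by (auto simp: div_deg_pdiv point_deg_infty)

lemma ninf_add: "ninf m + ninf n = ninf (m + n)" "ninf m - ninf n = ninf (m - n)"
  by (auto simp: fun_eq_iff pdiv_def)

text \<open>
  If \<open>D\<close> attains the genus, so does every divisor above \<open>D\<close>, and
  \<open>E + n P\<^sub>\<infinity>\<close> is equivalent to such a divisor for large \<open>n\<close>.
\<close>

lemma exact_in_large_degree: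
  assumes E: "is_divisor C E"
  shows "\<exists>n::nat. int (ell (E + ninf (int n))) = div_deg C (E + ninf (int n)) + 1 - int (genus C)"
proof -
  obtain D where D: "is_divisor C D" "int (ell D) = div_deg C D + 1 - int (genus C)"
    using genus_attained by blast
  define n where "n = nat (div_deg C D - div_deg C E + int (genus C))"
  define A where "A = E + ninf (int n)"
  have A: "is_divisor C A" "div_deg C A = div_deg C E + int n"
    using E ninf by (auto simp: A_def is_divisor_add div_deg_add)
  have dA: "is_divisor C (A - D)" using A D by (intro is_divisor_diff)
  have "0 < div_deg C (A - D) + 1 - int (genus C)" using A D by (simp add: div_deg_diff n_def)
  then have "0 < ell (A - D)" using Riemann[OF dA] by linarith
  then obtain f where f: "f \<in> LL (A - D)" "f \<noteq> 0" using exists_nonzero_of_ell by blast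
  define A' where "A' = A - principal_div C (inverse f)"
  have A': "is_divisor C A'" "div_deg C A' = div_deg C A" "ell A' = ell A"
    unfolding A'_def using A f is_divisor_principal[of "inverse f"] ell_shift[of "inverse f" A]
    by (auto simp: is_divisor_diff div_deg_diff deg_principal)
  have "principal_div C (inverse f) = - principal_div C f"
    by (auto simp: principal_div_def pt_inverse fun_eq_iff)
  then have "D \<le> A'" using LL_nonzero[OF dA f] by (auto simp: A'_def le_fun_def algebra_simps)
  then have "int (ell A') - div_deg C A' \<le> int (ell D) - div_deg C D" using A' D by (intro ell_growth) auto
  then show ?thesis using Riemann[OF A'(1)] A' D unfolding A_def[symmetric] by (intro exI[of _ n]) (simp add: A_def[symmetric])
qed

lemma ell_step:
  assumes "is_divisor C D" shows "ell (D - ninf 1) \<le> ell D" "ell D \<le> ell (D - ninf 1) + 1"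
proof -
  have d: "is_divisor C (D - ninf 1)" using assms ninf by (intro is_divisor_diff)
  have le: "D - ninf 1 \<le> D" by (auto simp: le_fun_def pdiv_def)
  show "ell (D - ninf 1) \<le> ell D" using assms le by (rule ell_mono)
  show "ell D \<le> ell (D - ninf 1) + 1"
    using ell_growth[OF d assms le] assms ninf by (simp add: div_deg_diff)
qed

lemma jump_element:
  assumes "is_divisor C D" "ell D \<noteq> ell (D - ninf 1)"
  shows "\<exists>f\<in>LL D. f \<noteq> 0 \<and> infty C f = - D (infty C)"
proof -
  have "LL D \<noteq> LL (D - ninf 1)" using assms(2) by (auto simp: ell_def)
  moreover have "LL (D - ninf 1) \<subseteq> LL D" by (intro LL_mono) (auto simp: le_fun_def pdiv_def)
  ultimately obtain f where f: "f \<in> LL D" "f \<notin> LL (D - ninf 1)" by blast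
  then obtain P where P: "P \<in> points C" "\<not> vge P (- (D - ninf 1) P) f" "vge P (- D P) f"
    unfolding LS_def by blast
  then have "P = infty C" by (auto simp: pdiv_def split: if_splits)
  then show ?thesis using P f by (intro bexI[of _ f]) (auto simp: vge_def pdiv_def)
qed

text \<open>
  Suppose that \<open>L(M) = L(M - P\<^sub>\<infinity>)\<close>.  For every \<open>k\<close>, at most one of \<open>L(k P\<^sub>\<infinity>) / L((k - 1) P\<^sub>\<infinity>)\<close> and
  \<open>L(M - k P\<^sub>\<infinity>) / L(M - (k + 1) P\<^sub>\<infinity>)\<close> is nonzero: the product of witnesses would lie in
  \<open>L(M)\<close> but not in \<open>L(M - P\<^sub>\<infinity>)\<close>.  Summing over \<open>0 \<le> k \<le> m = deg M\<close> gives
  \<open>l(m P\<^sub>\<infinity>) + l(M) \<le> m + 1\<close>, whereas both terms are at least \<open>m + 1 - g\<close>, and \<open>m \<ge> 2g\<close>.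
\<close>

lemma jump_in_large_degree:
  assumes M: "is_divisor C M" and deg: "2 * int (genus C) \<le> div_deg C M"
  shows "ell M = ell (M - ninf 1) + 1"
proof (rule ccontr)
  assume "\<not> ?thesis"
  then have eq: "ell M = ell (M - ninf 1)" using ell_step[OF M] by linarith
  define m where "m = nat (div_deg C M)"
  have m: "div_deg C M = int m" using deg by (simp add: m_def)
  define a where "a k = ell (ninf (int k - 1))" for k
  define b where "b k = ell (M - ninf (int k))" for k
  have dM: "is_divisor C (M - ninf k)" for k using M ninf by (intro is_divisor_diff)
  have inc: "a (Suc k) + b k \<le> a k + b (Suc k) + 1" for k
  proof -
    have Dk: "is_divisor C (ninf (int k))" by (rule ninf)
    have e1: "ninf (int k) - ninf 1 = ninf (int k - 1)" by (simp add: ninf_add)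
    have e2: "M - ninf (int k) - ninf 1 = M - ninf (int (Suc k))"
      by (auto simp: fun_eq_iff pdiv_def)
    note s1 = ell_step[OF Dk, unfolded e1] and s2 = ell_step[OF dM[of "int k"], unfolded e2]
    have "\<not> (a (Suc k) \<noteq> a k \<and> b k \<noteq> b (Suc k))"
    proof
      assume n: "a (Suc k) \<noteq> a k \<and> b k \<noteq> b (Suc k)"
      obtain f where f: "f \<in> LL (ninf (int k))" "f \<noteq> 0" "infty C f = - ninf (int k) (infty C)"
        using jump_element[OF Dk] n unfolding e1 by (auto simp: a_def)
      obtain h where h: "h \<in> LL (M - ninf (int k))" "h \<noteq> 0" "infty C h = - (M - ninf (int k)) (infty C)"
        using jump_element[OF dM[of "int k"]] n unfolding e2 by (auto simp: b_def)
      have "vge P (- M P) (f * h)" if P: "P \<in> points C" for P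
      proof -
        have "vge P (- ninf (int k) P + - (M - ninf (int k)) P) (f * h)"
          using f h P by (intro vge_mult) (auto simp: LS_def)
        then show ?thesis by simp
      qed
      then have "f * h \<in> LL M" by (simp add: LS_def)
      moreover have "LL (M - ninf 1) = LL M"
        using eq by (intro vs.subspace_eq_of_dim_le subspace_LL LL_mono fin_dim_LL M)
          (auto simp: le_fun_def pdiv_def ell_def)
      ultimately have "f * h \<in> LL (M - ninf 1)" by simp
      then have "vge (infty C) (- (M - ninf 1) (infty C)) (f * h)" using infty_point unfolding LS_def by blast
      then show False using f h by (simp add: vge_def pt_mult infty_point pdiv_def)
    qed
    then show ?thesis using s1 s2 by (auto simp: a_def b_def)
  qed
  have tel: "a n + b 0 \<le> a 0 + b n + n" for n
  proof (induction n)
    case (Suc n)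
    then show ?case using inc[of n] by simp
  qed simp
  have "a 0 = 0" unfolding a_def using ninf[of "- 1"] by (intro ell_neg_deg) auto
  moreover have "b (Suc m) = 0" unfolding b_def
    using M ninf m by (intro ell_neg_deg dM) (simp add: div_deg_diff)
  moreover have "int m + 1 - int (genus C) \<le> int (a (Suc m))"
    unfolding a_def using Riemann[OF ninf(1)[of "int m"]] ninf(2)[of "int m"] by simp
  moreover have "b 0 = ell M" by (simp add: b_def pdiv_def zero_fun_def[symmetric] fun_diff_def)
  moreover have "int m + 1 - int (genus C) \<le> int (ell M)" using Riemann[OF M] m by simp
  ultimately show False using tel[of "Suc m"] deg m by simp
qed

theorem ell_large_degree:
  assumes E: "is_divisor C E" and deg: "2 * int (genus C) - 1 \<le> div_deg C E"
  shows "int (ell E) = div_deg C E + 1 - int (genus C)"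
proof -
  define A where "A n = E + ninf (int n)" for n
  have d: "is_divisor C (A n)" "div_deg C (A n) = div_deg C E + int n" for n
    using E ninf by (auto simp: A_def is_divisor_add div_deg_add)
  have down: "int (ell (A n)) = div_deg C E + int n + 1 - int (genus C) \<Longrightarrow>
      int (ell (A 0)) = div_deg C E + 1 - int (genus C)" for n
  proof (induction n)
    case (Suc n)
    have e: "A (Suc n) - ninf 1 = A n" by (auto simp: A_def fun_eq_iff pdiv_def)
    have "ell (A (Suc n)) = ell (A n) + 1"
      using jump_in_large_degree[OF d(1)[of "Suc n"]] d(2)[of "Suc n"] deg unfolding e by simp
    then have "int (ell (A n)) = div_deg C E + int n + 1 - int (genus C)" using Suc.prems by linarith
    then show ?case by (rule Suc.IH)
  qed simp
  obtain n :: nat where "int (ell (A n)) = div_deg C (A n) + 1 - int (genus C)"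
    using exact_in_large_degree[OF E] unfolding A_def by blast
  then have "int (ell (A 0)) = div_deg C E + 1 - int (genus C)" using down[of n] d(2)[of n] by linarith
  moreover have "A 0 = E" by (auto simp: A_def fun_eq_iff pdiv_def)
  ultimately show ?thesis by simp
qed

section \<open>The degree zero Picard group\<close>

lemma div_group_simps [simp]:
  "carrier (div_group C) = {D. is_divisor C D \<and> div_deg C D = 0}"
  "monoid.mult (div_group C) = (+)" "monoid.one (div_group C) = 0"
  by (simp_all add: div_group_def)

lemma comm_group_div: "comm_group (div_group C)"
proof (rule comm_groupI)
  fix D assume "D \<in> carrier (div_group C)"
  then have "- D \<in> carrier (div_group C)" by (simp add: div_deg_uminus)
  moreover have "- D + D = 0" by simp
  ultimately show "\<exists>E\<in>carrier (div_group C). E \<otimes>\<^bsub>div_group C\<^esub> D = \<one>\<^bsub>div_group C\<^esub>"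
    unfolding div_group_simps(2,3) by blast
qed (simp_all add: is_divisor_add div_deg_add add.assoc add.commute)

lemma div_group_inv:
  assumes "D \<in> carrier (div_group C)" shows "inv\<^bsub>div_group C\<^esub> D = - D"
proof -
  interpret G: comm_group "div_group C" by (rule comm_group_div)
  show ?thesis using assms by (intro G.inv_equality) (simp_all add: div_deg_uminus)
qed

lemma principal_div_mult: "f \<noteq> 0 \<Longrightarrow> h \<noteq> 0 \<Longrightarrow> principal_div C (f * h) = principal_div C f + principal_div C h"
  by (auto simp: principal_div_def pt_mult fun_eq_iff)

lemma principal_div_inverse: "principal_div C (inverse f) = - principal_div C f"
  by (auto simp: principal_div_def pt_inverse fun_eq_iff)

lemma normal_principal: "principal_divs C \<lhd> div_group C"
proof -
  interpret G: comm_group "div_group C" by (rule comm_group_div)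
  have sub: "principal_divs C \<subseteq> carrier (div_group C)"
    by (auto simp: principal_divs_def deg_principal)
  have "subgroup (principal_divs C) (div_group C)"
  proof (rule G.subgroupI[OF sub])
    have "principal_div C 1 \<in> principal_divs C" unfolding principal_divs_def by (rule imageI) simp
    then show "principal_divs C \<noteq> {}" by blast
    fix D assume D: "D \<in> principal_divs C"
    then obtain f where f: "f \<noteq> 0" "D = principal_div C f" by (auto simp: principal_divs_def)
    have "inv\<^bsub>div_group C\<^esub> D = principal_div C (inverse f)"
      using div_group_inv[of D] D sub f by (auto simp: principal_div_inverse)
    then show "inv\<^bsub>div_group C\<^esub> D \<in> principal_divs C" using f by (auto simp: principal_divs_def)
    fix E assume "E \<in> principal_divs C"
    then obtain h where h: "h \<noteq> 0" "E = principal_div C h" by (auto simp: principal_divs_def)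
    have "D + E = principal_div C (f * h)" using f h by (simp add: principal_div_mult)
    then show "D \<otimes>\<^bsub>div_group C\<^esub> E \<in> principal_divs C" using f h by (auto simp: principal_divs_def)
  qed
  then show ?thesis by (rule G.subgroup_imp_normal)
qed

abbreviation g :: int where "g \<equiv> int (genus C)"

lemma pic_class_eq: "pic_class C D = principal_divs C #>\<^bsub>div_group C\<^esub> (D - ninf g)"
  by (simp add: pic_class_def pdiv_def)

lemma coset_eq:
  assumes "E \<in> carrier (div_group C)" "f \<noteq> 0"
  shows "principal_divs C #>\<^bsub>div_group C\<^esub> (principal_div C f + E) = principal_divs C #>\<^bsub>div_group C\<^esub> E"
proof -
  interpret N: normal "principal_divs C" "div_group C" by (rule normal_principal)
  have f: "principal_div C f \<in> principal_divs C" using assms by (auto simp: principal_divs_def)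
  then have "principal_div C f \<in> carrier (div_group C)" using N.subset by blast
  then have "principal_divs C #>\<^bsub>div_group C\<^esub> (principal_div C f \<otimes>\<^bsub>div_group C\<^esub> E) =
      (principal_divs C #>\<^bsub>div_group C\<^esub> principal_div C f) #>\<^bsub>div_group C\<^esub> E"
    using N.coset_mult_assoc[OF N.subset _ assms(1)] by simp
  also have "principal_divs C #>\<^bsub>div_group C\<^esub> principal_div C f = principal_divs C"
    by (rule N.rcos_const[OF N.is_group f])
  finally show ?thesis unfolding div_group_simps(2) .
qed

lemma pic_class_inverse:
  assumes D: "is_divisor C D" "div_deg C D = g" and A: "is_divisor C A" "div_deg C A = g"
    and f: "f \<noteq> 0" "D + A = principal_div C f + ninf (2 * g)"
  shows "pic_class C A = inv\<^bsub>Pic0 C\<^esub> (pic_class C D)"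
proof -
  interpret N: normal "principal_divs C" "div_group C" by (rule normal_principal)
  have m: "D - ninf g \<in> carrier (div_group C)" "A - ninf g \<in> carrier (div_group C)"
    using D A ninf by (auto simp: is_divisor_diff div_deg_diff)
  have "A - ninf g = principal_div C f + (ninf (2 * g) - ninf g - D)"
    using f(2) by (simp add: algebra_simps)
  also have "ninf (2 * g) - ninf g - D = - (D - ninf g)" by (simp add: ninf_add)
  finally have e: "A - ninf g = principal_div C f + - (D - ninf g)" .
  have "- (D - ninf g) \<in> carrier (div_group C)" using m(1) by (simp only: div_group_inv[symmetric] N.inv_closed)
  then have "pic_class C A = principal_divs C #>\<^bsub>div_group C\<^esub> (inv\<^bsub>div_group C\<^esub> (D - ninf g))"
    unfolding pic_class_eq e using coset_eq[OF _ f(1)] div_group_inv[OF m(1)] by simp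
  also have "\<dots> = inv\<^bsub>Pic0 C\<^esub> (pic_class C D)"
    unfolding Pic0_def pic_class_eq using m(1) N.rcos_inv[OF m(1)]
    by (subst N.inv_FactGroup) (auto simp: carrier_FactGroup)
  finally show ?thesis .
qed

lemma pic_class_sum:
  assumes D: "is_divisor C D" "div_deg C D = g" and E: "is_divisor C E" "div_deg C E = g"
    and f: "f \<noteq> 0" "A + ninf g = principal_div C f + (D + E)"
  shows "pic_class C A = pic_class C D \<otimes>\<^bsub>Pic0 C\<^esub> pic_class C E"
proof -
  interpret N: normal "principal_divs C" "div_group C" by (rule normal_principal)
  have m: "D - ninf g \<in> carrier (div_group C)" "E - ninf g \<in> carrier (div_group C)"
    using D E ninf by (auto simp: is_divisor_diff div_deg_diff)
  have e: "A - ninf g = principal_div C f + ((D - ninf g) + (E - ninf g))"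
    using f(2) by (simp add: algebra_simps)
  have "(D - ninf g) + (E - ninf g) \<in> carrier (div_group C)" using N.m_closed[OF m] by simp
  then have "pic_class C A = principal_divs C #>\<^bsub>div_group C\<^esub> ((D - ninf g) + (E - ninf g))"
    unfolding pic_class_eq e by (rule coset_eq[OF _ f(1)])
  also have "\<dots> = pic_class C D \<otimes>\<^bsub>Pic0 C\<^esub> pic_class C E"
    unfolding Pic0_def pic_class_eq using N.rcos_sum[OF m] by simp
  finally show ?thesis .
qed

section \<open>Affine divisors and the spaces \<open>W\<^sup>N\<^sub>D\<close>\<close>

lemma affine_div_mult: "f \<noteq> 0 \<Longrightarrow> h \<noteq> 0 \<Longrightarrow> affine_div C (f * h) = affine_div C f + affine_div C h"
  by (auto simp: affine_div_def pt_mult fun_eq_iff)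

lemma affine_div_divide: "f \<noteq> 0 \<Longrightarrow> h \<noteq> 0 \<Longrightarrow> affine_div C (f / h) = affine_div C f - affine_div C h"
  by (auto simp: affine_div_def pt_divide fun_eq_iff)

lemma pole_deg_mult: "f \<noteq> 0 \<Longrightarrow> h \<noteq> 0 \<Longrightarrow> pole_deg C (f * h) = pole_deg C f + pole_deg C h"
  by (simp add: pole_deg_def pt_mult infty_point)

lemma pole_deg_divide: "f \<noteq> 0 \<Longrightarrow> h \<noteq> 0 \<Longrightarrow> pole_deg C (f / h) = pole_deg C f - pole_deg C h"
  by (simp add: pole_deg_def pt_divide infty_point)

lemma affine_div_const: "affine_div C (emb C c) = 0"
  by (auto simp: affine_div_def pt_emb fun_eq_iff)

lemma affine_div_const_mult: "c \<noteq> 0 \<Longrightarrow> affine_div C (emb C c * f) = affine_div C f"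
  by (cases "f = 0") (auto simp: affine_div_mult affine_div_const fun_eq_iff)

lemma pole_deg_const_mult: "c \<noteq> 0 \<Longrightarrow> pole_deg C (emb C c * f) = pole_deg C f"
  by (cases "f = 0") (auto simp: pole_deg_def pt_mult pt_emb infty_point)

lemma principal_div_affine: "principal_div C f = affine_div C f - ninf (pole_deg C f)"
proof
  fix P
  show "principal_div C f P = (affine_div C f - ninf (pole_deg C f)) P"
    using infty_point by (cases "P = infty C") (simp_all add: principal_div_def affine_div_def pdiv_def pole_deg_def)
qed

lemma is_divisor_affine: "is_divisor C (affine_div C f)"
proof -
  have "affine_div C f = principal_div C f + ninf (pole_deg C f)"
    by (simp add: principal_div_affine)
  then show ?thesis using is_divisor_add[OF is_divisor_principal' ninf(1)] by simp
qed

lemma deg_affine_div: "f \<noteq> 0 \<Longrightarrow> div_deg C (affine_div C f) = pole_deg C f"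
  using deg_principal[of f] is_divisor_affine[of f] ninf
  by (simp add: principal_div_affine div_deg_diff)

lemma affine_div_infty: "affine_div C f (infty C) = 0"
  by (simp add: affine_div_def)

lemma good_0: "good C 0"
  unfolding good_def by (intro conjI is_divisor_0 order_refl) simp

lemma good_add: "good C D \<Longrightarrow> good C E \<Longrightarrow> good C (D + E)"
  unfolding good_def by (auto intro: is_divisor_add add_nonneg_nonneg)

lemma good_deg_add: "good C D \<Longrightarrow> good C E \<Longrightarrow> div_deg C (D + E) = div_deg C D + div_deg C E"
  unfolding good_def by (auto intro: div_deg_add)

lemma mem_reg_ring: "f \<in> reg_ring C \<longleftrightarrow> f = 0 \<or> 0 \<le> affine_div C f"
proof -
  have "0 \<le> affine_div C f \<longleftrightarrow> (\<forall>P\<in>points C - {infty C}. 0 \<le> P f)"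
    unfolding le_fun_def zero_fun_apply affine_div_def by auto
  then show ?thesis by (simp add: reg_ring_def)
qed

lemma mem_div_ideal:
  assumes "good C D"
  shows "f \<in> div_ideal C D \<longleftrightarrow> f = 0 \<or> D \<le> affine_div C f"
proof -
  have "D \<le> affine_div C f \<Longrightarrow> f \<in> reg_ring C"
    using assms unfolding good_def mem_reg_ring by (blast intro: order_trans)
  moreover have "0 \<in> reg_ring C" by (simp add: reg_ring_def)
  ultimately show ?thesis unfolding div_ideal_def by blast
qed

lemma mem_W: "f \<in> W C N \<longleftrightarrow> f = 0 \<or> 0 \<le> affine_div C f \<and> pole_deg C f \<le> N"
  unfolding W_def using mem_reg_ring by blast

lemma mem_WD:
  assumes "good C D"
  shows "f \<in> WD C N D \<longleftrightarrow> f = 0 \<or> D \<le> affine_div C f \<and> pole_deg C f \<le> N"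
proof -
  have "D \<le> affine_div C f \<Longrightarrow> 0 \<le> affine_div C f" using assms unfolding good_def by (blast intro: order_trans)
  then show ?thesis unfolding WD_def using mem_W mem_div_ideal[OF assms] by blast
qed

lemma WD_0: "WD C N 0 = W C N"
  using mem_WD[OF good_0] mem_W by blast

lemma WD_eq_LL:
  assumes D: "good C D" shows "WD C N D = LL (ninf N - D)"
proof -
  have "D \<le> affine_div C f \<and> pole_deg C f \<le> N \<longleftrightarrow> (\<forall>P\<in>points C. - (ninf N - D) P \<le> P f)" for f
  proof
    assume a: "D \<le> affine_div C f \<and> pole_deg C f \<le> N"
    show "\<forall>P\<in>points C. - (ninf N - D) P \<le> P f"
    proof
      fix P assume P: "P \<in> points C"
      have "D P \<le> affine_div C f P" using a by (simp add: le_funD)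
      then show "- (ninf N - D) P \<le> P f"
        using a P D by (cases "P = infty C") (auto simp: good_def pole_deg_def affine_div_def pdiv_def)
    qed
  next
    assume a: "\<forall>P\<in>points C. - (ninf N - D) P \<le> P f"
    have "D P \<le> affine_div C f P" for P
    proof (cases "P \<in> points C - {infty C}")
      case True
      then have "- (ninf N - D) P \<le> P f" using a by blast
      then show ?thesis using True by (simp add: affine_div_def pdiv_def)
    next
      case False
      then have "D P = 0" using D divisor_outside[of D P] by (auto simp: good_def)
      then show ?thesis using False by (auto simp: affine_div_def)
    qed
    moreover have "- N \<le> infty C f"
      using bspec[OF a infty_point] D by (simp add: good_def pdiv_def)
    ultimately show "D \<le> affine_div C f \<and> pole_deg C f \<le> N" by (simp add: le_fun_def pole_deg_def)
  qed
  then show ?thesis using mem_WD[OF D] by (auto simp: LS_def vge_def)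
qed

lemma subspace_WD: "good C D \<Longrightarrow> vs.subspace (WD C N D)"
  by (simp only: WD_eq_LL subspace_LL)

lemma subspace_W: "vs.subspace (W C N)"
  using subspace_WD[OF good_0] by (simp only: WD_0)

lemma is_divisor_WD: "good C D \<Longrightarrow> is_divisor C (ninf N - D)"
  by (auto simp: good_def intro: is_divisor_diff ninf)

lemma fin_dim_WD: "good C D \<Longrightarrow> vs.fin_dim (WD C N D)"
  by (simp only: WD_eq_LL fin_dim_LL is_divisor_WD)

lemma fin_dim_W: "vs.fin_dim (W C N)"
  using fin_dim_WD[OF good_0] by (simp only: WD_0)

lemma dim_WD: "good C D \<Longrightarrow> vs.dim (WD C N D) = ell (ninf N - D)"
  by (simp only: WD_eq_LL ell_def)

lemma deg_WD: "good C D \<Longrightarrow> div_deg C (ninf N - D) = N - div_deg C D"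
  using ninf by (auto simp: good_def div_deg_diff)

lemma dim_WD_ge: "good C D \<Longrightarrow> N - div_deg C D + 1 - g \<le> int (vs.dim (WD C N D))"
  using Riemann[OF is_divisor_WD] by (simp only: dim_WD deg_WD)

lemma dim_WD_eq:
  "good C D \<Longrightarrow> 2 * g - 1 \<le> N - div_deg C D \<Longrightarrow> int (vs.dim (WD C N D)) = N - div_deg C D + 1 - g"
  using ell_large_degree[OF is_divisor_WD] by (simp only: dim_WD deg_WD)

lemma dim_W_eq: "2 * g - 1 \<le> N \<Longrightarrow> int (vs.dim (W C N)) = N + 1 - g"
  using dim_WD_eq[OF good_0, of N] unfolding WD_0 by (simp only: div_deg_0 diff_0_right)

lemma dim_WD_step:
  assumes "good C D"
  shows "vs.dim (WD C N D) \<le> vs.dim (WD C (N - 1) D) + 1"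
    and "vs.dim (WD C N D) \<noteq> vs.dim (WD C (N - 1) D) \<Longrightarrow> \<exists>f\<in>WD C N D. has_deg C f N"
proof -
  have e: "ninf (N - 1) - D = ninf N - D - ninf 1" by (auto simp: fun_eq_iff pdiv_def)
  note d = is_divisor_WD[OF assms, of N]
  show "vs.dim (WD C N D) \<le> vs.dim (WD C (N - 1) D) + 1"
    using ell_step(2)[OF d] by (simp only: dim_WD[OF assms] e)
  assume "vs.dim (WD C N D) \<noteq> vs.dim (WD C (N - 1) D)"
  then have "ell (ninf N - D) \<noteq> ell (ninf N - D - ninf 1)" by (simp only: dim_WD[OF assms] e not_False_eq_True)
  from jump_element[OF d this] obtain f where f: "f \<in> LL (ninf N - D)" "f \<noteq> 0" "infty C f = - (ninf N - D) (infty C)"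
    by blast
  have "f \<in> WD C N D" using f(1) by (simp only: WD_eq_LL[OF assms])
  moreover have "has_deg C f N" using f assms by (simp add: has_deg_def pole_deg_def pdiv_def good_def)
  ultimately show "\<exists>f\<in>WD C N D. has_deg C f N" by blast
qed

text \<open>
  The residue field at \<open>P\<^sub>\<infinity>\<close> is \<open>K\<close>, so functions with equal
  pole order have proportional leading coefficients.
\<close>

lemma leading_coeff:
  assumes "f \<noteq> 0" "h \<noteq> 0" "pole_deg C f = pole_deg C h"
  shows "\<exists>c. c \<noteq> 0 \<and> (f - emb C c * h = 0 \<or> pole_deg C (f - emb C c * h) < pole_deg C f)"
proof -
  have "f / h \<in> local_ring (infty C)"
    using assms by (simp add: local_ring_def pt_divide infty_point pole_deg_def)
  then obtain c m where c: "f / h = emb C c + m" "m \<in> max_ideal (infty C)"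
    using rational_infty by (auto simp: rational_point_def set_plus_def)
  have f: "f - emb C c * h = m * h" using c(1) assms by (simp add: field_simps)
  have "c \<noteq> 0"
  proof
    assume "c = 0"
    then have "f / h \<in> max_ideal (infty C)" using c by simp
    then show False using assms by (simp add: max_ideal_def pt_divide infty_point pole_deg_def)
  qed
  moreover have "m * h = 0 \<or> pole_deg C (m * h) < pole_deg C f"
    using c(2) assms by (cases "m = 0") (simp_all add: max_ideal_def pole_deg_def pt_mult infty_point)
  ultimately show ?thesis using f by metis
qed

lemma set_times_image: "s *o V = (*) s ` V"
  by (auto simp: elt_set_times_def)

lemma dim_set_times:
  assumes "s \<noteq> 0" "vs.fin_dim V" shows "vs.fin_dim (s *o V)" "vs.dim (s *o V) = vs.dim V"
  using dim_times[OF assms] by (simp_all add: set_times_image)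

lemma subspace_set_times:
  assumes "vs.subspace V" shows "vs.subspace (s *o V)"
proof (rule vs.subspaceI)
  show "0 \<in> s *o V" using vs.subspace_0[OF assms] by (force simp: elt_set_times_def)
  show "x + y \<in> s *o V" if xy: "x \<in> s *o V" "y \<in> s *o V" for x y
  proof -
    obtain a b where "a \<in> V" "b \<in> V" "x = s * a" "y = s * b" using xy by (auto simp: elt_set_times_def)
    then have "x + y = s * (a + b)" "a + b \<in> V" using vs.subspace_add[OF assms] by (auto simp: algebra_simps)
    then show ?thesis by (auto simp: elt_set_times_def)
  qed
  show "scl C c x \<in> s *o V" if x: "x \<in> s *o V" for c x
  proof -
    obtain a where "a \<in> V" "x = s * a" using x by (auto simp: elt_set_times_def)
    then have "scl C c x = s * scl C c a" "scl C c a \<in> V" using vs.subspace_scale[OF assms] by (auto simp: scl_def)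
    then show ?thesis by (auto simp: elt_set_times_def)
  qed
qed

lemma W_mono: "m \<le> n \<Longrightarrow> W C m \<subseteq> W C n"
  by (auto simp: W_def)

lemma WD_mono: "m \<le> n \<Longrightarrow> WD C m D \<subseteq> WD C n D"
  using W_mono by (auto simp: WD_def)

lemma WD_W: "WD C n D \<subseteq> W C n" by (auto simp: WD_def)

lemma WD_mult_W:
  assumes D: "good C D" and a: "a \<in> WD C m D" and b: "b \<in> W C n" shows "a * b \<in> WD C (m + n) D"
proof (cases "a = 0 \<or> b = 0")
  case False
  then have "D + 0 \<le> affine_div C a + affine_div C b" "pole_deg C a \<le> m" "pole_deg C b \<le> n"
    using a b unfolding mem_WD[OF D] mem_W by (blast intro: add_mono)+
  then show ?thesis using False unfolding mem_WD[OF D] by (simp add: affine_div_mult pole_deg_mult)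
qed (auto simp: mem_WD[OF D])

section \<open>Semi-typical divisors\<close>

lemma semi_typicalD:
  assumes "semi_typical C D"
  shows "good C D" "g \<le> div_deg C D" "WD C (div_deg C D + g - 1) D = {0}"
  using assms by (simp_all add: semi_typical_def Let_def)

lemma semi_typicalI:
  "good C D \<Longrightarrow> g \<le> div_deg C D \<Longrightarrow> WD C (div_deg C D + g - 1) D = {0} \<Longrightarrow> semi_typical C D"
  by (simp add: semi_typical_def Let_def)

lemma dim_zero_space: "vs.dim {0} = 0"
  using vs.dim_le_card[of "{0}" "{}"] by simp

lemma zero_space_of_dim:
  assumes "vs.subspace V" "vs.fin_dim V" "vs.dim V = 0" shows "V = {0}"
  using vs.subspace_eq_of_dim_le[OF vs.subspace_single_0, of V] vs.subspace_0[OF assms(1)] assms by simp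

text \<open>
  The dimensions are \<open>0\<close> in degree \<open>d + g - 1\<close>, grow by at most
  \<open>1\<close> in each step, and are at least \<open>1\<close> and \<open>2\<close> by Riemann's
  inequality.
\<close>

lemma semi_typical_dims:
  assumes D: "semi_typical C D" and d: "div_deg C D = d"
  shows "vs.dim (WD C (d + g) D) = 1" "vs.dim (WD C (d + g + 1) D) = 2"
proof -
  note s = semi_typicalD[OF D, unfolded d]
  have 0: "vs.dim (WD C (d + g - 1) D) = 0" by (simp only: s(3) dim_zero_space)
  have 1: "vs.dim (WD C (d + g) D) \<le> 1" using dim_WD_step(1)[OF s(1), of "d + g"] 0 by simp
  have 2: "vs.dim (WD C (d + g + 1) D) \<le> vs.dim (WD C (d + g) D) + 1"
    using dim_WD_step(1)[OF s(1), of "d + g + 1"] by simp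
  have 3: "1 \<le> int (vs.dim (WD C (d + g) D))" "2 \<le> int (vs.dim (WD C (d + g + 1) D))"
    using dim_WD_ge[OF s(1), of "d + g"] dim_WD_ge[OF s(1), of "d + g + 1"] d by simp_all
  show "vs.dim (WD C (d + g) D) = 1" "vs.dim (WD C (d + g + 1) D) = 2" using 1 2 3 by linarith+
qed

lemma semi_typical_exact:
  assumes D: "semi_typical C D" and d: "div_deg C D = d"
  shows "\<exists>s\<in>WD C (d + g) D. has_deg C s (d + g)" "\<exists>t\<in>WD C (d + g + 1) D. has_deg C t (d + g + 1)"
proof -
  note s = semi_typicalD[OF D, unfolded d] and dm = semi_typical_dims[OF D d]
  have "vs.dim (WD C (d + g - 1) D) = 0" by (simp only: s(3) dim_zero_space)
  then show "\<exists>s\<in>WD C (d + g) D. has_deg C s (d + g)"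
    using dim_WD_step(2)[OF s(1), of "d + g"] dm by simp
  show "\<exists>t\<in>WD C (d + g + 1) D. has_deg C t (d + g + 1)"
    using dim_WD_step(2)[OF s(1), of "d + g + 1"] dm by simp
qed

lemma deg_ge_of_semi_typical:
  assumes D: "semi_typical C D" and f: "f \<in> WD C N D" "f \<noteq> 0"
  shows "div_deg C D + g \<le> pole_deg C f"
proof (rule ccontr)
  assume "\<not> ?thesis"
  then have "f \<in> WD C (div_deg C D + g - 1) D"
    using f mem_WD[OF semi_typicalD(1)[OF D]] by auto
  then show False using f semi_typicalD(3)[OF D] by auto
qed

lemma semi_typical_scalar:
  assumes D: "semi_typical C D" and d: "div_deg C D = d"
    and s: "s \<in> WD C (d + g) D" "has_deg C s (d + g)"
    and f: "f \<in> WD C (d + g) D"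
  shows "\<exists>c. f = emb C c * s"
proof (cases "f = 0")
  case True
  then show ?thesis by (intro exI[of _ 0]) simp
next
  case False
  have "pole_deg C f = d + g" using deg_ge_of_semi_typical[OF D f False] f False d
    mem_WD[OF semi_typicalD(1)[OF D], of f "d + g"] by simp
  then obtain c where c: "f - emb C c * s = 0 \<or> pole_deg C (f - emb C c * s) < d + g"
    using leading_coeff[of f s] s False by (auto simp: has_deg_def)
  have "f - emb C c * s \<in> WD C (d + g) D"
    using vs.subspace_diff[OF subspace_WD f vs.subspace_scale[OF subspace_WD s(1), of c]]
      semi_typicalD(1)[OF D] by (simp add: scl_def)
  then have "f - emb C c * s = 0" using deg_ge_of_semi_typical[OF D, of "f - emb C c * s" "d + g"] c d by force
  then show ?thesis by (intro exI[of _ c]) simp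
qed

lemma semi_typical_combination:
  assumes D: "semi_typical C D" and d: "div_deg C D = d"
    and s: "s \<in> WD C (d + g) D" "has_deg C s (d + g)"
    and t: "t \<in> WD C (d + g + 1) D" "has_deg C t (d + g + 1)"
    and f: "f \<in> WD C (d + g + 1) D"
  shows "\<exists>a b. f = emb C a * s + emb C b * t"
proof (cases "f \<in> WD C (d + g) D")
  case True
  then obtain c where "f = emb C c * s" using semi_typical_scalar[OF D d s] by blast
  then show ?thesis by (intro exI[of _ c] exI[of _ 0]) simp
next
  case False
  note gD = semi_typicalD(1)[OF D]
  have f0: "f \<noteq> 0" using False by (auto simp: mem_WD[OF gD])
  have "pole_deg C f = d + g + 1" using f False f0 by (simp add: mem_WD[OF gD])
  then obtain c where c: "f - emb C c * t = 0 \<or> pole_deg C (f - emb C c * t) < d + g + 1"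
    using leading_coeff[of f t] t f0 by (auto simp: has_deg_def)
  have "f - emb C c * t \<in> WD C (d + g + 1) D"
    using vs.subspace_diff[OF subspace_WD f vs.subspace_scale[OF subspace_WD t(1), of c]]
      gD by (simp add: scl_def)
  then have "f - emb C c * t \<in> WD C (d + g) D" using c by (auto simp: mem_WD[OF gD])
  then obtain a where "f - emb C c * t = emb C a * s" using semi_typical_scalar[OF D d s] by blast
  then show ?thesis by (intro exI[of _ a] exI[of _ c]) (simp add: algebra_simps)
qed

end

locale positive_genus_curve = pointed_curve C
  for C :: "('k::field, 'a::field) curve" +
  assumes genus_pos: "1 \<le> int (genus C)"
begin

section \<open>Typical divisors\<close>

text \<open>
  For \<open>s\<close>, \<open>t\<close> of degrees \<open>d + g\<close>, \<open>d + g + 1\<close>, the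
  sum consists of functions of degree at most \<open>d + 3g\<close>, and its dimension is at most
  \<open>2g + 1\<close>.
\<close>

abbreviation gen_space :: "'a \<Rightarrow> 'a \<Rightarrow> 'a set" where
  "gen_space s t \<equiv> s *o W C (2 * g) + t *o W C (2 * g - 1)"

lemma gen_space_subset:
  assumes D: "good C D" and s: "s \<in> WD C (d + g) D" and t: "t \<in> WD C (d + g + 1) D"
  shows "s *o W C (2 * g) \<subseteq> WD C (d + 3 * g) D" "t *o W C (2 * g - 1) \<subseteq> WD C (d + 3 * g) D"
    "gen_space s t \<subseteq> WD C (d + 3 * g) D"
proof -
  show a: "s *o W C (2 * g) \<subseteq> WD C (d + 3 * g) D"
    using WD_mult_W[OF D s, of _ "2 * g"] by (auto simp: elt_set_times_def add.assoc)
  have e: "d + g + 1 + (2 * g - 1) = d + 3 * g" by simp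
  show b: "t *o W C (2 * g - 1) \<subseteq> WD C (d + 3 * g) D"
    using WD_mult_W[OF D t, of _ "2 * g - 1", unfolded e] by (auto simp: elt_set_times_def)
  show "gen_space s t \<subseteq> WD C (d + 3 * g) D"
    using a b vs.subspace_add[OF subspace_WD[OF D]] unfolding set_plus_def by blast
qed

lemma dims_gen:
  assumes D: "good C D" "g \<le> div_deg C D" and d: "div_deg C D = d"
  shows "int (vs.dim (W C (2 * g))) = g + 1" "int (vs.dim (W C (2 * g - 1))) = g"
    "int (vs.dim (WD C (d + 3 * g) D)) = 2 * g + 1"
    "int (vs.dim (W C (d + g - 1))) = d" "int (vs.dim (W C (d + 3 * g))) = d + 2 * g + 1"
  using dim_W_eq[of "2 * g"] dim_W_eq[of "2 * g - 1"] dim_WD_eq[OF D(1), of "d + 3 * g"]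
    dim_W_eq[of "d + g - 1"] dim_W_eq[of "d + 3 * g"] D d genus_pos by auto

lemma dim_sum_le: "vs.subspace A \<Longrightarrow> vs.fin_dim A \<Longrightarrow> vs.subspace B \<Longrightarrow> vs.fin_dim B \<Longrightarrow>
    vs.dim (A + B) \<le> vs.dim A + vs.dim B"
  using vs.dim_sum_Int(2)[of A B] by simp

lemma fin_dim_set_times: "vs.fin_dim V \<Longrightarrow> vs.fin_dim (s *o V)"
proof (cases "s = 0")
  case True
  then have "s *o V \<subseteq> vs.span {}" by (auto simp: elt_set_times_def)
  then show ?thesis unfolding vs.fin_dim_def by (metis finite.emptyI)
qed (rule dim_set_times)

lemma subspace_gen_space: "vs.subspace (gen_space s t)"
  by (intro vs.subspace_plus subspace_set_times subspace_W)

lemma fin_dim_gen_space: "vs.fin_dim (gen_space s t)"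
  by (intro vs.dim_sum_Int(1) subspace_set_times subspace_W fin_dim_set_times fin_dim_W)

lemma WD_Int_W: "good C D \<Longrightarrow> m \<le> n \<Longrightarrow> WD C n D \<inter> W C m = WD C m D"
  unfolding WD_def using W_mono by blast

lemma WD_plus_W_dim:
  assumes D: "good C D" "g \<le> div_deg C D" and d: "div_deg C D = d"
  shows "WD C (d + 3 * g) D + W C (d + g - 1) \<subseteq> W C (d + 3 * g)"
    and "int (vs.dim (WD C (d + 3 * g) D + W C (d + g - 1))) + int (vs.dim (WD C (d + g - 1) D)) = d + 2 * g + 1"
proof -
  have le: "d + g - 1 \<le> d + 3 * g" using genus_pos by simp
  show "WD C (d + 3 * g) D + W C (d + g - 1) \<subseteq> W C (d + 3 * g)"
    using WD_W W_mono[OF le] vs.subspace_add[OF subspace_W] unfolding set_plus_def by blast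
  have "vs.dim (WD C (d + 3 * g) D + W C (d + g - 1)) + vs.dim (WD C (d + 3 * g) D \<inter> W C (d + g - 1)) =
      vs.dim (WD C (d + 3 * g) D) + vs.dim (W C (d + g - 1))"
    by (rule vs.dim_sum_Int(2)[OF subspace_WD[OF D(1)] fin_dim_WD[OF D(1)] subspace_W fin_dim_W])
  then show "int (vs.dim (WD C (d + 3 * g) D + W C (d + g - 1))) + int (vs.dim (WD C (d + g - 1) D)) = d + 2 * g + 1"
    unfolding WD_Int_W[OF D(1) le] using dims_gen[OF D d] by linarith
qed

text \<open>
  The dimensions of \<open>W\<^sup>d\<^sup>+\<^sup>3\<^sup>g\<^sub>D\<close> and
  \<open>W\<^sup>d\<^sup>+\<^sup>g\<^sup>-\<^sup>1\<close> add up to that of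
  \<open>W\<^sup>d\<^sup>+\<^sup>3\<^sup>g\<close>.  So the equation that defines typical divisors says
  that this sum is direct and that its first summand is generated by \<open>s\<close> and
  \<open>t\<close>.
\<close>

lemma typical_alt:
  "typical C D \<longleftrightarrow> semi_typical C D \<and>
    (\<exists>s\<in>WD C (div_deg C D + g) D. \<exists>t\<in>WD C (div_deg C D + g + 1) D.
       gen_space s t = WD C (div_deg C D + 3 * g) D)"
proof
  assume ty: "typical C D"
  define d where "d = div_deg C D"
  from ty obtain s t where D: "good C D" "g \<le> d" and s: "s \<in> WD C (d + g) D" and t: "t \<in> WD C (d + g + 1) D"
    and eq: "gen_space s t + W C (d + g - 1) = W C (d + 3 * g)"
    unfolding typical_def Let_def d_def by blast
  note dm = dims_gen[OF D(1) _ d_def[symmetric]]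
  have gd: "g \<le> div_deg C D" using D by (simp add: d_def)
  note sub = gen_space_subset[OF D(1) s t]
  have "vs.dim (W C (d + 3 * g)) \<le> vs.dim (gen_space s t) + vs.dim (W C (d + g - 1))"
    unfolding eq[symmetric] by (intro dim_sum_le subspace_gen_space fin_dim_gen_space subspace_W fin_dim_W)
  then have "vs.dim (WD C (d + 3 * g) D) \<le> vs.dim (gen_space s t)" using dm[OF gd] by linarith
  then have e: "gen_space s t = WD C (d + 3 * g) D"
    by (intro vs.subspace_eq_of_dim_le subspace_gen_space sub fin_dim_WD D)
  have "int (vs.dim (W C (d + 3 * g))) + int (vs.dim (WD C (d + g - 1) D)) = d + 2 * g + 1"
    using WD_plus_W_dim(2)[OF D(1) gd d_def[symmetric]] unfolding e[symmetric] eq .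
  then have "vs.dim (WD C (d + g - 1) D) = 0" using dm[OF gd] by linarith
  then have "WD C (d + g - 1) D = {0}" by (intro zero_space_of_dim subspace_WD fin_dim_WD D)
  then have "semi_typical C D" using D by (intro semi_typicalI) (auto simp: d_def)
  then show "semi_typical C D \<and>
    (\<exists>s\<in>WD C (div_deg C D + g) D. \<exists>t\<in>WD C (div_deg C D + g + 1) D.
       gen_space s t = WD C (div_deg C D + 3 * g) D)"
    using s t e unfolding d_def by blast
next
  assume "semi_typical C D \<and>
    (\<exists>s\<in>WD C (div_deg C D + g) D. \<exists>t\<in>WD C (div_deg C D + g + 1) D.
       gen_space s t = WD C (div_deg C D + 3 * g) D)"
  then obtain s t where D: "semi_typical C D" and st: "s\<in>WD C (div_deg C D + g) D" "t\<in>WD C (div_deg C D + g + 1) D"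
     and e: "gen_space s t = WD C (div_deg C D + 3 * g) D" by blast
  note sD = semi_typicalD[OF D]
  have "vs.dim (WD C (div_deg C D + g - 1) D) = 0" by (simp only: sD(3) dim_zero_space)
  then have "vs.dim (W C (div_deg C D + 3 * g)) \<le>
      vs.dim (WD C (div_deg C D + 3 * g) D + W C (div_deg C D + g - 1))"
    using WD_plus_W_dim(2)[OF sD(1,2) refl] dims_gen(5)[OF sD(1,2) refl] by linarith
  then have "WD C (div_deg C D + 3 * g) D + W C (div_deg C D + g - 1) = W C (div_deg C D + 3 * g)"
    using WD_plus_W_dim(1)[OF sD(1,2) refl]
    by (intro vs.subspace_eq_of_dim_le vs.subspace_plus subspace_WD subspace_W fin_dim_W sD)
  then show "typical C D" unfolding typical_def Let_def using sD(1,2) st e by metis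
qed

lemma typical_imp_semi_typical: "typical C D \<Longrightarrow> semi_typical C D"
  using typical_alt by blast

text \<open>
  Any other choice of \<open>s\<close> and \<open>t\<close> consists of linear combinations of the given
  ones, and generates a space that is not larger.
\<close>

lemma typical_iff_gen_space:
  assumes D: "semi_typical C D" and d: "div_deg C D = d"
    and s: "s \<in> WD C (d + g) D" "has_deg C s (d + g)"
    and t: "t \<in> WD C (d + g + 1) D" "has_deg C t (d + g + 1)"
  shows "typical C D \<longleftrightarrow> gen_space s t = WD C (d + 3 * g) D"
proof
  assume "typical C D"
  then obtain s' t' where st': "s' \<in> WD C (d + g) D" "t' \<in> WD C (d + g + 1) D"
    "gen_space s' t' = WD C (d + 3 * g) D"
    using typical_alt[of D] d by blast
  obtain c where c: "s' = emb C c * s" using semi_typical_scalar[OF D d s st'(1)] by blast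
  obtain a b where ab: "t' = emb C a * s + emb C b * t" using semi_typical_combination[OF D d s t st'(2)] by blast
  have "gen_space s' t' \<subseteq> gen_space s t"
  proof
    fix z assume "z \<in> gen_space s' t'"
    then obtain v w where vw: "z = s' * v + t' * w" "v \<in> W C (2 * g)" "w \<in> W C (2 * g - 1)"
      by (auto simp: set_plus_def elt_set_times_def)
    have "w \<in> W C (2 * g)" using vw W_mono[of "2 * g - 1" "2 * g"] by auto
    then have "scl C c v + scl C a w \<in> W C (2 * g)" "scl C b w \<in> W C (2 * g - 1)"
      using vw by (auto intro!: vs.subspace_add vs.subspace_scale subspace_W)
    moreover have "z = s * (scl C c v + scl C a w) + t * scl C b w"
      by (simp add: vw(1) c ab scl_def algebra_simps)
    ultimately show "z \<in> gen_space s t" by (auto simp: set_plus_def elt_set_times_def)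
  qed
  then show "gen_space s t = WD C (d + 3 * g) D"
    using gen_space_subset(3)[OF semi_typicalD(1)[OF D] s(1) t(1)] st'(3) by simp
next
  assume "gen_space s t = WD C (d + 3 * g) D"
  then show "typical C D" unfolding typical_alt using D s t d by blast
qed

section \<open>Flipping\<close>

lemma div_leI: "(\<And>P. D P \<le> E P) \<Longrightarrow> (D :: 'a divisor) \<le> E"
  by (rule le_funI)

lemma good_pos: "good C D \<Longrightarrow> 0 \<le> D P"
  unfolding good_def using le_funD[of 0 D P] by simp

lemma goodI: "is_divisor C D \<Longrightarrow> (\<And>P. 0 \<le> D P) \<Longrightarrow> D (infty C) = 0 \<Longrightarrow> good C D"
  unfolding good_def by (simp add: le_funI)

lemma flip_good:
  assumes D: "good C D" and s: "s \<in> WD C n D" "s \<noteq> 0" and A: "affine_div C s = D + A"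
  shows "good C A" "div_deg C A = pole_deg C s - div_deg C D"
proof -
  have e: "A = affine_div C s - D" using A by simp
  have dD: "is_divisor C D" using D by (simp add: good_def)
  have le: "D \<le> affine_div C s" using s mem_WD[OF D] by blast
  show "good C A"
  proof (rule goodI)
    show "is_divisor C A" unfolding e using is_divisor_affine dD by (rule is_divisor_diff)
    show "0 \<le> A P" for P using le_funD[OF le, of P] by (simp add: e)
    show "A (infty C) = 0" using D by (simp add: e affine_div_infty good_def)
  qed
  show "div_deg C A = pole_deg C s - div_deg C D"
    unfolding e div_deg_diff[OF is_divisor_affine dD] deg_affine_div[OF s(2)] ..
qed

text \<open>
  The divisor \<open>A - min(T, A)\<close>, where \<open>div t = D + T\<close>: what remains of the
  condition to vanish on \<open>A\<close> after multiplication by \<open>t\<close>.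
\<close>

definition flip_remainder :: "'a divisor \<Rightarrow> 'a \<Rightarrow> 'a divisor \<Rightarrow> 'a divisor" where
  "flip_remainder D t A = (\<lambda>P. A P - min (affine_div C t P - D P) (A P))"

lemma flip_remainder:
  assumes D: "good C D" and A: "good C A" and t: "t \<in> WD C n D" "t \<noteq> 0"
  shows "good C (flip_remainder D t A)" "flip_remainder D t A \<le> A"
proof -
  have le: "D P \<le> affine_div C t P" for P using t mem_WD[OF D] by (blast dest: le_funD)
  show "flip_remainder D t A \<le> A"
    by (rule div_leI) (use le good_pos[OF A] in \<open>auto simp: flip_remainder_def\<close>)
  show "good C (flip_remainder D t A)"
  proof (rule goodI)
    show "is_divisor C (flip_remainder D t A)"
    proof (rule is_divisorI[of "{P. A P \<noteq> 0}"])
      have "A P = 0 \<Longrightarrow> flip_remainder D t A P = 0" for P using le[of P] by (simp add: flip_remainder_def)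
      then show "{P. flip_remainder D t A P \<noteq> 0} \<subseteq> {P. A P \<noteq> 0}" by blast
      then show "{P. flip_remainder D t A P \<noteq> 0} \<subseteq> points C" using A unfolding good_def is_divisor_def by blast
      show "finite {P. A P \<noteq> 0}" using A by (simp add: good_def is_divisor_def)
    qed
    show "0 \<le> flip_remainder D t A P" for P by (simp add: flip_remainder_def)
    show "flip_remainder D t A (infty C) = 0"
      using A D by (simp add: flip_remainder_def good_def affine_div_infty)
  qed
qed

text \<open>
  The quotient \<open>l t / s\<close> has affine divisor \<open>div l + T - A\<close> and degree one more
  than \<open>l\<close>.
\<close>

lemma flip_divisible:
  assumes D: "good C D"
    and s: "s \<in> WD C n D" "has_deg C s n" and t: "t \<in> WD C (n + 1) D" "has_deg C t (n + 1)"
    and A: "affine_div C s = D + A" and l: "l \<in> W C N"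
  shows "l * t \<in> s *o W C (N + 1) \<longleftrightarrow> l \<in> WD C N (flip_remainder D t A)"
proof -
  have s0: "s \<noteq> 0" "pole_deg C s = n" and t0: "t \<noteq> 0" "pole_deg C t = n + 1"
    using s t by (auto simp: has_deg_def)
  note gA = flip_good(1)[OF D s(1) s0(1) A]
  note gA' = flip_remainder(1)[OF D gA t(1) t0(1)]
  show ?thesis
  proof (cases "l = 0")
    case True
    have "0 \<in> W C (N + 1)" by (simp add: mem_W)
    then show ?thesis using True by (auto simp: mem_WD[OF gA'] elt_set_times_def)
  next
    case False
    have l0: "0 \<le> affine_div C l P" for P
    proof -
      have "0 \<le> affine_div C l" using l False mem_W by blast
      then show ?thesis using le_funD[of 0 _ P] by fastforce
    qed
    define m where "m = l * t / s"
    have m: "m \<noteq> 0" "l * t = s * m" using False t0 s0 by (auto simp: m_def)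
    have am: "affine_div C m P = affine_div C l P + affine_div C t P - D P - A P" for P
      unfolding m_def using False t0 s0 A by (simp add: affine_div_divide affine_div_mult)
    have pm: "pole_deg C m = pole_deg C l + 1"
      unfolding m_def using False t0 s0 by (simp add: pole_deg_divide pole_deg_mult)
    have "l * t \<in> s *o W C (N + 1) \<longleftrightarrow> m \<in> W C (N + 1)"
      using m s0 by (auto simp: elt_set_times_def)
    also have "\<dots> \<longleftrightarrow> 0 \<le> affine_div C m" using m pm l False by (simp add: mem_W)
    also have "\<dots> \<longleftrightarrow> (\<forall>P. 0 \<le> affine_div C m P)" by (simp add: le_fun_def)
    also have "\<dots> \<longleftrightarrow> (\<forall>P. flip_remainder D t A P \<le> affine_div C l P)"
    proof (rule all_cong1)
      fix P
      show "0 \<le> affine_div C m P \<longleftrightarrow> flip_remainder D t A P \<le> affine_div C l P"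
        using l0[of P] unfolding am flip_remainder_def by linarith
    qed
    also have "\<dots> \<longleftrightarrow> l \<in> WD C N (flip_remainder D t A)"
      using l False by (auto simp: mem_WD[OF gA'] mem_W le_fun_def)
    finally show ?thesis .
  qed
qed

text \<open>
  A multiple \<open>s * m\<close> and \<open>l * t\<close> lie in \<open>I\<^sub>D\<close>, so an error term of degree below \<open>d + g\<close> does as
  well and vanishes for semi-typical \<open>D\<close>.
\<close>

lemma flip_congruence:
  assumes D: "semi_typical C D" and d: "div_deg C D = d"
    and s: "s \<in> WD C n D" and t: "t \<in> WD C m D" and l: "l \<in> W C N"
  shows "l * t \<in> s *o W C k + W C (d + g - 1) \<longleftrightarrow> l * t \<in> s *o W C k"
proof
  note gD = semi_typicalD(1)[OF D]
  assume "l * t \<in> s *o W C k + W C (d + g - 1)"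
  then obtain v w where vw: "l * t = s * v + w" "v \<in> W C k" "w \<in> W C (d + g - 1)"
    by (auto simp: set_plus_def elt_set_times_def)
  define M where "M = max (n + k) (m + N)"
  have "s * v \<in> WD C M D" "t * l \<in> WD C M D"
    using WD_mult_W[OF gD s vw(2)] WD_mult_W[OF gD t l] WD_mono[of "n + k" M D] WD_mono[of "m + N" M D]
    by (auto simp: M_def)
  moreover have "w = t * l - s * v" using vw(1) by (simp add: mult.commute)
  ultimately have "w \<in> WD C M D" using vs.subspace_diff[OF subspace_WD[OF gD]] by blast
  then have "w \<in> WD C (d + g - 1) D" using vw(3) unfolding WD_def by blast
  then have "w = 0" using semi_typicalD(3)[OF D] d by auto
  then show "l * t \<in> s *o W C k" using vw by (auto simp: elt_set_times_def)
next
  have "0 \<in> W C (d + g - 1)" by (simp add: mem_W)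
  moreover assume "l * t \<in> s *o W C k"
  ultimately show "l * t \<in> s *o W C k + W C (d + g - 1)" unfolding set_plus_def by force
qed

text \<open>
  \<open>s W\<^sup>2\<^sup>g\<close> and \<open>t W\<^sup>2\<^sup>g\<^sup>-\<^sup>1\<close> have
  dimensions \<open>g + 1\<close> and \<open>g\<close>, and
  \<open>W\<^sup>d\<^sup>+\<^sup>3\<^sup>g\<^sub>D\<close> has dimension \<open>2g + 1\<close>; so they
  generate it iff they intersect in \<open>0\<close>.  The intersection consists of the
  \<open>l t\<close> that are divisible by \<open>s\<close>.
\<close>

lemma typical_iff_flip_remainder:
  assumes D: "semi_typical C D" and d: "div_deg C D = d"
    and s: "s \<in> WD C (d + g) D" "has_deg C s (d + g)"
    and t: "t \<in> WD C (d + g + 1) D" "has_deg C t (d + g + 1)"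
    and A: "affine_div C s = D + A"
  shows "typical C D \<longleftrightarrow> WD C (2 * g - 1) (flip_remainder D t A) = {0}"
proof -
  note gD = semi_typicalD[OF D]
  have s0: "s \<noteq> 0" and t0: "t \<noteq> 0" using s t by (auto simp: has_deg_def)
  define R where "R = flip_remainder D t A"
  have gR: "good C R"
    unfolding R_def using flip_remainder(1)[OF gD(1) flip_good(1)[OF gD(1) s(1) s0 A] t(1) t0] .
  let ?X = "s *o W C (2 * g)" and ?Y = "t *o W C (2 * g - 1)"
  note dm = dims_gen[OF gD(1,2) d]
  have dX: "int (vs.dim ?X) = g + 1" "int (vs.dim ?Y) = g"
    using dim_set_times(2)[OF s0 fin_dim_W] dim_set_times(2)[OF t0 fin_dim_W] dm by simp_all
  have sum: "vs.dim (gen_space s t) + vs.dim (?X \<inter> ?Y) = vs.dim ?X + vs.dim ?Y"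
    by (intro vs.dim_sum_Int(2) subspace_set_times subspace_W fin_dim_set_times fin_dim_W)
  have sI: "vs.subspace (?X \<inter> ?Y)" by (intro vs.subspace_inter subspace_set_times subspace_W)
  have fI: "vs.fin_dim (?X \<inter> ?Y)" by (rule vs.fin_dim_mono[OF fin_dim_set_times[OF fin_dim_W]]) blast
  have "typical C D \<longleftrightarrow> gen_space s t = WD C (d + 3 * g) D"
    by (rule typical_iff_gen_space[OF D d s t])
  also have "\<dots> \<longleftrightarrow> vs.dim (?X \<inter> ?Y) = 0"
  proof
    assume "gen_space s t = WD C (d + 3 * g) D"
    then show "vs.dim (?X \<inter> ?Y) = 0" using sum dm dX by simp
  next
    assume "vs.dim (?X \<inter> ?Y) = 0"
    then have "vs.dim (WD C (d + 3 * g) D) \<le> vs.dim (gen_space s t)" using sum dm dX by linarith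
    then show "gen_space s t = WD C (d + 3 * g) D"
      by (intro vs.subspace_eq_of_dim_le subspace_gen_space gen_space_subset(3)[OF gD(1) s(1) t(1)] fin_dim_WD gD(1))
  qed
  also have "\<dots> \<longleftrightarrow> ?X \<inter> ?Y = {0}"
    using zero_space_of_dim[OF sI fI] dim_zero_space by auto
  also have "\<dots> \<longleftrightarrow> WD C (2 * g - 1) R = {0}"
  proof -
    have div: "l * t \<in> ?X \<longleftrightarrow> l \<in> WD C (2 * g - 1) R" if "l \<in> W C (2 * g - 1)" for l
      using flip_divisible[OF gD(1) s t A that] by (simp add: R_def)
    have "?X \<inter> ?Y = t *o WD C (2 * g - 1) R"
    proof
      show "?X \<inter> ?Y \<subseteq> t *o WD C (2 * g - 1) R"
      proof
        fix z assume z: "z \<in> ?X \<inter> ?Y"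
        then obtain l where l: "z = t * l" "l \<in> W C (2 * g - 1)" by (auto simp: elt_set_times_def)
        have "l * t \<in> ?X" using z l(1) by (simp add: mult.commute)
        then show "z \<in> t *o WD C (2 * g - 1) R" using div[OF l(2)] l(1) by (auto simp: elt_set_times_def)
      qed
      show "t *o WD C (2 * g - 1) R \<subseteq> ?X \<inter> ?Y"
      proof
        fix z assume "z \<in> t *o WD C (2 * g - 1) R"
        then obtain l where l: "z = t * l" "l \<in> WD C (2 * g - 1) R" by (auto simp: elt_set_times_def)
        then have "l \<in> W C (2 * g - 1)" using WD_W by blast
        moreover from this have "t * l \<in> ?X" using div[of l] l(2) by (simp add: mult.commute)
        ultimately show "z \<in> ?X \<inter> ?Y" using l(1) by (auto simp: elt_set_times_def)
      qed
    qed
    also have "\<dots> = {0} \<longleftrightarrow> WD C (2 * g - 1) R = {0}"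
    proof
      have z: "0 \<in> WD C (2 * g - 1) R" by (simp add: mem_WD[OF gR])
      assume "t *o WD C (2 * g - 1) R = {0}"
      then have "l = 0" if "l \<in> WD C (2 * g - 1) R" for l
        using set_times_intro2[OF that, of t] t0 by simp
      then show "WD C (2 * g - 1) R = {0}" using z by blast
    qed (auto simp: elt_set_times_def)
    finally show ?thesis .
  qed
  finally show ?thesis by (simp add: R_def)
qed

lemma divisor_eq_of_deg_le:
  assumes "good C R" "good C A" "R \<le> A" "div_deg C A \<le> div_deg C R" shows "R = A"
proof -
  have "is_divisor C (A - R)" "div_deg C (A - R) = div_deg C A - div_deg C R"
    using assms by (auto simp: good_def is_divisor_diff div_deg_diff)
  moreover have "0 \<le> A - R" using assms(3) by simp
  ultimately have "A - R = 0" using assms(4) by (intro effective_deg_0) auto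
  then show ?thesis by simp
qed

text \<open>
  By Riemann's inequality, \<open>W\<^sup>2\<^sup>g\<^sup>-\<^sup>1\<close> vanishes only for divisors of
  degree at least \<open>g = deg A\<close>, so nothing is removed from \<open>A\<close>.
\<close>

lemma flip_of_typical:
  assumes ty: "typical C D" and d: "div_deg C D = d"
    and s: "s \<in> WD C (d + g) D" "has_deg C s (d + g)"
    and t: "t \<in> WD C (d + g + 1) D" "has_deg C t (d + g + 1)"
    and A: "affine_div C s = D + A"
  shows "flip_remainder D t A = A" "semi_typical C A" "div_deg C A = g"
    "affine_div C t P = D P \<or> A P = 0"
proof -
  note D = typical_imp_semi_typical[OF ty]
  note gD = semi_typicalD[OF D]
  have s0: "s \<noteq> 0" and t0: "t \<noteq> 0" using s t by (auto simp: has_deg_def)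
  note gA = flip_good[OF gD(1) s(1) s0 A]
  show dA: "div_deg C A = g" using gA(2) s d by (simp add: has_deg_def)
  note R = flip_remainder[OF gD(1) gA(1) t(1) t0]
  have 0: "WD C (2 * g - 1) (flip_remainder D t A) = {0}"
    using typical_iff_flip_remainder[OF D d s t A] ty by blast
  have "g - div_deg C (flip_remainder D t A) \<le> 0"
    using dim_WD_ge[OF R(1), of "2 * g - 1"] unfolding 0 dim_zero_space by simp
  then show e: "flip_remainder D t A = A" using dA by (intro divisor_eq_of_deg_le R gA) simp
  show "semi_typical C A" using gA(1) dA 0 unfolding e by (intro semi_typicalI) auto
  show "affine_div C t P = D P \<or> A P = 0"
    using fun_cong[OF e, of P] by (auto simp: flip_remainder_def min_def split: if_splits)
qed

section \<open>Typicality depends only on the divisor class\<close>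

lemma WD_shift:
  assumes D: "good C D" and D': "good C D'" and f: "f \<noteq> 0" "D' = D + affine_div C f"
  shows "f *o WD C N D = WD C (N + div_deg C D' - div_deg C D) D'"
proof -
  have df: "pole_deg C f = div_deg C D' - div_deg C D"
    using D is_divisor_affine[of f] by (simp only: f(2)) (simp add: good_def div_deg_add deg_affine_div f(1))
  have "f * h \<in> WD C (N + div_deg C D' - div_deg C D) D' \<longleftrightarrow> h \<in> WD C N D" for h
  proof (cases "h = 0")
    case False
    have "D' \<le> affine_div C (f * h) \<longleftrightarrow> D \<le> affine_div C h"
      unfolding affine_div_mult[OF f(1) False] f(2) by (simp only: add.commute[of D] add_le_cancel_left)
    moreover have "pole_deg C (f * h) \<le> N + div_deg C D' - div_deg C D \<longleftrightarrow> pole_deg C h \<le> N"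
      unfolding pole_deg_mult[OF f(1) False] df by linarith
    ultimately show ?thesis using False f(1) unfolding mem_WD[OF D] mem_WD[OF D'] by simp
  qed (simp add: mem_WD[OF D] mem_WD[OF D'])
  note m = this
  show ?thesis
  proof
    show "f *o WD C N D \<subseteq> WD C (N + div_deg C D' - div_deg C D) D'" using m by (auto simp: elt_set_times_def)
    show "WD C (N + div_deg C D' - div_deg C D) D' \<subseteq> f *o WD C N D"
    proof
      fix z assume "z \<in> WD C (N + div_deg C D' - div_deg C D) D'"
      then have "z / f \<in> WD C N D" using m[of "z / f"] f(1) by simp
      then have "f * (z / f) \<in> f *o WD C N D" by (rule set_times_intro2)
      then show "z \<in> f *o WD C N D" using f(1) by simp
    qed
  qed
qed

text \<open>
  Multiplication by \<open>f\<close> carries every \<open>W\<^sup>N\<^sub>D\<close> to the corresponding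
  space for \<open>D'\<close>, with \<open>N\<close> shifted by the difference of the degrees.
\<close>

lemma typical_class_invariant:
  assumes ty: "typical C D" and D': "good C D'" "g \<le> div_deg C D'"
    and f: "f \<noteq> 0" "D' = D + affine_div C f"
  shows "typical C D'"
proof -
  note D = typical_imp_semi_typical[OF ty]
  note gD = semi_typicalD[OF D]
  define d d' where "d = div_deg C D" and "d' = div_deg C D'"
  have sh: "f *o WD C (d + k) D = WD C (d' + k) D'" for k
    using WD_shift[OF gD(1) D'(1) f, of "d + k"] by (simp add: d_def d'_def algebra_simps)
  have "f *o WD C (d + (g - 1)) D = {0}" using gD(3) by (simp add: d_def elt_set_times_def add_diff_eq)
  then have "WD C (d' + g - 1) D' = {0}" unfolding sh by (simp add: add_diff_eq)
  then have semi: "semi_typical C D'" using D' by (intro semi_typicalI) (auto simp: d'_def)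
  obtain s t where st: "s \<in> WD C (d + g) D" "t \<in> WD C (d + (g + 1)) D"
    "gen_space s t = WD C (d + 3 * g) D"
    using ty unfolding typical_alt d_def[symmetric] add.assoc by blast
  have s': "f * s \<in> WD C (d' + g) D'" using st(1) unfolding sh[symmetric] by (auto simp: elt_set_times_def)
  have t': "f * t \<in> WD C (d' + (g + 1)) D'" using st(2) unfolding sh[symmetric] by (auto simp: elt_set_times_def)
  have "gen_space (f * s) (f * t) = f *o gen_space s t"
    by (simp only: set_times_plus_distrib set_times_rearrange2 elt_set_times_def set_plus_def)
      (force simp: algebra_simps)
  then have "gen_space (f * s) (f * t) = WD C (d' + 3 * g) D'" unfolding st(3) sh .
  then show ?thesis unfolding typical_alt d'_def[symmetric] add.assoc using semi s' t' by blast
qed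

section \<open>Echelon bases\<close>

lemma subspace_pole_le: "vs.subspace {f. f = 0 \<or> pole_deg C f \<le> n}"
proof -
  have "{f. f = 0 \<or> pole_deg C f \<le> n} = LS {infty C} (\<lambda>_. n)"
    by (auto simp: LS_def vge_def pole_deg_def)
  then show ?thesis using subspace_LS[of "{infty C}"] infty_point by simp
qed

lemma echelon_snoc:
  assumes bs: "echelon_basis C V' bs" and h: "h \<noteq> 0" "h \<notin> V'"
    and deg: "\<And>f. f \<in> V' \<Longrightarrow> f \<noteq> 0 \<Longrightarrow> pole_deg C f < pole_deg C h"
    and V: "V = vs.span (insert h V')"
  shows "echelon_basis C V (bs @ [h])"
proof -
  have sp: "vs.span (set bs) = V'" and i: "vs.independent (set bs)" using bs by (auto simp: echelon_basis_def)
  have "set bs \<subseteq> V'" using sp vs.span_superset by blast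
  then have "pole_deg C b < pole_deg C h" if "b \<in> set bs" for b
    using deg[of b] that bs by (auto simp: echelon_basis_def)
  moreover have "vs.independent (insert h (set bs))"
    using h sp by (intro vs.independent_insertI i) simp
  moreover have "vs.span (insert h (set bs)) = V"
    unfolding V using sp vs.span_insert[of h "set bs"] vs.span_insert[of h V'] by (metis vs.span_span)
  ultimately show ?thesis using bs h by (auto simp: echelon_basis_def sorted_wrt_append)
qed

text \<open>
  Split off an element of largest degree; the elements of smaller degree form a subspace of codimension
  \<open>1\<close>.
\<close>

lemma echelon_basis_exists:
  assumes "vs.subspace V" "V \<subseteq> W C N" shows "\<exists>bs. echelon_basis C V bs"
  using assms
proof (induction "vs.dim V" arbitrary: V rule: less_induct)
  case less
  note V = less.prems
  have fV: "vs.fin_dim V" by (rule vs.fin_dim_mono[OF fin_dim_W V(2)])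
  show ?case
  proof (cases "V = {0}")
    case True
    then show ?thesis by (intro exI[of _ "[]"]) (simp add: echelon_basis_def vs.independent_empty)
  next
    case False
    then have ex: "\<exists>f. f \<in> V \<and> f \<noteq> 0" using vs.subspace_0[OF V(1)] by blast
    obtain h where h: "h \<in> V \<and> h \<noteq> 0"
      "\<And>f. f \<in> V \<and> f \<noteq> 0 \<Longrightarrow> nat (N - pole_deg C h) \<le> nat (N - pole_deg C f)"
      using ex_has_least_nat[of "\<lambda>f. f \<in> V \<and> f \<noteq> 0" _ "\<lambda>f. nat (N - pole_deg C f)"] ex by blast
    have top: "pole_deg C f \<le> pole_deg C h" if "f \<in> V" "f \<noteq> 0" for f
    proof -
      have "pole_deg C f \<le> N" "pole_deg C h \<le> N" using V(2) that h(1) mem_W by blast+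
      then show ?thesis using h(2)[of f] that by linarith
    qed
    define V' where "V' = V \<inter> {f. f = 0 \<or> pole_deg C f \<le> pole_deg C h - 1}"
    have sV': "vs.subspace V'" unfolding V'_def by (intro vs.subspace_inter V subspace_pole_le)
    have hV': "h \<notin> V'" using h by (simp add: V'_def)
    have lt: "vs.dim V' < vs.dim V"
    proof (rule ccontr)
      assume "\<not> ?thesis"
      then have "V' = V" using fV by (intro vs.subspace_eq_of_dim_le sV') (auto simp: V'_def)
      then show False using h hV' by blast
    qed
    have V'W: "V' \<subseteq> W C N" using V(2) by (auto simp: V'_def)
    obtain bs where bs: "echelon_basis C V' bs" using less.hyps[OF lt sV' V'W] by blast
    have "V = vs.span (insert h V')"
    proof
      show "vs.span (insert h V') \<subseteq> V" using h V by (intro vs.span_minimal) (auto simp: V'_def)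
      show "V \<subseteq> vs.span (insert h V')"
      proof
        fix f assume f: "f \<in> V"
        show "f \<in> vs.span (insert h V')"
        proof (cases "f = 0 \<or> pole_deg C f < pole_deg C h")
          case True
          then have "f \<in> V'" using f by (auto simp: V'_def)
          then show ?thesis by (intro vs.span_base) simp
        next
          case False
          then have "f \<noteq> 0" "pole_deg C f = pole_deg C h" using top[OF f] by auto
          then obtain c where c: "f - emb C c * h = 0 \<or> pole_deg C (f - emb C c * h) < pole_deg C h"
            using leading_coeff[of f h] h by auto
          have "f - scl C c h \<in> V" using f h V by (intro vs.subspace_diff vs.subspace_scale) auto
          then have "f - scl C c h \<in> V'" using c by (auto simp: V'_def scl_def)
          then have "(f - scl C c h) + scl C c h \<in> vs.span (insert h V')"
            by (intro vs.span_add vs.span_scale vs.span_base) auto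
          then show ?thesis by simp
        qed
      qed
    qed
    then have "echelon_basis C V (bs @ [h])"
      using h hV' by (intro echelon_snoc[OF bs]) (auto simp: V'_def)
    then show ?thesis by blast
  qed
qed

lemma sorted_pole_distinct:
  "sorted_wrt (\<lambda>a b. pole_deg C a < pole_deg C b) bs \<Longrightarrow> distinct bs"
  by (induction bs) auto

lemma echelon_length:
  assumes "echelon_basis C V bs" shows "length bs = vs.dim V"
proof -
  have "distinct bs" using assms sorted_pole_distinct by (auto simp: echelon_basis_def)
  then have "length bs = card (set bs)" by (simp add: distinct_card)
  also have "\<dots> = vs.dim V"
    using assms vs.dim_span_eq_card_independent[of "set bs"] by (simp add: echelon_basis_def)
  finally show ?thesis .
qed

text \<open>
  The leading term of a linear combination cannot cancel, as the degrees are distinct.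
\<close>

lemma span_echelon_truncate:
  assumes "sorted_wrt (\<lambda>a b. pole_deg C a < pole_deg C b) bs" "0 \<notin> set bs"
    and "f \<in> vs.span (set bs)" "f = 0 \<or> pole_deg C f \<le> m"
  shows "f \<in> vs.span (set (filter (\<lambda>b. pole_deg C b \<le> m) bs))"
  using assms
proof (induction bs arbitrary: f rule: rev_induct)
  case (snoc h bs)
  have h: "h \<noteq> 0" "\<And>b. b \<in> set bs \<Longrightarrow> pole_deg C b < pole_deg C h"
    using snoc.prems by (auto simp: sorted_wrt_append)
  obtain c where c: "f - scl C c h \<in> vs.span (set bs)"
    using snoc.prems(3) vs.span_breakdown_eq[of f h "set bs"] by auto
  note IH = snoc.IH[of "f - scl C c h"] snoc.IH[of f]
  have sub: "set (filter (\<lambda>b. pole_deg C b \<le> m) bs) \<subseteq> set (filter (\<lambda>b. pole_deg C b \<le> m) (bs @ [h]))"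
    by auto
  show ?case
  proof (cases "pole_deg C h \<le> m")
    case True
    have "f \<in> {f. f = 0 \<or> pole_deg C f \<le> m}" "h \<in> {f. f = 0 \<or> pole_deg C f \<le> m}"
      using snoc.prems(4) True by auto
    then have "f - scl C c h \<in> {f. f = 0 \<or> pole_deg C f \<le> m}"
      by (intro vs.subspace_diff vs.subspace_scale subspace_pole_le)
    then have "f - scl C c h \<in> vs.span (set (filter (\<lambda>b. pole_deg C b \<le> m) bs))"
      using IH(1) c snoc.prems by (auto simp: sorted_wrt_append)
    then have "f - scl C c h \<in> vs.span (set (filter (\<lambda>b. pole_deg C b \<le> m) (bs @ [h])))"
      using vs.span_mono[OF sub] by blast
    moreover have "scl C c h \<in> vs.span (set (filter (\<lambda>b. pole_deg C b \<le> m) (bs @ [h])))"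
      using True by (intro vs.span_scale vs.span_base) simp
    ultimately have "(f - scl C c h) + scl C c h \<in> vs.span (set (filter (\<lambda>b. pole_deg C b \<le> m) (bs @ [h])))"
      by (rule vs.span_add)
    then show ?thesis by simp
  next
    case False
    let ?S = "{f. f = 0 \<or> pole_deg C f \<le> pole_deg C h - 1}"
    have "vs.span (set bs) \<subseteq> ?S" using h(2) by (intro vs.span_minimal subspace_pole_le) force
    then have 1: "f - scl C c h \<in> ?S" using c by blast
    have 2: "f \<in> ?S" using snoc.prems(4) False by auto
    have "f - (f - scl C c h) \<in> ?S" using 2 1 by (rule vs.subspace_diff[OF subspace_pole_le])
    then have "emb C c * h = 0 \<or> pole_deg C (emb C c * h) \<le> pole_deg C h - 1" by (simp add: scl_def)
    then have "c = 0" using h(1) pole_deg_const_mult[of c h] by (cases "c = 0") simp_all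
    then have "f \<in> vs.span (set bs)" using c by simp
    then show ?thesis using IH(2) snoc.prems False by (auto simp: sorted_wrt_append)
  qed
qed simp

lemma filter_sorted_take:
  "sorted_wrt (\<lambda>a b. q a < q b) xs \<Longrightarrow>
    filter (\<lambda>x. q x \<le> (m::int)) xs = take (length (filter (\<lambda>x. q x \<le> m) xs)) xs"
proof (induction xs)
  case (Cons x xs)
  show ?case
  proof (cases "q x \<le> m")
    case False
    then have "filter (\<lambda>x. q x \<le> m) xs = []" using Cons.prems by (auto simp: filter_empty_conv)
    then show ?thesis using False by simp
  qed (use Cons in simp)
qed simp

lemma echelon_truncate:
  assumes D: "good C D" and b: "echelon_basis C (WD C n D) bs" and m: "m \<le> n"
  shows "echelon_basis C (WD C m D) (take (vs.dim (WD C m D)) bs)"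
proof -
  let ?F = "filter (\<lambda>b. pole_deg C b \<le> m) bs"
  have so: "sorted_wrt (\<lambda>a b. pole_deg C a < pole_deg C b) bs" and nz: "0 \<notin> set bs"
    and ind: "vs.independent (set bs)" and sp: "vs.span (set bs) = WD C n D"
    using b by (auto simp: echelon_basis_def)
  have "vs.span (set ?F) = WD C m D"
  proof
    have "set bs \<subseteq> WD C n D" using sp vs.span_superset by blast
    then have "set ?F \<subseteq> WD C m D" using mem_WD[OF D] by auto
    then show "vs.span (set ?F) \<subseteq> WD C m D" by (rule vs.span_minimal[OF _ subspace_WD[OF D]])
    show "WD C m D \<subseteq> vs.span (set ?F)"
    proof
      fix f assume f: "f \<in> WD C m D"
      then have "f \<in> vs.span (set bs)" using sp WD_mono[OF m] by blast
      then show "f \<in> vs.span (set ?F)"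
        using f mem_WD[OF D] by (intro span_echelon_truncate[OF so nz]) auto
    qed
  qed
  moreover have "vs.independent (set ?F)" by (rule vs.independent_mono[OF ind]) auto
  ultimately have "echelon_basis C (WD C m D) ?F"
    unfolding echelon_basis_def using so nz by (auto intro: sorted_wrt_filter)
  moreover from echelon_length[OF this] have "?F = take (vs.dim (WD C m D)) bs"
    using filter_sorted_take[OF so, of m] by simp
  ultimately show ?thesis by simp
qed

lemma echelon_pair:
  assumes D: "semi_typical C D" and d: "div_deg C D = d"
    and s: "s \<in> WD C (d + g) D" "has_deg C s (d + g)"
    and t: "t \<in> WD C (d + g + 1) D" "has_deg C t (d + g + 1)"
  shows "echelon_basis C (WD C (d + g + 1) D) [s, t]"
proof -
  note gD = semi_typicalD(1)[OF D]
  have st: "s \<noteq> 0" "t \<noteq> 0" "pole_deg C s = d + g" "pole_deg C t = d + g + 1"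
    using s t by (auto simp: has_deg_def)
  have ts: "t \<notin> vs.span {s}"
  proof
    assume "t \<in> vs.span {s}"
    then obtain c where "t = emb C c * s" by (auto simp: vs.span_singleton scl_def)
    then show False using st pole_deg_const_mult[of c s] by (cases "c = 0") auto
  qed
  have "vs.independent {t, s}" using ts st by (intro vs.independent_insertI vs.independent_empty) simp_all
  then have ind: "vs.independent {s, t}" by (simp add: insert_commute)
  have "s \<in> WD C (d + g + 1) D" using s(1) WD_mono[of "d + g" "d + g + 1" D] by auto
  then have "vs.span {s, t} \<subseteq> WD C (d + g + 1) D"
    using t by (intro vs.span_minimal subspace_WD gD) auto
  moreover have "WD C (d + g + 1) D \<subseteq> vs.span {s, t}"
  proof
    fix f assume "f \<in> WD C (d + g + 1) D"
    then obtain a b where f: "f = emb C a * s + emb C b * t" using semi_typical_combination[OF D d s t] by blast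
    have "scl C a s + scl C b t \<in> vs.span {s, t}" by (intro vs.span_add vs.span_scale vs.span_base) auto
    then show "f \<in> vs.span {s, t}" by (simp add: f scl_def)
  qed
  ultimately show ?thesis using st ind by (auto simp: echelon_basis_def)
qed

lemma echelon_pair_of_semi_typical:
  assumes D: "semi_typical C D" and d: "div_deg C D = d" and b: "echelon_basis C (WD C (d + g + 1) D) b"
  shows "\<exists>s t. b = [s, t] \<and> s \<in> WD C (d + g) D \<and> has_deg C s (d + g) \<and>
    t \<in> WD C (d + g + 1) D \<and> has_deg C t (d + g + 1)"
proof -
  note gD = semi_typicalD(1)[OF D]
  have "length b = 2" using echelon_length[OF b] semi_typical_dims(2)[OF D d] by simp
  then obtain s t where st: "b = [s, t]" by (auto simp: length_Suc_conv numeral_2_eq_2)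
  have nz: "s \<noteq> 0" "t \<noteq> 0" "pole_deg C s < pole_deg C t" using b st by (auto simp: echelon_basis_def)
  have "vs.span {s, t} = WD C (d + g + 1) D" using b st by (simp add: echelon_basis_def)
  then have mem: "s \<in> WD C (d + g + 1) D" "t \<in> WD C (d + g + 1) D" using vs.span_superset[of "{s, t}"] by auto
  have "d + g \<le> pole_deg C s" using deg_ge_of_semi_typical[OF D mem(1) nz(1)] d by simp
  moreover have "pole_deg C t \<le> d + g + 1" using mem(2) nz by (simp add: mem_WD[OF gD])
  ultimately have "pole_deg C s = d + g" "pole_deg C t = d + g + 1" using nz(3) by simp_all
  moreover from this have "s \<in> WD C (d + g) D" using mem(1) by (simp add: mem_WD[OF gD])
  ultimately show ?thesis using st nz mem by (auto simp: has_deg_def)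
qed

lemma basis_or_fail_exists:
  assumes "vs.subspace V" "V \<subseteq> W C N" shows "\<exists>r. basis_or_fail C V V0 r"
  using echelon_basis_exists[OF assms] by (cases "V0 = {0}") (auto simp: basis_or_fail_def)

section \<open>The procedures\<close>

lemma describes_iff:
  "describes C F G D \<longleftrightarrow> semi_typical C D \<and> div_deg C D = g \<and>
     F \<in> WD C (g + g) D \<and> has_deg C F (g + g) \<and> G \<in> WD C (g + g + 1) D \<and> has_deg C G (g + g + 1)"
  unfolding describes_def Let_def mult_2 ..

text \<open>
  The procedure computes \<open>W\<^sup>2\<^sup>g\<^sup>+\<^sup>1\<close> of the flip remainder, and
  fails iff the remainder has nonzero functions of degree at most \<open>2g - 1\<close>.
\<close>

lemma flip_run_iff:
  assumes D: "semi_typical C D" and d: "div_deg C D = d"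
    and s: "s \<in> WD C (d + g) D" "has_deg C s (d + g)"
    and t: "t \<in> WD C (d + g + 1) D" "has_deg C t (d + g + 1)"
    and A: "affine_div C s = D + A"
  shows "flip_run C (2 * g + 1) d s t r \<longleftrightarrow>
    (if typical C D then \<exists>b. r = Some b \<and> echelon_basis C (WD C (g + g + 1) A) b else r = None)"
proof -
  note gD = semi_typicalD(1)[OF D]
  have s0: "s \<noteq> 0" and t0: "t \<noteq> 0" using s t by (auto simp: has_deg_def)
  note gR = flip_remainder(1)[OF gD flip_good(1)[OF gD s(1) s0 A] t(1) t0]
  let ?N = "2 * g + 1"
  have "{l \<in> W C ?N. l * t \<in> s *o W C (?N + 1) + W C (d + g - 1)} = WD C ?N (flip_remainder D t A)"
    using flip_congruence[OF D d s(1) t(1)] flip_divisible[OF gD s t A] WD_W by blast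
  moreover have "WD C ?N (flip_remainder D t A) \<inter> W C (2 * g - 1) = WD C (2 * g - 1) (flip_remainder D t A)"
    by (rule WD_Int_W[OF gR]) simp
  ultimately have "flip_run C ?N d s t r \<longleftrightarrow>
      basis_or_fail C (WD C ?N (flip_remainder D t A)) (WD C (2 * g - 1) (flip_remainder D t A)) r"
    unfolding flip_run_def Let_def by (simp only:)
  also have "\<dots> \<longleftrightarrow> (if typical C D then \<exists>b. r = Some b \<and> echelon_basis C (WD C (g + g + 1) A) b else r = None)"
  proof (cases "typical C D")
    case True
    then show ?thesis
      using typical_iff_flip_remainder[OF D d s t A] flip_of_typical(1)[OF True d s t A]
      unfolding basis_or_fail_def mult_2 by simp
  next
    case False
    then show ?thesis
      using typical_iff_flip_remainder[OF D d s t A] unfolding basis_or_fail_def by simp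
  qed
  finally show ?thesis .
qed

lemma flip_run_exists: "\<exists>r. flip_run C N d s t r"
proof -
  let ?V = "{l \<in> W C N. l * t \<in> s *o W C (N + 1) + W C (d + g - 1)}"
  have X: "vs.subspace (s *o W C (N + 1) + W C (d + g - 1))"
    by (intro vs.subspace_plus subspace_set_times subspace_W)
  have "vs.subspace ?V"
  proof (rule vs.subspaceI)
    show "0 \<in> ?V" using vs.subspace_0[OF X] by (simp add: mem_W)
    show "x + y \<in> ?V" if "x \<in> ?V" "y \<in> ?V" for x y
      using that vs.subspace_add[OF X, of "x * t" "y * t"] vs.subspace_add[OF subspace_W]
      by (simp add: distrib_right)
    show "scl C c x \<in> ?V" if "x \<in> ?V" for c x
      using that vs.subspace_scale[OF X, of "x * t" c] vs.subspace_scale[OF subspace_W]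
      by (simp add: scl_def mult.assoc)
  qed
  then show ?thesis unfolding flip_run_def Let_def by (rule basis_or_fail_exists) blast
qed

lemma flip_describes:
  assumes ty: "typical C D" and d: "div_deg C D = d"
    and s: "s \<in> WD C (d + g) D" "has_deg C s (d + g)"
    and t: "t \<in> WD C (d + g + 1) D" "has_deg C t (d + g + 1)"
    and A: "affine_div C s = D + A"
    and run: "flip_run C (2 * g + 1) d s t (Some b)"
  shows "\<exists>F G. b = [F, G] \<and> describes C F G A"
proof -
  have "echelon_basis C (WD C (g + g + 1) A) b"
    using run flip_run_iff[OF typical_imp_semi_typical[OF ty] d s t A] ty by simp
  from echelon_pair_of_semi_typical[OF flip_of_typical(2,3)[OF ty d s t A] this]
  show ?thesis using flip_of_typical(2,3)[OF ty d s t A] unfolding describes_iff by blast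
qed

text \<open>The second of two flips leads from \<open>D2\<close> to \<open>D3\<close>.  As \<open>D3 - E\<close> is the affine divisor of \<open>F / s\<close>,
  the divisor \<open>D3\<close> is typical like \<open>E\<close>.\<close>

lemma second_flip:
  assumes E: "typical C E" and e: "div_deg C E = 2 * g"
    and s: "s \<in> WD C (2 * g + g) E" "has_deg C s (2 * g + g)"
    and D2: "affine_div C s = E + D2" "describes C F G D2"
    and D3: "affine_div C F = D2 + D3"
  shows "typical C D3" "div_deg C D3 = g"
    "F \<noteq> 0" "s \<noteq> 0" "D3 + ninf g = principal_div C (F / s) + E"
    and "flip_run C (2 * g + 1) g F G r \<longleftrightarrow>
       (if typical C D2 then \<exists>b. r = Some b \<and> echelon_basis C (WD C (g + g + 1) D3) b else r = None)"
    and "flip_run C (2 * g + 1) g F G (Some b) \<Longrightarrow> typical C D2 \<and>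
       (\<exists>F' G'. b = [F', G'] \<and> describes C F' G' D3 \<and> (\<exists>c. c \<noteq> 0 \<and> F' = emb C c * F) \<and>
          flip_run C (2 * g + 1) g F G (Some [F, G']) \<and> valid_triple C F' G' G D3)"
proof -
  note dD2 = D2(2)[unfolded describes_iff]
  have semi2: "semi_typical C D2" and d2: "div_deg C D2 = g"
    and F: "F \<in> WD C (g + g) D2" "has_deg C F (g + g)" and G: "G \<in> WD C (g + g + 1) D2" "has_deg C G (g + g + 1)"
    using dD2 by auto
  note gD2 = semi_typicalD(1)[OF semi2]
  note gE = semi_typicalD(1)[OF typical_imp_semi_typical[OF E]]
  show F0: "F \<noteq> 0" and s0: "s \<noteq> 0" using F s by (auto simp: has_deg_def)
  note gD3 = flip_good[OF gD2 F(1) F0 D3]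
  show d3: "div_deg C D3 = g" using gD3(2) F(2) d2 by (simp add: has_deg_def)
  have "affine_div C (F / s) = affine_div C F - affine_div C s" using F0 s0 by (rule affine_div_divide)
  then have aff: "D3 = E + affine_div C (F / s)" unfolding D2(1) D3 by simp
  have q0: "F / s \<noteq> 0" using F0 s0 by simp
  show ty3: "typical C D3"
    by (rule typical_class_invariant[OF E gD3(1) _ q0 aff]) (simp add: d3)
  have "pole_deg C (F / s) = - g"
    using F(2) s(2) pole_deg_divide[OF F0 s0] by (simp add: has_deg_def)
  then show "D3 + ninf g = principal_div C (F / s) + E"
    unfolding principal_div_affine aff by (simp add: fun_eq_iff pdiv_def)
  note it = flip_run_iff[OF semi2 d2 F G D3]
  show "flip_run C (2 * g + 1) g F G r \<longleftrightarrow>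
       (if typical C D2 then \<exists>b. r = Some b \<and> echelon_basis C (WD C (g + g + 1) D3) b else r = None)"
    by (rule it)
  assume run: "flip_run C (2 * g + 1) g F G (Some b)"
  then have ty2: "typical C D2" using it by (auto split: if_splits)
  obtain F' G' where b: "b = [F', G']" "describes C F' G' D3"
    using flip_describes[OF ty2 d2 F G D3 run] by blast
  note sd3 = b(2)[unfolded describes_iff]
  have semi3: "semi_typical C D3" and F': "F' \<in> WD C (g + g) D3" "has_deg C F' (g + g)"
    and G': "G' \<in> WD C (g + g + 1) D3" "has_deg C G' (g + g + 1)" using sd3 by auto
  have aF: "affine_div C F = D3 + D2" using D3 by (simp add: add.commute)
  have "D3 \<le> affine_div C F" unfolding aF using gD2 by (simp add: good_def)
  then have F3: "F \<in> WD C (g + g) D3" using F(2) by (simp add: mem_WD[OF gD3(1)] has_deg_def)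
  obtain c where c: "F' = emb C c * F" using semi_typical_scalar[OF semi3 d3 F3 F(2) F'(1)] by blast
  then have c0: "c \<noteq> 0" using F'(2) by (auto simp: has_deg_def)
  have "echelon_basis C (WD C (g + g + 1) D3) [F, G']" by (rule echelon_pair[OF semi3 d3 F3 F(2) G'])
  then have run': "flip_run C (2 * g + 1) g F G (Some [F, G'])" using it ty2 by simp
  have aF': "affine_div C F' = D3 + D2" unfolding c affine_div_const_mult[OF c0] by (rule aF)
  have "D2 \<le> affine_div C F'" unfolding aF' using gD3(1) by (simp add: good_def)
  then have "F' \<in> WD C (g + g) D2" using F'(2) by (simp add: mem_WD[OF gD2] has_deg_def)
  then have "describes C F' G D2" unfolding describes_iff using semi2 d2 F'(2) G by blast
  then have "valid_triple C F' G' G D3" unfolding valid_triple_def using ty3 b(2) aF' ty2 by blast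
  then show "typical C D2 \<and>
       (\<exists>F' G'. b = [F', G'] \<and> describes C F' G' D3 \<and> (\<exists>c. c \<noteq> 0 \<and> F' = emb C c * F) \<and>
          flip_run C (2 * g + 1) g F G (Some [F, G']) \<and> valid_triple C F' G' G D3)"
    using ty2 b c c0 run' by blast
qed

text \<open>
  The last clause also records the linear equivalence that determines the class of the result.
\<close>

lemma two_flips_correct:
  assumes E: "semi_typical C E" and e: "div_deg C E = 2 * g"
    and s: "s \<in> WD C (2 * g + g) E" "has_deg C s (2 * g + g)"
    and t: "t \<in> WD C (2 * g + g + 1) E" "has_deg C t (2 * g + g + 1)"
    and D2: "affine_div C s = E + D2"
  shows "\<exists>r. two_flips_run C s t r"
    and "two_flips_run C s t r \<Longrightarrow> r \<noteq> None \<longleftrightarrow> typical C E \<and> typical C D2"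
    and "two_flips_run C s t (Some (F''', G''', G'')) \<Longrightarrow>
      \<exists>D3 f. valid_triple C F''' G''' G'' D3 \<and> f \<noteq> 0 \<and> D3 + ninf g = principal_div C f + E"
proof -
  note first = flip_run_iff[OF E e s t D2]
  have second: "\<exists>F G D3. b = [F, G] \<and> describes C F G D2 \<and> affine_div C F = D2 + D3"
    if run: "flip_run C (2 * g + 1) (2 * g) s t (Some b)" for b
  proof -
    have ty: "typical C E" using first run by (auto split: if_splits)
    obtain F G where FG: "b = [F, G]" "describes C F G D2" using flip_describes[OF ty e s t D2 run] by blast
    have "affine_div C F = D2 + (affine_div C F - D2)" by simp
    then show ?thesis using FG by blast
  qed
  show "\<exists>r. two_flips_run C s t r"
  proof -
    obtain r2 where r2: "flip_run C (2 * g + 1) (2 * g) s t r2" using flip_run_exists by blast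
    show ?thesis
    proof (cases r2)
      case None
      then show ?thesis using r2 unfolding two_flips_run_def Let_def by force
    next
      case (Some b2)
      obtain r3 where "flip_run C (2 * g + 1) g (b2 ! 0) (b2 ! 1) r3" using flip_run_exists by blast
      then show ?thesis using r2 Some unfolding two_flips_run_def Let_def
        by (intro exI[of _ "map_option (\<lambda>b3. (b3 ! 0, b3 ! 1, b2 ! 1)) r3"] exI[of _ r2]) auto
    qed
  qed
  show "r \<noteq> None \<longleftrightarrow> typical C E \<and> typical C D2" if run: "two_flips_run C s t r"
  proof -
    obtain r2 where r2: "flip_run C (2 * g + 1) (2 * g) s t r2"
      and c: "case r2 of None \<Rightarrow> r = None | Some b2 \<Rightarrow> \<exists>r3. flip_run C (2 * g + 1) g (b2 ! 0) (b2 ! 1) r3 \<and>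
            r = map_option (\<lambda>b3. (b3 ! 0, b3 ! 1, b2 ! 1)) r3"
      using run unfolding two_flips_run_def Let_def by blast
    show ?thesis
    proof (cases r2)
      case None
      then have "\<not> typical C E" using r2 first by auto
      then show ?thesis using c None by simp
    next
      case (Some b2)
      then have ty: "typical C E" using r2 first by (auto split: if_splits)
      obtain F G D3 where b2: "b2 = [F, G]" "describes C F G D2" "affine_div C F = D2 + D3"
        using second r2 Some by blast
      obtain r3 where r3: "flip_run C (2 * g + 1) g F G r3" "r = None \<longleftrightarrow> r3 = None"
        using c Some b2(1) by auto
      show ?thesis using second_flip(6)[OF ty e s D2 b2(2,3), of r3] r3 ty by (auto split: if_splits)
    qed
  qed
  show "\<exists>D3 f. valid_triple C F''' G''' G'' D3 \<and> f \<noteq> 0 \<and> D3 + ninf g = principal_div C f + E"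
    if run: "two_flips_run C s t (Some (F''', G''', G''))"
  proof -
    obtain b2 r3 where b2: "flip_run C (2 * g + 1) (2 * g) s t (Some b2)"
      and r3: "flip_run C (2 * g + 1) g (b2 ! 0) (b2 ! 1) r3"
        "Some (F''', G''', G'') = map_option (\<lambda>b3. (b3 ! 0, b3 ! 1, b2 ! 1)) r3"
      using run unfolding two_flips_run_def Let_def by (auto split: option.splits)
    obtain b3 where b3: "flip_run C (2 * g + 1) g (b2 ! 0) (b2 ! 1) (Some b3)"
      and eq: "(F''', G''', G'') = (b3 ! 0, b3 ! 1, b2 ! 1)"
      using r3 by (cases r3) simp_all
    have ty: "typical C E" using b2 first by (auto split: if_splits)
    obtain F G D3 where FG: "b2 = [F, G]" "describes C F G D2" "affine_div C F = D2 + D3"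
      using second b2 by blast
    note sf = second_flip[OF ty e s D2 FG(2,3)]
    obtain F' G' where "b3 = [F', G']" "valid_triple C F' G' G D3" using sf(7)[of b3] b3 FG(1) by auto
    then have "valid_triple C F''' G''' G'' D3" using eq FG(1) by simp
    moreover have "F / s \<noteq> 0" using sf(3,4) by simp
    ultimately show ?thesis using sf(5) by blast
  qed
qed

section \<open>Valid triples\<close>

lemma valid_tripleD:
  assumes "valid_triple C F G G1 D"
  shows "typical C D" "semi_typical C D" "div_deg C D = g" "F \<in> WD C (g + g) D" "has_deg C F (g + g)"
    "G \<in> WD C (g + g + 1) D" "has_deg C G (g + g + 1)"
  using assms by (auto simp: valid_triple_def describes_iff)

theorem representation:
  assumes D: "typical C D" "div_deg C D = int (genus C)" and F: "flip_via C (2 * g) D F A" and A: "typical C A"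
  shows "\<exists>G G1. valid_triple C F G G1 D"
proof -
  have F': "F \<in> WD C (g + g) D" "has_deg C F (g + g)" "affine_div C F = D + A"
    using F unfolding flip_via_def mult_2 by blast+
  have F0: "F \<noteq> 0" using F' by (auto simp: has_deg_def)
  note sD = typical_imp_semi_typical[OF D(1)] and sA = typical_imp_semi_typical[OF A]
  have dA: "div_deg C A = g"
    using flip_good(2)[OF semi_typicalD(1)[OF sD] F'(1) F0 F'(3)] F'(2) D(2) by (simp add: has_deg_def)
  have "A \<le> affine_div C F" unfolding F'(3) using semi_typicalD(1)[OF sD] by (simp add: good_def)
  then have FA: "F \<in> WD C (g + g) A"
    using F'(2) by (simp add: mem_WD[OF semi_typicalD(1)[OF sA]] has_deg_def)
  obtain G where G: "G \<in> WD C (g + g + 1) D" "has_deg C G (g + g + 1)" using semi_typical_exact(2)[OF sD D(2)] by blast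
  obtain G1 where G1: "G1 \<in> WD C (g + g + 1) A" "has_deg C G1 (g + g + 1)" using semi_typical_exact(2)[OF sA dA] by blast
  have "valid_triple C F G G1 D"
    unfolding valid_triple_def describes_iff using D A sD sA dA F' FA G G1 by blast
  then show ?thesis by blast
qed

theorem negation:
  assumes v: "valid_triple C F G G1 D" and A: "affine_div C F = D + A"
  shows "valid_triple C F G1 G A \<and> affine_div C F = A + D \<and> typical C A \<and> typical C D \<and>
        pic_class C A = inv\<^bsub>Pic0 C\<^esub> (pic_class C D)"
proof -
  obtain A' where A': "affine_div C F = D + A'" "typical C A'" "describes C F G1 A'"
    using v by (auto simp: valid_triple_def)
  have [simp]: "A' = A" using A A'(1) by simp
  have e: "affine_div C F = A + D" using A by (simp add: add.commute)
  have dD: "describes C F G D" "typical C D" using v by (auto simp: valid_triple_def)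
  have F: "F \<noteq> 0" "pole_deg C F = 2 * g" using valid_tripleD(5)[OF v] by (auto simp: has_deg_def)
  have "valid_triple C F G1 G A" unfolding valid_triple_def using A' dD e by auto
  moreover have "pic_class C A = inv\<^bsub>Pic0 C\<^esub> (pic_class C D)"
  proof (rule pic_class_inverse)
    show "is_divisor C D" using semi_typicalD(1)[OF valid_tripleD(2)[OF v]] by (simp add: good_def)
    show "div_deg C D = g" by (rule valid_tripleD(3)[OF v])
    show "is_divisor C A" "div_deg C A = g"
      using A'(3) by (auto simp: describes_iff good_def dest: semi_typicalD(1))
    show "F \<noteq> 0" by (rule F)
    show "D + A = principal_div C F + ninf (2 * g)"
      unfolding principal_div_affine A F(2) by simp
  qed
  ultimately show ?thesis using e A'(2) dD(2) by simp
qed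

lemma gen_space_of_valid_triple:
  assumes v: "valid_triple C F G G1 D"
  shows "F *o W C (2 * g) + G *o W C (2 * g - 1) = WD C (4 * g) D"
  using typical_iff_gen_space[OF valid_tripleD(2-7)[OF v]] valid_tripleD(1)[OF v] by simp

lemma selected_basis_of_valid_triple:
  assumes v: "valid_triple C F G G1 D"
  shows "\<exists>b. selected_basis C F G b"
    and "selected_basis C F G b \<Longrightarrow> length b = nat (g + 2) \<and> echelon_basis C (WD C (3 * g + 1) D) b"
proof -
  note gD = semi_typicalD(1)[OF valid_tripleD(2)[OF v]]
  note sp = gen_space_of_valid_triple[OF v]
  show "\<exists>b. selected_basis C F G b"
    using echelon_basis_exists[OF subspace_WD[OF gD] WD_W, of "4 * g"] unfolding selected_basis_def sp by blast
  have "int (vs.dim (WD C (3 * g + 1) D)) = g + 2"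
    using dim_WD_eq[OF gD, of "3 * g + 1"] valid_tripleD(3)[OF v] by simp
  then have dm: "vs.dim (WD C (3 * g + 1) D) = genus C + 2" by linarith
  assume "selected_basis C F G b"
  then obtain b0 where b0: "echelon_basis C (WD C (4 * g) D) b0" "b = take (genus C + 2) b0"
    unfolding selected_basis_def sp by blast
  have "echelon_basis C (WD C (3 * g + 1) D) b"
    using echelon_truncate[OF gD b0(1), of "3 * g + 1"] genus_pos unfolding dm b0(2) by simp
  moreover from echelon_length[OF this] have "length b = nat (g + 2)" using dm by simp
  ultimately show "length b = nat (g + 2) \<and> echelon_basis C (WD C (3 * g + 1) D) b" by blast
qed

section \<open>Addition\<close>

lemma WD_Int_WD:
  assumes "good C D" "good C D'"
  shows "good C (\<lambda>P. max (D P) (D' P))"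
    "WD C N D \<inter> WD C N D' = WD C N (\<lambda>P. max (D P) (D' P))"
proof -
  show g: "good C (\<lambda>P. max (D P) (D' P))"
  proof (rule goodI)
    have f: "finite ({P. D P \<noteq> 0} \<union> {P. D' P \<noteq> 0})" "{P. D P \<noteq> 0} \<union> {P. D' P \<noteq> 0} \<subseteq> points C"
      using assms by (auto simp: good_def is_divisor_def)
    have s: "{P. max (D P) (D' P) \<noteq> 0} \<subseteq> {P. D P \<noteq> 0} \<union> {P. D' P \<noteq> 0}" by auto
    show "is_divisor C (\<lambda>P. max (D P) (D' P))"
      using f s by (intro is_divisorI[OF f(1) s]) (rule order_trans)
    show "0 \<le> max (D P) (D' P)" for P using good_pos[OF assms(1), of P] by simp
    show "max (D (infty C)) (D' (infty C)) = 0" using assms by (simp add: good_def)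
  qed
  have "(\<lambda>P. max (D P) (D' P)) \<le> affine_div C f \<longleftrightarrow> D \<le> affine_div C f \<and> D' \<le> affine_div C f" for f
    unfolding le_fun_def by auto
  then show "WD C N D \<inter> WD C N D' = WD C N (\<lambda>P. max (D P) (D' P))"
    using mem_WD[OF assms(1)] mem_WD[OF assms(2)] mem_WD[OF g] by blast
qed

lemma disjoint_max:
  assumes "good C D" "good C D'" "disjoint_divs D D'"
  shows "(\<lambda>P. max (D P) (D' P)) = D + D'"
proof
  fix P
  show "max (D P) (D' P) = (D + D') P"
    using assms(3)[unfolded disjoint_divs_def, rule_format, of P] good_pos[OF assms(1), of P]
      good_pos[OF assms(2), of P] by auto
qed

text \<open>
  The intersection belongs to the maximum \<open>M\<close> of \<open>D\<close> and \<open>D'\<close>.  By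
  Riemann's inequality it can vanish only if \<open>deg M \<ge> 2g\<close>, and then
  \<open>M = D + D'\<close>.
\<close>

lemma intersection_success:
  assumes D: "good C D" "div_deg C D = g" and D': "good C D'" "div_deg C D' = g"
  shows "WD C (3 * g - 1) D \<inter> WD C (3 * g - 1) D' = {0} \<longleftrightarrow> disjoint_divs D D' \<and> semi_typical C (D + D')"
proof
  note M = WD_Int_WD[OF D(1) D'(1)]
  let ?M = "\<lambda>P. max (D P) (D' P)"
  have deg: "div_deg C (D + D') = 2 * g" using good_deg_add[OF D(1) D'(1)] D D' by simp
  {
    assume "WD C (3 * g - 1) D \<inter> WD C (3 * g - 1) D' = {0}"
    then have 0: "WD C (3 * g - 1) ?M = {0}" using M(2) by simp
    have "3 * g - 1 - div_deg C ?M + 1 - g \<le> 0"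
      using dim_WD_ge[OF M(1), of "3 * g - 1"] unfolding 0 dim_zero_space by simp
    then have "div_deg C (D + D') \<le> div_deg C ?M" using deg by simp
    moreover have "?M \<le> D + D'"
    proof (rule div_leI)
      fix P show "max (D P) (D' P) \<le> (D + D') P"
        using good_pos[OF D(1), of P] good_pos[OF D'(1), of P] by simp
    qed
    ultimately have e: "?M = D + D'" using M(1) good_add[OF D(1) D'(1)] by (intro divisor_eq_of_deg_le)
    have "disjoint_divs D D'" unfolding disjoint_divs_def
    proof
      fix P show "D P = 0 \<or> D' P = 0" using fun_cong[OF e, of P] by auto
    qed
    moreover have "semi_typical C (D + D')"
      using good_add[OF D(1) D'(1)] deg 0 genus_pos unfolding e by (intro semi_typicalI) auto
    ultimately show "disjoint_divs D D' \<and> semi_typical C (D + D')" by blast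
  next
    assume a: "disjoint_divs D D' \<and> semi_typical C (D + D')"
    show "WD C (3 * g - 1) D \<inter> WD C (3 * g - 1) D' = {0}"
      unfolding M(2) using semi_typicalD(3)[of "D + D'"] a deg disjoint_max[OF D(1) D'(1)] by simp
  }
qed

context
  fixes F G G1 D F' G' G1' D'
  assumes v: "valid_triple C F G G1 D" and v': "valid_triple C F' G' G1' D'"
begin

lemma add_divisor:
  shows "good C D" "good C D'" "good C (D + D')" "div_deg C (D + D') = 2 * g"
proof -
  show *: "good C D" "good C D'" using v v' semi_typicalD(1) valid_tripleD(2) by blast+
  show "good C (D + D')" "div_deg C (D + D') = 2 * g"
    using good_add[OF *] good_deg_add[OF *] valid_tripleD(3)[OF v] valid_tripleD(3)[OF v'] by auto
qed

lemma add_start_iff: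
  "add_start_run C F G F' G' r \<longleftrightarrow>
    (if disjoint_divs D D' \<and> semi_typical C (D + D')
     then \<exists>b. r = Some b \<and> echelon_basis C (WD C (2 * g + g + 1) (D + D')) b else r = None)"
proof -
  note gD = add_divisor(1) and gD' = add_divisor(2)
  have run: "intersection_run C b b' r \<longleftrightarrow>
      basis_or_fail C (WD C (3 * g + 1) D \<inter> WD C (3 * g + 1) D') (WD C (3 * g - 1) D \<inter> WD C (3 * g - 1) D') r"
    if "selected_basis C F G b" "selected_basis C F' G' b'" for b b'
  proof -
    have "kspan C (set b) = WD C (3 * g + 1) D" "kspan C (set b') = WD C (3 * g + 1) D'"
      using selected_basis_of_valid_triple(2)[OF v that(1)] selected_basis_of_valid_triple(2)[OF v' that(2)]
      by (auto simp: echelon_basis_def)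
    then show ?thesis
      unfolding intersection_run_def Let_def using WD_Int_W[OF gD, of "3 * g - 1" "3 * g + 1"]
        WD_Int_W[OF gD', of "3 * g - 1" "3 * g + 1"] by simp
  qed
  have "add_start_run C F G F' G' r \<longleftrightarrow>
      basis_or_fail C (WD C (3 * g + 1) D \<inter> WD C (3 * g + 1) D') (WD C (3 * g - 1) D \<inter> WD C (3 * g - 1) D') r"
    unfolding add_start_run_def using run selected_basis_of_valid_triple(1)[OF v] selected_basis_of_valid_triple(1)[OF v']
    by blast
  moreover have "WD C (3 * g + 1) D \<inter> WD C (3 * g + 1) D' = WD C (2 * g + g + 1) (D + D')" if "disjoint_divs D D'"
    using WD_Int_WD(2)[OF gD gD', of "3 * g + 1"] disjoint_max[OF gD gD' that] by simp
  ultimately show ?thesis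
    using intersection_success[OF gD valid_tripleD(3)[OF v] gD' valid_tripleD(3)[OF v']]
    unfolding basis_or_fail_def by auto
qed

end

text \<open>
  The assertions about the two flips that start from a divisor \<open>E\<close> of degree
  \<open>2g\<close>, where \<open>c\<close> is the class of \<open>E - 2g P\<^sub>\<infinity>\<close>.
  Addition uses it for \<open>E = D + D'\<close>, doubling for \<open>E = 2D\<close>.
\<close>

definition flips_spec :: "'a divisor \<Rightarrow> 'a \<Rightarrow> 'a \<Rightarrow> 'a divisor \<Rightarrow> 'a divisor set \<Rightarrow> bool" where
  "flips_spec E s t D2 c \<longleftrightarrow>
    (\<exists>r. flip_run C (2 * g + 1) (2 * g) s t r) \<and>
    (\<forall>r. flip_run C (2 * g + 1) (2 * g) s t r \<longrightarrow>
      (r \<noteq> None \<longleftrightarrow> typical C E) \<and>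
      (\<forall>b. r = Some b \<longrightarrow> (\<exists>F G. b = [F, G] \<and> describes C F G D2))) \<and>
    (\<forall>F'' G'' D'''.
      flip_run C (2 * g + 1) (2 * g) s t (Some [F'', G'']) \<and>
      affine_div C F'' = D2 + D''' \<longrightarrow>
      (\<exists>r. flip_run C (2 * g + 1) g F'' G'' r) \<and>
      (\<forall>b. flip_run C (2 * g + 1) g F'' G'' (Some b) \<longrightarrow>
         typical C D2 \<and> typical C D''' \<and>
         (\<exists>F''' G'''. b = [F''', G'''] \<and> describes C F''' G''' D''' \<and>
            (\<exists>c. c \<noteq> 0 \<and> F''' = emb C c * F'') \<and>
            flip_run C (2 * g + 1) g F'' G'' (Some [F'', G''']) \<and>
            valid_triple C F''' G''' G'' D''' \<and>
            pic_class C D''' = c)))"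

lemma flips_correct:
  assumes E: "semi_typical C E" and e: "div_deg C E = 2 * g"
    and s: "s \<in> WD C (2 * g + g) E" "has_deg C s (2 * g + g)"
    and t: "t \<in> WD C (2 * g + g + 1) E" "has_deg C t (2 * g + g + 1)"
    and D2: "affine_div C s = E + D2"
    and c: "\<forall>A f. f \<noteq> 0 \<longrightarrow> A + ninf g = principal_div C f + E \<longrightarrow> pic_class C A = c"
  shows "flips_spec E s t D2 c"
  unfolding flips_spec_def
proof (intro conjI allI impI)
  note first = flip_run_iff[OF E e s t D2]
  have desc: "\<exists>F G. b = [F, G] \<and> describes C F G D2"
    if run: "flip_run C (2 * g + 1) (2 * g) s t (Some b)" for b
  proof -
    have ty: "typical C E" using first run by (auto split: if_splits)
    show ?thesis by (rule flip_describes[OF ty e s t D2 run])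
  qed
  show "\<exists>r. flip_run C (2 * g + 1) (2 * g) s t r" by (rule flip_run_exists)
  show "r \<noteq> None \<longleftrightarrow> typical C E" if "flip_run C (2 * g + 1) (2 * g) s t r" for r
    using first that by (auto split: if_splits)
  show "\<exists>F G. b = [F, G] \<and> describes C F G D2"
    if "flip_run C (2 * g + 1) (2 * g) s t r" "r = Some b" for r b
    using desc that by simp
  fix F'' G'' D'''
  assume r1: "flip_run C (2 * g + 1) (2 * g) s t (Some [F'', G'']) \<and> affine_div C F'' = D2 + D'''"
  then have ty: "typical C E" using first by (auto split: if_splits)
  have d: "describes C F'' G'' D2" using desc[of "[F'', G'']"] r1 by auto
  note sf = second_flip[OF ty e s D2 d conjunct2[OF r1]]
  show "\<exists>r. flip_run C (2 * g + 1) g F'' G'' r" by (rule flip_run_exists)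
  fix b assume r2: "flip_run C (2 * g + 1) g F'' G'' (Some b)"
  show "typical C D2" using sf(7)[OF r2] by blast
  show "typical C D'''" by (rule sf(1))
  have "F'' / s \<noteq> 0" using sf(3,4) by simp
  then have "pic_class C D''' = c" using sf(5) c by blast
  then show "\<exists>F''' G'''. b = [F''', G'''] \<and> describes C F''' G''' D''' \<and>
            (\<exists>c. c \<noteq> 0 \<and> F''' = emb C c * F'') \<and>
            flip_run C (2 * g + 1) g F'' G'' (Some [F'', G''']) \<and>
            valid_triple C F''' G''' G'' D''' \<and>
            pic_class C D''' = c"
    using sf(7)[OF r2] by blast
qed

text \<open>
  \<open>E\<close> and \<open>D3\<close> differ by the divisor of \<open>F / s\<close>.
\<close>

lemma flip_chain_typical:
  assumes E: "good C E" "div_deg C E = 2 * g"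
    and 1: "flip_via C (3 * g) E s D2" and 2: "flip_via C (2 * g) D2 F D3"
  shows "typical C E \<longleftrightarrow> typical C D3"
proof -
  have s: "s \<noteq> 0" "s \<in> WD C (3 * g) E" "pole_deg C s = 3 * g" "affine_div C s = E + D2"
    and F: "F \<noteq> 0" "F \<in> WD C (2 * g) D2" "pole_deg C F = 2 * g" "affine_div C F = D2 + D3"
    using 1 2 unfolding flip_via_def has_deg_def by blast+
  note g2 = flip_good[OF E(1) s(2,1,4)]
  note g3 = flip_good[OF g2(1) F(2,1,4)]
  have d3: "div_deg C D3 = g" using g2(2) g3(2) s(3) F(3) E(2) by simp
  have q: "F / s \<noteq> 0" "s / F \<noteq> 0" using s F by simp_all
  have a: "D3 = E + affine_div C (F / s)" "E = D3 + affine_div C (s / F)"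
    using affine_div_divide[OF F(1) s(1)] affine_div_divide[OF s(1) F(1)] unfolding s(4) F(4) by simp_all
  show "typical C E \<longleftrightarrow> typical C D3"
  proof
    show "typical C E \<Longrightarrow> typical C D3"
      by (rule typical_class_invariant[OF _ g3(1) _ q(1) a(1)]) (simp_all add: d3)
    show "typical C D3 \<Longrightarrow> typical C E"
      by (rule typical_class_invariant[OF _ E(1) _ q(2) a(2)]) (simp_all add: E(2))
  qed
qed

lemma flip_via_unique:
  assumes E: "semi_typical C E" and e: "div_deg C E = d"
    and s: "s \<in> WD C (d + g) E" "has_deg C s (d + g)" "affine_div C s = E + A"
    and v: "flip_via C (d + g) E f B"
  shows "A = B"
proof -
  have f: "f \<in> WD C (d + g) E" "has_deg C f (d + g)" "affine_div C f = E + B"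
    using v unfolding flip_via_def by blast+
  obtain c where c: "f = emb C c * s" using semi_typical_scalar[OF E e s(1,2) f(1)] by blast
  then have "c \<noteq> 0" using f(2) by (auto simp: has_deg_def)
  then have "affine_div C f = affine_div C s" unfolding c by (rule affine_div_const_mult)
  then show ?thesis using s(3) f(3) by simp
qed

lemma flip_via_exists:
  assumes E: "semi_typical C E" and e: "div_deg C E = d"
  shows "\<exists>f B. flip_via C (d + g) E f B"
proof -
  obtain f where f: "f \<in> WD C (d + g) E" "has_deg C f (d + g)" using semi_typical_exact(1)[OF E e] by blast
  have "affine_div C f = E + (affine_div C f - E)" by simp
  then have "flip_via C (d + g) E f (affine_div C f - E)" using f unfolding flip_via_def by blast
  then show ?thesis by blast
qed

lemma three_g: "2 * g + g = 3 * g" by simp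

text \<open>
  Addition and doubling differ only in the first step \<open>S\<close>, which has to produce
  \<open>W\<^sup>3\<^sup>g\<^sup>+\<^sup>1\<^sub>E\<close> for \<open>E = D + D'\<close> or
  \<open>E = 2D\<close>; \<open>ok\<close> is the extra condition for its success.
\<close>

lemma composite_correct:
  fixes S :: "'a list option \<Rightarrow> bool" and R :: "('a \<times> 'a \<times> 'a) option \<Rightarrow> bool"
  assumes gE: "good C E" "div_deg C E = 2 * g"
    and S: "\<And>r. S r \<longleftrightarrow> (if ok \<and> semi_typical C E
      then \<exists>b. r = Some b \<and> echelon_basis C (WD C (3 * g + 1) E) b else r = None)"
    and R: "\<And>r. R r \<longleftrightarrow> (\<exists>r1. S r1 \<and>
      (case r1 of None \<Rightarrow> r = None | Some b \<Rightarrow> two_flips_run C (b ! 0) (b ! 1) r))"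
    and c: "\<forall>A f. f \<noteq> 0 \<longrightarrow> A + ninf g = principal_div C f + E \<longrightarrow> pic_class C A = c"
  shows "\<exists>r. S r" and "S r1 \<Longrightarrow> r1 \<noteq> None \<longleftrightarrow> ok \<and> semi_typical C E"
    and "S (Some b) \<Longrightarrow> \<exists>s t. b = [s, t] \<and>
      s \<in> WD C (3 * g) E \<and> has_deg C s (3 * g) \<and> t \<in> WD C (3 * g + 1) E \<and> has_deg C t (3 * g + 1) \<and>
      echelon_basis C (WD C (3 * g + 1) E) [s, t]"
    and "S (Some [s, t]) \<Longrightarrow> affine_div C s = E + D2 \<Longrightarrow> flips_spec E s t D2 c"
    and "\<exists>r. R r"
    and "R r \<Longrightarrow> r \<noteq> None \<longleftrightarrow> ok \<and> typical C E \<and>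
      (\<exists>s D''. flip_via C (3 * g) E s D'' \<and> typical C D'')"
    and "R (Some (F''', G''', G'')) \<Longrightarrow> \<exists>D'''. valid_triple C F''' G''' G'' D''' \<and> pic_class C D''' = c"
proof -
  have pair: "ok \<and> semi_typical C E \<and> echelon_basis C (WD C (3 * g + 1) E) b \<and>
    (\<exists>s t. b = [s, t] \<and> s \<in> WD C (2 * g + g) E \<and> has_deg C s (2 * g + g) \<and>
       t \<in> WD C (2 * g + g + 1) E \<and> has_deg C t (2 * g + g + 1))" if "S (Some b)" for b
  proof -
    have a: "ok" "semi_typical C E" "echelon_basis C (WD C (3 * g + 1) E) b"
      using that unfolding S by (auto split: if_splits)
    show ?thesis using a echelon_pair_of_semi_typical[OF a(2) gE(2) a(3)[folded three_g]] by blast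
  qed
  have exact: "semi_typical C E" "s \<in> WD C (2 * g + g) E" "has_deg C s (2 * g + g)"
    "t \<in> WD C (2 * g + g + 1) E" "has_deg C t (2 * g + g + 1)" if "S (Some [s, t])" for s t
    using pair[OF that] by auto
  have residual: "affine_div C s = E + (affine_div C s - E)" for s by simp
  show start_ex: "\<exists>r. S r"
  proof -
    obtain b where "echelon_basis C (WD C (3 * g + 1) E) b"
      using echelon_basis_exists[OF subspace_WD[OF gE(1)] WD_W] by blast
    then show ?thesis unfolding S by (auto split: if_splits)
  qed
  show succ: "r1 \<noteq> None \<longleftrightarrow> ok \<and> semi_typical C E" if "S r1" for r1
    using that unfolding S by (auto split: if_splits)
  show "\<exists>s t. b = [s, t] \<and>
      s \<in> WD C (3 * g) E \<and> has_deg C s (3 * g) \<and> t \<in> WD C (3 * g + 1) E \<and> has_deg C t (3 * g + 1) \<and>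
      echelon_basis C (WD C (3 * g + 1) E) [s, t]" if "S (Some b)"
    using pair[OF that] unfolding three_g by blast
  show "flips_spec E s t D2 c" if "S (Some [s, t])" "affine_div C s = E + D2"
    by (rule flips_correct[OF exact(1)[OF that(1)] gE(2) exact(2-5)[OF that(1)] that(2) c])
  show "\<exists>r. R r"
  proof -
    obtain r1 where r1: "S r1" using start_ex by blast
    show ?thesis
    proof (cases r1)
      case None
      then show ?thesis using r1 unfolding R by (intro exI[of _ None] exI[of _ r1]) simp
    next
      case (Some b)
      note r1' = r1[unfolded Some]
      obtain s t where b: "b = [s, t]" using pair[OF r1'] by blast
      obtain r where "two_flips_run C s t r"
        using two_flips_correct(1)[OF exact(1)[OF r1'[unfolded b]] gE(2) exact(2-5)[OF r1'[unfolded b]] residual] by blast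
      then show ?thesis using r1 Some b unfolding R by (intro exI[of _ r] exI[of _ r1]) simp
    qed
  qed
  show "r \<noteq> None \<longleftrightarrow> ok \<and> typical C E \<and> (\<exists>s D''. flip_via C (3 * g) E s D'' \<and> typical C D'')"
    if run: "R r"
  proof -
    obtain r1 where r1: "S r1"
      and cs: "case r1 of None \<Rightarrow> r = None | Some b \<Rightarrow> two_flips_run C (b ! 0) (b ! 1) r"
      using run unfolding R by blast
    show ?thesis
    proof (cases r1)
      case None
      then have "\<not> (ok \<and> semi_typical C E)" using succ[OF r1] by simp
      then show ?thesis using cs None typical_imp_semi_typical by auto
    next
      case (Some b)
      note r1' = r1[unfolded Some]
      obtain s t where b: "b = [s, t]" using pair[OF r1'] by blast
      note ex = exact[OF r1'[unfolded b]]
      define D2 where "D2 = affine_div C s - E"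
      have D2: "affine_div C s = E + D2" by (simp add: D2_def)
      have "two_flips_run C s t r" using cs Some b by simp
      then have rt: "r \<noteq> None \<longleftrightarrow> typical C E \<and> typical C D2"
        by (rule two_flips_correct(2)[OF ex(1) gE(2) ex(2-5) D2])
      have via: "flip_via C (3 * g) E s D2" using ex D2 unfolding flip_via_def three_g by blast
      have "D2 = D''" if "flip_via C (3 * g) E s' D''" for s' D''
        by (rule flip_via_unique[OF ex(1) gE(2) ex(2,3) D2 that[folded three_g]])
      then show ?thesis using rt via pair[OF r1'] by blast
    qed
  qed
  show "\<exists>D'''. valid_triple C F''' G''' G'' D''' \<and> pic_class C D''' = c"
    if run: "R (Some (F''', G''', G''))"
  proof -
    obtain b where r1: "S (Some b)" and tf: "two_flips_run C (b ! 0) (b ! 1) (Some (F''', G''', G''))"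
      using run unfolding R by (auto split: option.splits)
    obtain s t where b: "b = [s, t]" using pair[OF r1] by blast
    note ex = exact[OF r1[unfolded b]]
    have "two_flips_run C s t (Some (F''', G''', G''))" using tf b by simp
    from two_flips_correct(3)[OF ex(1) gE(2) ex(2-5) residual this] c show ?thesis by blast
  qed
qed

context
  fixes F G G1 D F' G' G1' D'
  assumes v: "valid_triple C F G G1 D" and v': "valid_triple C F' G' G1' D'"
begin

lemma add_pic_class:
  "\<forall>A f. f \<noteq> 0 \<longrightarrow> A + ninf g = principal_div C f + (D + D') \<longrightarrow>
    pic_class C A = pic_class C D \<otimes>\<^bsub>Pic0 C\<^esub> pic_class C D'"
  using pic_class_sum[OF _ valid_tripleD(3)[OF v] _ valid_tripleD(3)[OF v']] add_divisor(1,2)[OF v v']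
  by (simp add: good_def)

lemmas add_correct =
  composite_correct[OF add_divisor(3,4)[OF v v'] add_start_iff[OF v v', unfolded three_g] add_run_def add_pic_class]

text \<open>
  In terms of the divisors, the condition that \<open>D + D'\<close> is typical can be replaced by the
  condition that \<open>D'''\<close> is, because the two are linearly equivalent up to a multiple of
  \<open>P\<^sub>\<infinity>\<close>.
\<close>

lemma add_success:
  "(disjoint_divs D D' \<and> typical C (D + D') \<and> (\<exists>s D''. flip_via C (3 * g) (D + D') s D'' \<and> typical C D''))
    \<longleftrightarrow> disjoint_divs D D' \<and>
      (\<exists>s D'' F'' D'''. flip_via C (3 * g) (D + D') s D'' \<and>
         flip_via C (2 * g) D'' F'' D''' \<and> typical C D'' \<and> typical C D''')" (is "?L \<longleftrightarrow> ?R")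
proof
  assume L: ?L
  then obtain s D'' where s: "flip_via C (3 * g) (D + D') s D''" "typical C D''" by blast
  then have s': "s \<in> WD C (3 * g) (D + D')" "s \<noteq> 0" "pole_deg C s = 3 * g" "affine_div C s = D + D' + D''"
    unfolding flip_via_def has_deg_def by blast+
  have "div_deg C D'' = g" using flip_good(2)[OF add_divisor(3)[OF v v'] s'(1,2,4)] s'(3) add_divisor(4)[OF v v'] by simp
  then obtain F'' D''' where f: "flip_via C (2 * g) D'' F'' D'''"
    using flip_via_exists[OF typical_imp_semi_typical[OF s(2)]] unfolding mult_2 by blast
  have "typical C D'''" using flip_chain_typical[OF add_divisor(3,4)[OF v v'] s(1) f] L by blast
  then show ?R using L s f by blast
next
  assume ?R
  then show ?L using flip_chain_typical[OF add_divisor(3,4)[OF v v']] by blast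
qed

end

section \<open>Doubling\<close>

text \<open>
  Let \<open>div G\<^sub>1 = A + B\<close>.  Since \<open>A\<close> is typical with flip
  \<open>D\<close>, the divisors \<open>B\<close> and \<open>D\<close> are disjoint.  So
  \<open>l G\<^sub>1 / F\<close>, whose divisor is \<open>div l + B - D\<close>, vanishes on
  \<open>D\<close> iff \<open>div l \<ge> 2D\<close>.
\<close>

lemma double_start_iff:
  assumes v: "valid_triple C F G G1 D"
  shows "- (G * G1) / F \<in> W C (2 * g + 2)"
    and "double_start_run C D F G G1 r \<longleftrightarrow>
     (if semi_typical C (D + D) then \<exists>b. r = Some b \<and> echelon_basis C (WD C (3 * g + 1) (D + D)) b else r = None)"
    and "good C (D + D)" "div_deg C (D + D) = 2 * g"
proof -
  note vD = valid_tripleD[OF v]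
  note gD = semi_typicalD(1)[OF vD(2)]
  obtain A where A: "affine_div C F = D + A" "typical C A" "describes C F G1 A"
    using v by (auto simp: valid_triple_def)
  have dA: "semi_typical C A" "div_deg C A = g" "F \<in> WD C (g + g) A"
    "G1 \<in> WD C (g + g + 1) A" "has_deg C G1 (g + g + 1)"
    using A(3) unfolding describes_iff by blast+
  note gA = semi_typicalD(1)[OF dA(1)]
  have nz: "F \<noteq> 0" "G \<noteq> 0" "G1 \<noteq> 0" and pd: "pole_deg C F = 2 * g" "pole_deg C G = 2 * g + 1" "pole_deg C G1 = 2 * g + 1"
    using vD(5,7) dA(5) by (auto simp: has_deg_def)
  have leG: "D \<le> affine_div C G" using vD(6) nz by (simp add: mem_WD[OF gD])
  have leG1: "A \<le> affine_div C G1" using dA(4) nz by (simp add: mem_WD[OF gA])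
  have meet: "affine_div C G1 P = A P \<or> D P = 0" for P
    by (rule flip_of_typical(4)[OF A(2) dA(2,3) vD(5) dA(4,5)]) (simp add: A(1) add.commute)
  show gDD: "good C (D + D)" and dDD: "div_deg C (D + D) = 2 * g"
    using good_add[OF gD gD] good_deg_add[OF gD gD] vD(3) by simp_all
  define H where "H = - (G * G1) / F"
  have H: "H = emb C (- 1) * (G * G1 / F)" by (simp add: H_def emb_minus)
  have "affine_div C H = affine_div C (G * G1 / F)" unfolding H by (rule affine_div_const_mult) simp
  also have "\<dots> = affine_div C G + affine_div C G1 - (D + A)"
    using nz by (simp add: affine_div_divide affine_div_mult A(1))
  finally have "0 \<le> affine_div C H" using add_mono[OF leG leG1] by (simp only: le_diff_eq add_0)
  moreover have "pole_deg C H = 2 * g + 2"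
    unfolding H using nz pd by (subst pole_deg_const_mult) (simp_all add: pole_deg_divide pole_deg_mult)
  ultimately show "- (G * G1) / F \<in> W C (2 * g + 2)" unfolding H_def[symmetric] mem_W by simp
  let ?N = "3 * g + 1"
  \<comment> \<open>For \<open>l = \<alpha> F + \<beta> G\<close>, the second condition of the doubling procedure concerns \<open>l G\<^sub>1 / F\<close>.\<close>
  have key: "l * G1 / F \<in> WD C (?N + 1) D \<longleftrightarrow> l \<in> WD C ?N (D + D)" if l: "l \<in> WD C ?N D" for l
  proof (cases "l = 0")
    case False
    have lD: "D P \<le> affine_div C l P" for P using l False mem_WD[OF gD] by (blast dest: le_funD)
    have pl: "pole_deg C l \<le> ?N" using l False mem_WD[OF gD] by blast
    have aff: "affine_div C (l * G1 / F) P = affine_div C l P + affine_div C G1 P - (D P + A P)" for P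
      using False nz by (simp add: affine_div_divide affine_div_mult A(1))
    have "l * G1 / F \<in> WD C (?N + 1) D \<longleftrightarrow> (\<forall>P. D P \<le> affine_div C (l * G1 / F) P)"
      using False nz pd pl by (simp add: mem_WD[OF gD] le_fun_def pole_deg_divide pole_deg_mult)
    also have "\<dots> \<longleftrightarrow> (\<forall>P. D P + D P \<le> affine_div C l P)"
    proof (rule all_cong1)
      fix P
      show "D P \<le> affine_div C (l * G1 / F) P \<longleftrightarrow> D P + D P \<le> affine_div C l P"
        using meet[of P] lD[of P] le_funD[OF leG1, of P] unfolding aff by auto
    qed
    also have "\<dots> \<longleftrightarrow> l \<in> WD C ?N (D + D)"
      using False pl unfolding mem_WD[OF gDD] le_fun_def by simp
    finally show ?thesis .
  next
    case True
    show ?thesis unfolding True mem_WD[OF gD] mem_WD[OF gDD] by simp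
  qed
  have sub: "WD C ?N (D + D) \<subseteq> WD C ?N D"
  proof
    fix l assume "l \<in> WD C ?N (D + D)"
    moreover have "D \<le> D + D" using gD unfolding good_def by (blast intro: add_increasing order_refl)
    ultimately show "l \<in> WD C ?N D" unfolding mem_WD[OF gD] mem_WD[OF gDD] by (blast intro: order_trans)
  qed
  have comb: "\<alpha> * G1 - \<beta> * H = (\<alpha> * F + \<beta> * G) * G1 / F" for \<alpha> \<beta>
    using nz by (simp add: H_def field_simps)
  have "{\<alpha> * F + \<beta> * G | \<alpha> \<beta>. \<alpha> \<in> reg_ring C \<and> \<beta> \<in> reg_ring C \<and>
      \<alpha> * F + \<beta> * G \<in> WD C ?N D \<and> \<alpha> * G1 - \<beta> * H \<in> WD C (?N + 1) D} = WD C ?N (D + D)" (is "?V = _")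
  proof
    show "?V \<subseteq> WD C ?N (D + D)" using key unfolding comb by blast
    show "WD C ?N (D + D) \<subseteq> ?V"
    proof
      fix l assume l: "l \<in> WD C ?N (D + D)"
      then have lD: "l \<in> WD C ?N D" using sub by blast
      then have "l \<in> WD C (4 * g) D" using WD_mono[of ?N "4 * g" D] genus_pos by auto
      then obtain \<alpha> \<beta> where ab: "l = F * \<alpha> + G * \<beta>" "\<alpha> \<in> W C (2 * g)" "\<beta> \<in> W C (2 * g - 1)"
        unfolding gen_space_of_valid_triple[OF v, symmetric] by (auto simp: set_plus_def elt_set_times_def)
      have "\<alpha> \<in> reg_ring C" "\<beta> \<in> reg_ring C" using ab by (auto simp: W_def)
      moreover have e: "l = \<alpha> * F + \<beta> * G" using ab(1) by (simp add: mult.commute)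
      moreover have "\<alpha> * G1 - \<beta> * H \<in> WD C (?N + 1) D" unfolding comb e[symmetric] using key[OF lD] l by blast
      ultimately show "l \<in> ?V" using lD by blast
    qed
  qed
  then have run: "double_start_run C D F G G1 r \<longleftrightarrow>
      basis_or_fail C (WD C ?N (D + D)) (WD C ?N (D + D) \<inter> W C (3 * g - 1)) r"
    unfolding double_start_run_def doubling_run_def Let_def H_def by (simp only:)
  have "WD C ?N (D + D) \<inter> W C (3 * g - 1) = WD C (3 * g - 1) (D + D)" by (rule WD_Int_W[OF gDD]) simp
  moreover have "WD C (3 * g - 1) (D + D) = {0} \<longleftrightarrow> semi_typical C (D + D)"
    unfolding semi_typical_def Let_def dDD using gDD genus_pos by simp
  ultimately show "double_start_run C D F G G1 r \<longleftrightarrow>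
     (if semi_typical C (D + D) then \<exists>b. r = Some b \<and> echelon_basis C (WD C (3 * g + 1) (D + D)) b else r = None)"
    unfolding run basis_or_fail_def by simp
qed

lemma double_pic_class:
  assumes v: "valid_triple C F G G1 D"
  shows "\<forall>A f. f \<noteq> 0 \<longrightarrow> A + ninf g = principal_div C f + (D + D) \<longrightarrow>
    pic_class C A = pic_class C D \<otimes>\<^bsub>Pic0 C\<^esub> pic_class C D"
  by (rule add_pic_class[OF v v])

text \<open>
  The same with a trivial extra condition, as \<open>composite_correct\<close> expects it.
\<close>

lemma double_start_iff':
  assumes v: "valid_triple C F G G1 D"
  shows "double_start_run C D F G G1 r \<longleftrightarrow> (if True \<and> semi_typical C (D + D)
    then \<exists>b. r = Some b \<and> echelon_basis C (WD C (3 * g + 1) (D + D)) b else r = None)"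
  using double_start_iff(2)[OF v] by simp

lemmas double_correct =
  composite_correct[OF double_start_iff(3,4) double_start_iff' double_run_def double_pic_class]

end

theorem theorem4p1p5:
  fixes C :: "('k::field, 'a::field) curve" and g :: int
  assumes "smooth_pointed_curve C"
    and "g = int (genus C)"
    and "g \<ge> 1"
  shows
    \<comment> \<open>representation by valid triples\<close>
    "(\<forall>D F A. typical C D \<and> div_deg C D = g \<and> flip_via C (2 * g) D F A \<and> typical C A \<longrightarrow>
        (\<exists>G G1. valid_triple C F G G1 D))
    \<and>
    \<comment> \<open>negation\<close>
     (\<forall>D F G G1 A. valid_triple C F G G1 D \<and> affine_div C F = D + A \<longrightarrow>
        valid_triple C F G1 G A \<and> affine_div C F = A + D \<and> typical C A \<and> typical C D \<and>
        pic_class C A = inv\<^bsub>Pic0 C\<^esub> (pic_class C D))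
    \<and>
    \<comment> \<open>addition\<close>
     (\<forall>D F G G1 D' F' G' G1'.
        valid_triple C F G G1 D \<and> valid_triple C F' G' G1' D' \<longrightarrow>
        \<comment> \<open>step (a): the bases\<close>
        F *o W C (2 * g) + G *o W C (2 * g - 1) = WD C (4 * g) D \<and>
        F' *o W C (2 * g) + G' *o W C (2 * g - 1) = WD C (4 * g) D' \<and>
        (\<forall>b. selected_basis C F G b \<longrightarrow>
           length b = nat (g + 2) \<and> echelon_basis C (WD C (3 * g + 1) D) b) \<and>
        (\<forall>b'. selected_basis C F' G' b' \<longrightarrow>
           length b' = nat (g + 2) \<and> echelon_basis C (WD C (3 * g + 1) D') b') \<and>
        \<comment> \<open>step (a): the intersection procedure\<close>
        (\<exists>r. add_start_run C F G F' G' r) \<and>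
        (\<forall>r. add_start_run C F G F' G' r \<longrightarrow>
           (r \<noteq> None \<longleftrightarrow> disjoint_divs D D' \<and> semi_typical C (D + D')) \<and>
           (\<forall>b. r = Some b \<longrightarrow>
              (\<exists>s t. b = [s, t] \<and>
                 s \<in> WD C (3 * g) (D + D') \<and> has_deg C s (3 * g) \<and>
                 t \<in> WD C (3 * g + 1) (D + D') \<and> has_deg C t (3 * g + 1) \<and>
                 echelon_basis C (WD C (3 * g + 1) (D + D')) [s, t]))) \<and>
        \<comment> \<open>steps (b) and (c)\<close>
        (\<forall>s t D''. add_start_run C F G F' G' (Some [s, t]) \<and> affine_div C s = D + D' + D'' \<longrightarrow>
           (\<exists>r. flip_run C (2 * g + 1) (2 * g) s t r) \<and>
           (\<forall>r. flip_run C (2 * g + 1) (2 * g) s t r \<longrightarrow>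
              (r \<noteq> None \<longleftrightarrow> typical C (D + D')) \<and>
              (\<forall>b. r = Some b \<longrightarrow> (\<exists>F'' G''. b = [F'', G''] \<and> describes C F'' G'' D''))) \<and>
           (\<forall>F'' G'' D'''.
              flip_run C (2 * g + 1) (2 * g) s t (Some [F'', G'']) \<and>
              affine_div C F'' = D'' + D''' \<longrightarrow>
              (\<exists>r. flip_run C (2 * g + 1) g F'' G'' r) \<and>
              (\<forall>b. flip_run C (2 * g + 1) g F'' G'' (Some b) \<longrightarrow>
                 typical C D'' \<and> typical C D''' \<and>
                 (\<exists>F''' G'''. b = [F''', G'''] \<and> describes C F''' G''' D''' \<and>
                    (\<exists>c. c \<noteq> 0 \<and> F''' = emb C c * F'') \<and>
                    flip_run C (2 * g + 1) g F'' G'' (Some [F'', G''']) \<and>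
                    valid_triple C F''' G''' G'' D''' \<and>
                    pic_class C D''' = pic_class C D \<otimes>\<^bsub>Pic0 C\<^esub> pic_class C D')))) \<and>
        \<comment> \<open>the whole procedure\<close>
        (\<exists>r. add_run C F G F' G' r) \<and>
        (\<forall>r. add_run C F G F' G' r \<longrightarrow>
           (r \<noteq> None \<longleftrightarrow> disjoint_divs D D' \<and>
              (\<exists>s D'' F'' D'''. flip_via C (3 * g) (D + D') s D'' \<and>
                 flip_via C (2 * g) D'' F'' D''' \<and> typical C D'' \<and> typical C D''')) \<and>
           (\<forall>F''' G''' G''. r = Some (F''', G''', G'') \<longrightarrow>
              (\<exists>D'''. valid_triple C F''' G''' G'' D''' \<and>
                 pic_class C D''' = pic_class C D \<otimes>\<^bsub>Pic0 C\<^esub> pic_class C D'))))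
    \<and>
    \<comment> \<open>doubling\<close>
     (\<forall>D F G G1. valid_triple C F G G1 D \<longrightarrow>
        - (G * G1) / F \<in> W C (2 * g + 2) \<and>
        \<comment> \<open>the doubling procedure\<close>
        (\<exists>r. double_start_run C D F G G1 r) \<and>
        (\<forall>b. double_start_run C D F G G1 (Some b) \<longrightarrow>
           (\<exists>s t. b = [s, t] \<and>
              s \<in> WD C (3 * g + 1) (D + D) \<and> has_deg C s (3 * g) \<and>
              t \<in> WD C (3 * g + 1) (D + D) \<and> has_deg C t (3 * g + 1) \<and>
              echelon_basis C (WD C (3 * g + 1) (D + D)) [s, t])) \<and>
        \<comment> \<open>the two flips\<close>
        (\<forall>s t D''. double_start_run C D F G G1 (Some [s, t]) \<and> affine_div C s = D + D + D'' \<longrightarrow>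
           (\<exists>r. flip_run C (2 * g + 1) (2 * g) s t r) \<and>
           (\<forall>r. flip_run C (2 * g + 1) (2 * g) s t r \<longrightarrow>
              (r \<noteq> None \<longleftrightarrow> typical C (D + D)) \<and>
              (\<forall>b. r = Some b \<longrightarrow> (\<exists>F'' G''. b = [F'', G''] \<and> describes C F'' G'' D''))) \<and>
           (\<forall>F'' G'' D'''.
              flip_run C (2 * g + 1) (2 * g) s t (Some [F'', G'']) \<and>
              affine_div C F'' = D'' + D''' \<longrightarrow>
              (\<exists>r. flip_run C (2 * g + 1) g F'' G'' r) \<and>
              (\<forall>b. flip_run C (2 * g + 1) g F'' G'' (Some b) \<longrightarrow>
                 typical C D'' \<and> typical C D''' \<and>
                 (\<exists>F''' G'''. b = [F''', G'''] \<and> describes C F''' G''' D''' \<and>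
                    (\<exists>c. c \<noteq> 0 \<and> F''' = emb C c * F'') \<and>
                    flip_run C (2 * g + 1) g F'' G'' (Some [F'', G''']) \<and>
                    valid_triple C F''' G''' G'' D''' \<and>
                    pic_class C D''' = pic_class C D \<otimes>\<^bsub>Pic0 C\<^esub> pic_class C D)))) \<and>
        \<comment> \<open>the whole procedure\<close>
        (\<exists>r. double_run C D F G G1 r) \<and>
        (\<forall>r. double_run C D F G G1 r \<longrightarrow>
           (r \<noteq> None \<longleftrightarrow> typical C (D + D) \<and>
              (\<exists>s D''. flip_via C (3 * g) (D + D) s D'' \<and> typical C D'')) \<and>
           (\<forall>F''' G''' G''. r = Some (F''', G''', G'') \<longrightarrow>
              (\<exists>D'''. valid_triple C F''' G''' G'' D''' \<and>
                 pic_class C D''' = pic_class C D \<otimes>\<^bsub>Pic0 C\<^esub> pic_class C D))) \<and>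
        (\<forall>s D'' F'' D'''. typical C (D + D) \<and> flip_via C (3 * g) (D + D) s D'' \<and>
           flip_via C (2 * g) D'' F'' D''' \<longrightarrow> typical C D'''))"
proof -
  interpret positive_genus_curve C
    using assms by unfold_locales (auto simp: smooth_pointed_curve_def)
  show ?thesis
    unfolding assms(2)
  proof (intro conjI, goal_cases)
    case 1
    show ?case using representation by blast
  next
    case 2
    show ?case using negation by blast
  next
    case 3
    show ?case
    proof (intro allI impI, elim conjE, goal_cases)
      case (1 D F G G1 D' F' G' G1')
      note v = 1(1) and v' = 1(2)
      note gen = gen_space_of_valid_triple[OF v] gen_space_of_valid_triple[OF v']
      note sel = selected_basis_of_valid_triple(2)[OF v] selected_basis_of_valid_triple(2)[OF v']
      note correct = add_correct[OF v v']
      note flips = correct(4)[unfolded flips_spec_def]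
      show ?case
      proof (intro conjI)
        show "\<exists>r. add_start_run C F G F' G' r" "\<exists>r. add_run C F G F' G' r" by (rule correct)+
      qed (use gen sel in blast, use gen sel in blast, use sel in blast, use sel in blast,
          use correct(2,3) in blast, intro allI impI, elim conjE, rule flips, assumption, assumption,
          use correct(6)[unfolded add_success[OF v v']] correct(7) in blast)
    qed
  next
    case 4
    show ?case
    proof (intro allI impI, goal_cases)
      case (1 D F G G1)
      note v = 1
      note correct = double_correct[OF v v v v]
      note flips = correct(4)[unfolded flips_spec_def]
      have start: "\<exists>s t. b = [s, t] \<and>
          s \<in> WD C (3 * int (genus C) + 1) (D + D) \<and> has_deg C s (3 * int (genus C)) \<and>
          t \<in> WD C (3 * int (genus C) + 1) (D + D) \<and> has_deg C t (3 * int (genus C) + 1) \<and>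
          echelon_basis C (WD C (3 * int (genus C) + 1) (D + D)) [s, t]"
        if "double_start_run C D F G G1 (Some b)" for b
        using correct(3)[OF that] WD_mono[of "3 * int (genus C)" "3 * int (genus C) + 1" "D + D"] by auto
      have third: "typical C D'''"
        if "typical C (D + D) \<and> flip_via C (3 * int (genus C)) (D + D) s D'' \<and>
          flip_via C (2 * int (genus C)) D'' F'' D'''" for s D'' F'' D'''
        using flip_chain_typical[OF double_start_iff(3,4)[OF v]] that by blast
      show ?case
      proof (intro conjI)
        show "- (G * G1) / F \<in> W C (2 * int (genus C) + 2)" by (rule double_start_iff(1)[OF v])
        show "\<exists>r. double_start_run C D F G G1 r" "\<exists>r. double_run C D F G G1 r" by (rule correct)+
      qed (use start in blast, intro allI impI, elim conjE, rule flips, assumption, assumption,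
          use correct(6,7) in blast, use third in blast)
    qed
  qed
qed

end
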